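(* Let $(\mathcal{X}\times\mathcal{X}_r,\,p(y,y_r|x,x_r),\,\mathcal{Y}\times\mathcal{Y}_r)$ be a discrete memoryless one-way relay channel. Let $\hat{\mathcal{Y}}_r$ be a finite set, and let $p(x)$, $p(x_r)$ and $p(\hat y_r|y_r,x_r)$ be (conditional) probability mass functions, with $\hat y_r\in\hat{\mathcal{Y}}_r$. Let $(X,X_r,Y,Y_r,\hat Y_r)$ have joint distribution $p(x)p(x_r)p(y,y_r|x,x_r)p(\hat y_r|y_r,x_r)$, and suppose that $$I(X_r;Y)+I(\hat{Y}_r;X,Y|X_r)\geq I(\hat{Y}_r;Y_r|X_r).$$ Then every rate $R\ge 0$ satisfying $$R\leq \min\{\, I(X,X_r;Y)-I(\hat{Y}_r;Y_r|X,X_r,Y),\ \ I(X;Y,\hat{Y}_r|X_r)\,\}$$ is achievable for the relay channel (achieved by compress-forward in which the relay sends its compression index directly, without Wyner-Ziv binning, and the receiver jointly decodes the message and the compression index).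
   Context: All alphabets $\mathcal{X},\mathcal{X}_r,\mathcal{Y},\mathcal{Y}_r$ are finite. The channel is memoryless and full-duplex: given the channel inputs $(x_i,x_{ri})$ at time $i$, the outputs $(Y_i,Y_{ri})$ are drawn from $p(y,y_r|x_i,x_{ri})$, independently of the past. The sender transmits $X$, the relay transmits $X_r$ and observes $Y_r$, and the receiver observes $Y$. A $(2^{nR},n)$ code consists of: a message set $[1:2^{nR}]$ (with $2^{nR}$ rounded to an integer if necessary); an encoder assigning a codeword $x^n(m)\in\mathcal{X}^n$ to each message $m$; a relay encoder that assigns, at each time $i\in[1:n]$, a symbol $x_{ri}(y_r^{i-1})\in\mathcal{X}_r$ to each past received sequence $y_r^{i-1}\in\mathcal{Y}_r^{i-1}$; and a decoder that assigns to each $y^n\in\mathcal{Y}^n$ an estimate $\hat m$ or an error message. The average error probability is $P_e=\Pr\{\hat M\neq M\}$, with $M$ uniform on the message set. A rate is achievable if there is a sequence of $(2^{nR},n)$ codes with $P_e\to0$ as $n\to\infty$; as is customary, limits of achievable rates are also counted as achievable (i.e., the set of achievable rates is closed up). $I(\cdot;\cdot|\cdot)$ denotes (conditional) mutual information. *)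

theory Defs
  imports "HOL-Probability.Probability"
begin

section \<open>Discrete memoryless one-way relay channels\<close>

text \<open>
  The alphabets are finite types.  For channel inputs \<open>x\<close> (sender) and \<open>x\<^sub>r\<close> (relay),
  the channel law \<open>W x x\<^sub>r\<close> is the distribution \<open>p(y, y\<^sub>r | x, x\<^sub>r)\<close> of the pair of
  outputs at the receiver and at the relay.
\<close>

type_synonym ('x, 'xr, 'y, 'yr) relay_channel = "'x \<Rightarrow> 'xr \<Rightarrow> ('y \<times> 'yr) pmf"

text \<open>
  Times are numbered from 1: \<open>relay_encoder c i\<close> maps the \<open>i - 1\<close> relay outputs received
  before time \<open>i\<close>, oldest first, to the relay input at time \<open>i\<close>.  The decoder result
  \<^const>\<open>None\<close> is the error message.
\<close>

record ('x, 'xr, 'y, 'yr) relay_code =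
  encoder :: "nat \<Rightarrow> 'x list"
  relay_encoder :: "nat \<Rightarrow> 'yr list \<Rightarrow> 'xr"
  decoder :: "'y list \<Rightarrow> nat option"

definition messages :: "real \<Rightarrow> nat \<Rightarrow> nat set" where
  "messages R n = {1..nat \<lceil>2 powr (real n * R)\<rceil>}"

definition is_code :: "real \<Rightarrow> nat \<Rightarrow> ('x, 'xr, 'y, 'yr) relay_code \<Rightarrow> bool" where
  "is_code R n c \<longleftrightarrow>
     (\<forall>m\<in>messages R n. length (encoder c m) = n) \<and>
     (\<forall>ys m. length ys = n \<longrightarrow> decoder c ys = Some m \<longrightarrow> m \<in> messages R n)"

text \<open>
  Joint distribution of the outputs \<open>(Y\<^sub>j, Y\<^sub>r\<^sub>j)\<close>, \<open>1 \<le> j \<le> i\<close>, when the sender transmits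
  the codeword \<open>xs\<close> and the relay uses the encoder \<open>f\<close>.  The list position \<open>xs ! i\<close>
  is the sender's symbol at time \<open>Suc i\<close>.
\<close>

primrec channel_outputs ::
  "('x, 'xr, 'y, 'yr) relay_channel \<Rightarrow> 'x list \<Rightarrow> (nat \<Rightarrow> 'yr list \<Rightarrow> 'xr) \<Rightarrow> nat \<Rightarrow> ('y \<times> 'yr) list pmf"
where
  "channel_outputs W xs f 0 = return_pmf []"
| "channel_outputs W xs f (Suc i) =
     do {
       h \<leftarrow> channel_outputs W xs f i;
       z \<leftarrow> W (xs ! i) (f (Suc i) (map snd h));
       return_pmf (h @ [z])
     }"

text \<open>Joint distribution of the uniform message \<open>M\<close> and the decoder's output.\<close>

definition message_estimate ::
  "('x, 'xr, 'y, 'yr) relay_channel \<Rightarrow> real \<Rightarrow> nat \<Rightarrow> ('x, 'xr, 'y, 'yr) relay_code \<Rightarrow> (nat \<times> nat option) pmf"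
where
  "message_estimate W R n c =
     do {
       m \<leftarrow> pmf_of_set (messages R n);
       h \<leftarrow> channel_outputs W (encoder c m) (relay_encoder c) n;
       return_pmf (m, decoder c (map fst h))
     }"

definition error_prob ::
  "('x, 'xr, 'y, 'yr) relay_channel \<Rightarrow> real \<Rightarrow> nat \<Rightarrow> ('x, 'xr, 'y, 'yr) relay_code \<Rightarrow> real"
where
  "error_prob W R n c = measure_pmf.prob (message_estimate W R n c) {(m, e). e \<noteq> Some m}"

text \<open>The set of achievable rates is closed up: limits of achievable rates are achievable.\<close>

definition achievable :: "('x, 'xr, 'y, 'yr) relay_channel \<Rightarrow> real \<Rightarrow> bool" where
  "achievable W R \<longleftrightarrow>
     R \<in> closure {R'. R' \<ge> 0 \<and>
       (\<exists>c. (\<forall>n. is_code R' n (c n)) \<and> (\<lambda>n. error_prob W R' n (c n)) \<longlonglongrightarrow> 0)}"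


section \<open>Single-letter quantities\<close>

text \<open>Mutual information in bits of finite-valued random variables on a discrete space.\<close>

abbreviation mutual_info :: "'s pmf \<Rightarrow> ('s \<Rightarrow> 'a) \<Rightarrow> ('s \<Rightarrow> 'b) \<Rightarrow> real" where
  "mutual_info P A B \<equiv>
     prob_space.mutual_information (measure_pmf P) 2 (count_space UNIV) (count_space UNIV) A B"

abbreviation cond_mutual_info ::
  "'s pmf \<Rightarrow> ('s \<Rightarrow> 'a) \<Rightarrow> ('s \<Rightarrow> 'b) \<Rightarrow> ('s \<Rightarrow> 'c) \<Rightarrow> real"
where
  "cond_mutual_info P A B C \<equiv>
     prob_space.conditional_mutual_information (measure_pmf P) 2
       (count_space UNIV) (count_space UNIV) (count_space UNIV) A B C"

text \<open>
  Joint distribution \<open>p(x) p(x\<^sub>r) p(y, y\<^sub>r | x, x\<^sub>r) p(yh\<^sub>r | y\<^sub>r, x\<^sub>r)\<close> of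
  \<open>(X, X\<^sub>r, Y, Y\<^sub>r, Yh\<^sub>r)\<close>, where \<open>Yh\<^sub>r\<close> is the compressed version of \<open>Y\<^sub>r\<close>.
\<close>

definition joint_pmf ::
  "('x, 'xr, 'y, 'yr) relay_channel \<Rightarrow> 'x pmf \<Rightarrow> 'xr pmf \<Rightarrow> ('yr \<Rightarrow> 'xr \<Rightarrow> 'yh pmf)
     \<Rightarrow> ('x \<times> 'xr \<times> 'y \<times> 'yr \<times> 'yh) pmf"
where
  "joint_pmf W px pxr q =
     do {
       x \<leftarrow> px;
       xr \<leftarrow> pxr;
       (y, yr) \<leftarrow> W x xr;
       yh \<leftarrow> q yr xr;
       return_pmf (x, xr, y, yr, yh)
     }"

definition rv_X :: "'x \<times> 'xr \<times> 'y \<times> 'yr \<times> 'yh \<Rightarrow> 'x" where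
  "rv_X = (\<lambda>(x, xr, y, yr, yh). x)"

definition rv_Xr :: "'x \<times> 'xr \<times> 'y \<times> 'yr \<times> 'yh \<Rightarrow> 'xr" where
  "rv_Xr = (\<lambda>(x, xr, y, yr, yh). xr)"

definition rv_Y :: "'x \<times> 'xr \<times> 'y \<times> 'yr \<times> 'yh \<Rightarrow> 'y" where
  "rv_Y = (\<lambda>(x, xr, y, yr, yh). y)"

definition rv_Yr :: "'x \<times> 'xr \<times> 'y \<times> 'yr \<times> 'yh \<Rightarrow> 'yr" where
  "rv_Yr = (\<lambda>(x, xr, y, yr, yh). yr)"

definition rv_Yh :: "'x \<times> 'xr \<times> 'y \<times> 'yr \<times> 'yh \<Rightarrow> 'yh" where
  "rv_Yh = (\<lambda>(x, xr, y, yr, yh). yh)"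

end

theory Submission
  imports Defs "HOL-Real_Asymp.Real_Asymp"
begin

text \<open>
  In every block the relay quantizes its observation with a stochastic likelihood encoder: it picks
  the index \<open>k\<close> with probability proportional to \<open>p(u\<^sub>k | y\<^sub>r, x\<^sub>r) / p(u\<^sub>k | x\<^sub>r)\<close>.  The receiver
  picks the pair (message, index) of largest likelihood, based on the current block and the
  following one, in which the relay sends the index.  A unique maximizer is missed with at
  most twice the error probability of the decoder that draws the pair with probability proportional to
  its likelihood.  For random codes the success probability of the latter is the mean of \<open>1 / (a b)\<close>
  with sums \<open>a\<close>, \<open>b\<close> over the codebooks, and Jensen's inequality for this convex function
  replaces the sums by their means (the one-shot argument of Yassaee, Aref and Gohari).  The law of
  large numbers for the logarithms of the weights then gives the rates, and a union bound over
  blocks, each with fresh random codebooks, gives the block Markov code.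
\<close>

section \<open>Expectations under finitely supported distributions\<close>

text \<open>The index rate \<open>Rr\<close> is an auxiliary unknown. Quantizing needs
  \<open>Rr\<close> above I(Yh_r; Y_r | X_r). Competitors of the correct pair with a wrong message,
  a wrong index, or both, demand R < I(X; Y, Yh_r | X_r), Rr < I(X_r; Y) + I(Yh_r; X, Y | X_r) and R
  + Rr < I(X, X_r; Y) + I(Yh_r; X, Y | X_r). The hypothesis says that the bounds on
  \<open>Rr\<close> alone do not contradict each other; taking \<open>Rr\<close> near its lower end
  turns the last bound into the first term of the minimum, because Yh_r depends on (X, Y) only
  through (X_r, Y_r), so that I(Yh_r; Y_r | X, X_r, Y) is a difference of the informations above.
  Since the hypothesis is not strict, no room may be left between the bounds; randomly erasing the
  compressed observation creates it. The quantizer and the receiver use the same compression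
  codebook, so their normalizing sums are dependent; this is why Jensen is applied to a function of
  both sums at once. Treating the density ratios as abstract weights lets one one-shot bound serve
  single letters, blocks and erased observations.\<close>

abbreviation expect :: "'a pmf \<Rightarrow> ('a \<Rightarrow> real) \<Rightarrow> real" where
  "expect p f \<equiv> measure_pmf.expectation p f"

lemma finite_set_bind_pmf:
  "finite (set_pmf p) \<Longrightarrow> (\<And>x. x \<in> set_pmf p \<Longrightarrow> finite (set_pmf (f x)))
    \<Longrightarrow> finite (set_pmf (bind_pmf p f))"
  by (simp add: set_bind_pmf)

lemma expect_bind:
  assumes "finite (set_pmf p)" "\<And>x. x \<in> set_pmf p \<Longrightarrow> finite (set_pmf (f x))"
  shows "expect (bind_pmf p f) h = expect p (\<lambda>x. expect (f x) h)"
  by (subst pmf_expectation_bind[of "set_pmf p"])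
    (use assms in \<open>auto simp: integral_measure_pmf[of "set_pmf p"]\<close>)

lemma expect_finite: "finite (set_pmf p) \<Longrightarrow> expect p f = (\<Sum>x\<in>set_pmf p. pmf p x * f x)"
  by (subst integral_measure_pmf[of "set_pmf p"]) auto

lemma expect_cong: "(\<And>x. x \<in> set_pmf p \<Longrightarrow> f x = g x) \<Longrightarrow> expect p f = expect p g"
  by (intro integral_cong_AE) (auto intro: AE_pmfI)

lemma expect_mono:
  assumes "finite (set_pmf p)" "\<And>x. x \<in> set_pmf p \<Longrightarrow> f x \<le> g x"
  shows "expect p f \<le> expect p g"
  by (auto simp: expect_finite assms intro!: sum_mono mult_left_mono)

lemma expect_le_const:
  assumes "finite (set_pmf p)" "\<And>x. x \<in> set_pmf p \<Longrightarrow> f x \<le> c"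
  shows "expect p f \<le> c"
  using expect_mono[OF assms(1), of f "\<lambda>_. c"] assms(2) by simp

lemma expect_nonneg:
  assumes "\<And>x. x \<in> set_pmf p \<Longrightarrow> 0 \<le> f x"
  shows "0 \<le> expect p f"
  by (rule integral_nonneg_AE) (auto simp: AE_measure_pmf_iff assms)

lemma expect_add:
  assumes "finite (set_pmf p)"
  shows "expect p (\<lambda>x. f x + g x) = expect p f + expect p g"
  by (rule Bochner_Integration.integral_add) (auto intro: integrable_measure_pmf_finite assms)

lemma expect_diff:
  assumes "finite (set_pmf p)"
  shows "expect p (\<lambda>x. f x - g x) = expect p f - expect p g"
  by (rule Bochner_Integration.integral_diff) (auto intro: integrable_measure_pmf_finite assms)

lemma expect_sum:
  assumes "finite (set_pmf p)"
  shows "expect p (\<lambda>x. \<Sum>i\<in>I. f i x) = (\<Sum>i\<in>I. expect p (f i))"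
  by (rule Bochner_Integration.integral_sum) (auto intro: integrable_measure_pmf_finite assms)

lemma expect_indicator_Collect: "expect p (\<lambda>x. of_bool (P x)) = measure_pmf.prob p {x. P x}"
proof -
  have "expect p (\<lambda>x. of_bool (P x)) = expect p (indicator {x. P x})"
    by (intro expect_cong) (auto simp: indicator_def)
  then show ?thesis by simp
qed

text \<open>Bounds \<open>1 / (a b)\<close> from below by its tangent plane at the means of \<open>a\<close> and \<open>b\<close>.\<close>

lemma am_gm_three:
  fixes s t :: real assumes "s > 0" "t > 0" shows "s + t + 1 / (s * t) \<ge> 3"
proof -
  \<comment> \<open>With w the geometric mean of s and t, it suffices that 2w + 1/w^2 >= 3, that is
    2w^3 - 3w^2 + 1 = (w - 1)^2 (2w + 1) >= 0.\<close>
  define w where "w = sqrt (s * t)"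
  have "w > 0" and st: "s * t = w^2" using assms by (auto simp: w_def)
  have "s * t * (2 * w) \<le> s * t * (s + t)"
    using assms arith_geo_mean_sqrt[of s t] unfolding w_def by (intro mult_left_mono) auto
  then have "w^2 * (2 * w) \<le> s^2 * t + s * t^2"
    unfolding st[symmetric] by (simp add: power2_eq_square algebra_simps)
  moreover have "0 \<le> (w - 1)^2 * (2 * w + 1)" using \<open>w > 0\<close> by simp
  moreover have "(w - 1)^2 * (2 * w + 1) = w^2 * (2 * w) - 3 * w^2 + 1"
    by (simp add: power2_eq_square algebra_simps)
  ultimately have "s^2 * t + s * t^2 + 1 - 3 * s * t \<ge> 0"
    using st by simp
  then have "(s^2 * t + s * t^2 + 1 - 3 * s * t) / (s * t) \<ge> 0"
    using assms by simp
  also have "(s^2 * t + s * t^2 + 1 - 3 * s * t) / (s * t) = s + t + 1 / (s * t) - 3"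
    using assms by (simp add: field_simps power2_eq_square)
  finally show ?thesis by simp
qed

text \<open>Nothing is assumed about the dependence of \<open>a\<close> and \<open>b\<close>. The
  tangent plane at (A, B) is decreasing in both arguments, so upper bounds on the two means
  suffice.\<close>

lemma expect_inverse_mult_ge:
  assumes fin: "finite (set_pmf p)"
    and pos: "\<And>x. x \<in> set_pmf p \<Longrightarrow> a x > 0" "\<And>x. x \<in> set_pmf p \<Longrightarrow> b x > 0"
    and le: "expect p a \<le> A" "expect p b \<le> B" and "A > 0" "B > 0"
  shows "expect p (\<lambda>x. 1 / (a x * b x)) \<ge> 1 / (A * B)"
proof -
  have ptw: "(3 - a x / A - b x / B) / (A * B) \<le> 1 / (a x * b x)" if x: "x \<in> set_pmf p" for x
  proof -
    have "3 - a x / A - b x / B \<le> 1 / ((a x / A) * (b x / B))"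
      using am_gm_three[of "a x / A" "b x / B"] pos[OF x] \<open>A > 0\<close> \<open>B > 0\<close> by simp
    then have "(3 - a x / A - b x / B) / (A * B) \<le> 1 / ((a x / A) * (b x / B)) / (A * B)"
      using \<open>A > 0\<close> \<open>B > 0\<close> by (intro divide_right_mono) auto
    also have "\<dots> = 1 / (a x * b x)" using \<open>A > 0\<close> \<open>B > 0\<close> by simp
    finally show ?thesis .
  qed
  have "expect p a / A \<le> 1" "expect p b / B \<le> 1"
    using le \<open>A > 0\<close> \<open>B > 0\<close> by auto
  then have "1 \<le> 3 - expect p a / A - expect p b / B" by linarith
  then have "1 / (A * B) \<le> (3 - expect p a / A - expect p b / B) / (A * B)"
    using \<open>A > 0\<close> \<open>B > 0\<close> by (intro divide_right_mono) auto
  also have "\<dots> = expect p (\<lambda>x. (3 - a x / A - b x / B) / (A * B))"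
    by (simp add: expect_diff[OF fin])
  also have "\<dots> \<le> expect p (\<lambda>x. 1 / (a x * b x))"
    by (rule expect_mono[OF fin ptw])
  finally show ?thesis .
qed

lemma expect_commute:
  assumes "finite (set_pmf p)" "finite (set_pmf q)"
  shows "expect p (\<lambda>x. expect q (f x)) = expect q (\<lambda>y. expect p (\<lambda>x. f x y))"
  by (simp add: expect_finite assms sum_distrib_left mult.left_commute sum.swap[of _ "set_pmf p"])

lemma expect_pair:
  assumes "finite (set_pmf p)" "finite (set_pmf q)"
  shows "expect (pair_pmf p q) f = expect p (\<lambda>x. expect q (\<lambda>y. f (x, y)))"
  by (simp add: pair_pmf_def expect_bind assms set_bind_pmf)

lemma finite_set_Pi_pmf:
  assumes "finite I" "\<And>i. i \<in> I \<Longrightarrow> finite (set_pmf (p i))"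
  shows "finite (set_pmf (Pi_pmf I d p))"
  using assms by (auto simp: set_Pi_pmf)

lemma Pi_pmf_split:
  assumes "finite I" "i \<in> I"
  shows "Pi_pmf I d p = do {x \<leftarrow> p i; f \<leftarrow> Pi_pmf (I - {i}) d p; return_pmf (f(i := x))}"
proof -
  have "Pi_pmf I d p = Pi_pmf (insert i (I - {i})) d p"
    using assms by (simp add: insert_absorb)
  also have "\<dots> = do {x \<leftarrow> p i; f \<leftarrow> Pi_pmf (I - {i}) d p; return_pmf (f(i := x))}"
    using assms by (subst Pi_pmf_insert') auto
  finally show ?thesis .
qed

lemma expect_Pi_pmf_component:
  assumes "finite I" "i \<in> I"
  shows "expect (Pi_pmf I d p) (\<lambda>f. g (f i)) = expect (p i) g"
proof -
  have "p i = map_pmf (\<lambda>f. f i) (Pi_pmf I d p)"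
    using assms by (subst Pi_pmf_component) auto
  then show ?thesis by (metis integral_map_pmf)
qed

lemma bind_Pi_pmf_component:
  assumes "finite I" "i \<in> I"
  shows "bind_pmf (Pi_pmf I d p) (\<lambda>f. g (f i)) = bind_pmf (p i) g"
proof -
  have "p i = map_pmf (\<lambda>f. f i) (Pi_pmf I d p)"
    using assms by (subst Pi_pmf_component) auto
  then show ?thesis by (simp add: bind_map_pmf)
qed

lemma prob_bind_le:
  assumes "\<And>x. x \<in> set_pmf p \<Longrightarrow> measure_pmf.prob (f x) S \<le> c"
  shows "measure_pmf.prob (bind_pmf p f) S \<le> c"
proof -
  have "c \<ge> 0"
    using assms measure_nonneg order_trans set_pmf_not_empty by (metis all_not_in_conv)
  have "emeasure (bind_pmf p f) S = (\<integral>\<^sup>+x. emeasure (f x) S \<partial>p)"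
    by (rule emeasure_bind_pmf)
  also have "\<dots> \<le> (\<integral>\<^sup>+x. ennreal c \<partial>p)"
    by (intro nn_integral_mono_AE)
      (auto simp: AE_measure_pmf_iff measure_pmf.emeasure_eq_measure intro!: ennreal_leI assms)
  also have "\<dots> = ennreal c" by simp
  finally show ?thesis using \<open>c \<ge> 0\<close>
    by (simp add: measure_pmf.emeasure_eq_measure)
qed


section \<open>Memoryless products as lists\<close>

text \<open>Independent entries with individual laws. \<open>replicate_pmf\<close> has identical
  entries only, whereas a channel output depends on the input symbol of its position.\<close>

primrec mapM_pmf :: "('a \<Rightarrow> 'b pmf) \<Rightarrow> 'a list \<Rightarrow> 'b list pmf" where
  "mapM_pmf f [] = return_pmf []"
| "mapM_pmf f (w # ws) = do {y \<leftarrow> f w; ys \<leftarrow> mapM_pmf f ws; return_pmf (y # ys)}"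

lemma mapM_pmf_const: "mapM_pmf (\<lambda>_. p) ws = replicate_pmf (length ws) p"
  by (induction ws) auto

lemma set_mapM_pmf:
  "set_pmf (mapM_pmf f ws) = {ys. length ys = length ws \<and> (\<forall>i<length ws. ys ! i \<in> set_pmf (f (ws ! i)))}"
proof (induction ws)
  case (Cons w ws)
  show ?case
  proof (intro set_eqI iffI, goal_cases)
    case (1 x)
    then obtain y ys where "x = y # ys" "y \<in> set_pmf (f w)" "ys \<in> set_pmf (mapM_pmf f ws)"
      by (auto simp: set_bind_pmf)
    then show ?case using Cons by (auto simp: nth_Cons split: nat.splits)
  next
    case (2 x)
    then obtain y ys where x: "x = y # ys" by (cases x) auto
    then have "y \<in> set_pmf (f w)" "length ys = length ws" 
      "\<And>i. i < length ws \<Longrightarrow> ys ! i \<in> set_pmf (f (ws ! i))"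
      using 2 by (auto simp: nth_Cons dest: spec[of _ "Suc _"] spec[of _ 0])
    then show ?case using Cons x by (auto simp: set_bind_pmf)
  qed
qed simp

lemma length_mapM_pmf: "ys \<in> set_pmf (mapM_pmf f ws) \<Longrightarrow> length ys = length ws"
  by (simp add: set_mapM_pmf)

lemma finite_set_mapM_pmf:
  "(\<And>w. w \<in> set ws \<Longrightarrow> finite (set_pmf (f w))) \<Longrightarrow> finite (set_pmf (mapM_pmf f ws))"
  by (induction ws) (auto simp: set_bind_pmf)

lemma pmf_mapM_pmf:
  "length ys = length ws \<Longrightarrow> pmf (mapM_pmf f ws) ys = (\<Prod>i<length ws. pmf (f (ws ! i)) (ys ! i))"
proof (induction ws arbitrary: ys)
  case (Cons w ws)
  then obtain y ys' where ys: "ys = y # ys'" "length ys' = length ws" by (cases ys) auto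
  have "mapM_pmf f (w # ws) = map_pmf (\<lambda>(y, ys). y # ys) (pair_pmf (f w) (mapM_pmf f ws))"
    by (simp add: pair_pmf_def map_pmf_def bind_assoc_pmf bind_return_pmf)
  then have "pmf (mapM_pmf f (w # ws)) ((\<lambda>(y, ys). y # ys) (y, ys')) 
      = pmf (pair_pmf (f w) (mapM_pmf f ws)) (y, ys')"
    by (simp only:) (rule pmf_map_inj', auto simp: inj_def)
  then show ?case using Cons ys by (simp add: pmf_pair prod.lessThan_Suc_shift del: mapM_pmf.simps prod.lessThan_Suc)
qed auto

lemma expect_mapM_prod:
  assumes "\<And>w. w \<in> set ws \<Longrightarrow> finite (set_pmf (f w))"
  shows "expect (mapM_pmf f ws) (\<lambda>ys. \<Prod>i<length ws. g i (ys ! i))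
       = (\<Prod>i<length ws. expect (f (ws ! i)) (g i))"
  using assms
proof (induction ws arbitrary: g)
  case (Cons w ws)
  have fin: "finite (set_pmf (mapM_pmf f ws))" using Cons.prems by (intro finite_set_mapM_pmf) auto
  have "expect (mapM_pmf f (w # ws)) (\<lambda>ys. \<Prod>i<length (w # ws). g i (ys ! i))
      = expect (f w) (\<lambda>y. expect (mapM_pmf f ws) (\<lambda>ys. g 0 y * (\<Prod>i<length ws. g (Suc i) (ys ! i))))"
    using Cons.prems fin
    by (simp add: expect_bind set_bind_pmf prod.lessThan_Suc_shift del: prod.lessThan_Suc)
  also have "\<dots> = (\<Prod>i<length (w # ws). expect (f ((w # ws) ! i)) (g i))"
    using Cons.IH[of "\<lambda>i. g (Suc i)"] Cons.prems
    by (simp add: prod.lessThan_Suc_shift del: prod.lessThan_Suc)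
  finally show ?case .
qed simp

text \<open>Two memoryless stages in a row are one memoryless stage with the composed letter law.
  Iterating this turns a whole block experiment into independent letters.\<close>

lemma zip_mapM_pmf:
  "do {ws \<leftarrow> mapM_pmf g vs; ys \<leftarrow> mapM_pmf f ws; return_pmf (zip ws ys)}
   = mapM_pmf (\<lambda>v. do {w \<leftarrow> g v; y \<leftarrow> f w; return_pmf (w, y)}) vs"
proof (induction vs)
  case (Cons v vs)
  have "do {ws \<leftarrow> mapM_pmf g (v # vs); ys \<leftarrow> mapM_pmf f ws; return_pmf (zip ws ys)}
    = do {w \<leftarrow> g v; ws \<leftarrow> mapM_pmf g vs; y \<leftarrow> f w; ys \<leftarrow> mapM_pmf f ws; return_pmf ((w, y) # zip ws ys)}"
    by (simp add: bind_assoc_pmf bind_return_pmf)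
  also have "\<dots> = do {w \<leftarrow> g v; y \<leftarrow> f w; ws \<leftarrow> mapM_pmf g vs; ys \<leftarrow> mapM_pmf f ws; return_pmf ((w, y) # zip ws ys)}"
    by (intro bind_pmf_cong refl) (rule bind_commute_pmf)
  also have "\<dots> = do {w \<leftarrow> g v; y \<leftarrow> f w; 
      zs \<leftarrow> do {ws \<leftarrow> mapM_pmf g vs; ys \<leftarrow> mapM_pmf f ws; return_pmf (zip ws ys)}; return_pmf ((w, y) # zs)}"
    by (simp add: bind_assoc_pmf bind_return_pmf)
  also have "\<dots> = mapM_pmf (\<lambda>v. do {w \<leftarrow> g v; y \<leftarrow> f w; return_pmf (w, y)}) (v # vs)"
    unfolding Cons.IH by (simp add: bind_assoc_pmf bind_return_pmf)
  finally show ?case .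
qed (simp add: bind_return_pmf)

section \<open>One-shot compress-forward\<close>

definition strict_argmax :: "'p set \<Rightarrow> ('p \<Rightarrow> real) \<Rightarrow> 'p" where
  "strict_argmax S w = (SOME p. p \<in> S \<and> (\<forall>p'\<in>S - {p}. w p' < w p))"

text \<open>If \<open>p\<close> is not returned, it is not the strict maximizer, so another element
  weighs at least as much; then \<open>p\<close> has at most half of the total weight and the right
  side is at least 1. Ties, where the choice is unspecified, are covered by the same
  argument.\<close>

lemma strict_argmax_error_le:
  assumes "finite S" "p \<in> S" "\<And>p'. p' \<in> S \<Longrightarrow> w p' \<ge> 0"
  shows "of_bool (strict_argmax S w \<noteq> p) \<le> 2 * (1 - w p / (\<Sum>p'\<in>S. w p'))"
proof (cases "strict_argmax S w = p")
  case True
  have "w p \<le> (\<Sum>p'\<in>S. w p')" using assms by (intro member_le_sum) auto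
  then have "w p / (\<Sum>p'\<in>S. w p') \<le> 1"
    using assms by (intro divide_le_eq_1[THEN iffD2]) (auto simp: sum_nonneg less_le)
  with True show ?thesis by simp
next
  case False
  have "\<exists>p'\<in>S - {p}. w p \<le> w p'"
  proof (rule ccontr)
    assume "\<not> ?thesis"
    then have p: "p \<in> S \<and> (\<forall>p'\<in>S - {p}. w p' < w p)" using assms by (auto simp: not_le)
    have "strict_argmax S w = p" unfolding strict_argmax_def
    proof (rule some_equality, rule p)
      fix p' assume "p' \<in> S \<and> (\<forall>p''\<in>S - {p'}. w p'' < w p')"
      with p show "p' = p" by (metis DiffI insertE empty_iff order.asym)
    qed
    with False show False by simp
  qed
  then obtain p' where p': "p' \<in> S" "p' \<noteq> p" "w p \<le> w p'" by auto
  have "w p + w p' = (\<Sum>p''\<in>{p, p'}. w p'')" using p' by simp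
  also have "\<dots> \<le> (\<Sum>p''\<in>S. w p'')" using assms p' by (intro sum_mono2) auto
  finally have "2 * w p \<le> (\<Sum>p''\<in>S. w p'')" using p' by simp
  moreover have "0 \<le> w p" using assms by auto
  ultimately have "w p / (\<Sum>p''\<in>S. w p'') \<le> 1 / 2"
    by (cases "w p = 0") (auto simp: field_simps)
  then show ?thesis using False by (simp add: mult.commute)
qed

text \<open>Asking only for lower bounds also covers a vanishing total likelihood: the quotients are
  then 0 by the convention for division and any law on \<open>{..<K}\<close> qualifies.\<close>

definition likelihood_pmf :: "nat \<Rightarrow> (nat \<Rightarrow> real) \<Rightarrow> nat pmf" where
  "likelihood_pmf K l = (SOME p. set_pmf p \<subseteq> {..<K} \<and> (\<forall>k<K. l k / (\<Sum>\<kappa><K. l \<kappa>) \<le> pmf p k))"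

lemma likelihood_pmf:
  assumes "K > 0" "\<And>k. l k \<ge> 0"
  shows "set_pmf (likelihood_pmf K l) \<subseteq> {..<K}"
    and "k < K \<Longrightarrow> l k / (\<Sum>\<kappa><K. l \<kappa>) \<le> pmf (likelihood_pmf K l) k"
proof -
  have "\<exists>p. set_pmf p \<subseteq> {..<K} \<and> (\<forall>k<K. l k / (\<Sum>\<kappa><K. l \<kappa>) \<le> pmf p k)"
  proof (cases "(\<Sum>\<kappa><K. l \<kappa>) = 0")
    case True
    then show ?thesis using assms(1) by (intro exI[of _ "return_pmf 0"]) auto
  next
    case False
    define f where "f k = (if k < K then l k / (\<Sum>\<kappa><K. l \<kappa>) else 0)" for k
    have nn: "f k \<ge> 0" for k unfolding f_def by (auto intro!: divide_nonneg_nonneg sum_nonneg assms)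
    have "(\<integral>\<^sup>+k. ennreal (f k) \<partial>count_space UNIV) = (\<integral>\<^sup>+k. ennreal (f k) \<partial>count_space {..<K})"
      by (rule nn_integral_count_space_eq) (auto simp: f_def)
    also have "\<dots> = ennreal (\<Sum>k<K. f k)"
      using nn by (subst nn_integral_count_space_finite) (auto simp: sum_ennreal)
    also have "(\<Sum>k<K. f k) = 1"
      using False by (simp add: f_def sum_divide_distrib[symmetric])
    finally have *: "(\<integral>\<^sup>+k. ennreal (f k) \<partial>count_space UNIV) = 1" by simp
    have pmf: "pmf (embed_pmf f) k = f k" for k by (rule pmf_embed_pmf[OF nn *])
    have "set_pmf (embed_pmf f) \<subseteq> {..<K}" using pmf by (auto simp: set_pmf_eq f_def split: if_splits)
    then show ?thesis using pmf by (intro exI[of _ "embed_pmf f"]) (auto simp: f_def)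
  qed
  from someI_ex[OF this] show "set_pmf (likelihood_pmf K l) \<subseteq> {..<K}"
    and "k < K \<Longrightarrow> l k / (\<Sum>\<kappa><K. l \<kappa>) \<le> pmf (likelihood_pmf K l) k"
    unfolding likelihood_pmf_def by auto
qed

text \<open>
  \<open>t\<close> is the law of a compression codeword given the relay input and \<open>q\<close> the test channel.  The
  remaining parameters stand for ratios of conditional densities, of which only the listed
  inequalities are used; this makes the assumptions stable under products and erasures:
  \<open>e = p(u | y\<^sub>r, x\<^sub>r) / p(u | x\<^sub>r)\<close>,
  \<open>D1 = p(y, u | x, x\<^sub>r) / (p(y | x\<^sub>r) p(u | x\<^sub>r))\<close>, \<open>A1\<close> and \<open>A2\<close> its means over an
  independent \<open>x\<close> and an independent \<open>u\<close>, and \<open>D2 = p(y | x\<^sub>r) / p(y)\<close>.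
\<close>

locale cf_weights =
  fixes px :: "'a pmf" and pxr :: "'b pmf" and V :: "'a \<Rightarrow> 'b \<Rightarrow> ('c \<times> 'd) pmf"
    and t :: "'b \<Rightarrow> 'u pmf" and q :: "'d \<Rightarrow> 'b \<Rightarrow> 'u pmf"
    and e :: "'d \<Rightarrow> 'b \<Rightarrow> 'u \<Rightarrow> real" and D1 :: "'a \<Rightarrow> 'b \<Rightarrow> 'c \<Rightarrow> 'u \<Rightarrow> real"
    and A1 :: "'b \<Rightarrow> 'c \<Rightarrow> 'u \<Rightarrow> real" and A2 :: "'a \<Rightarrow> 'b \<Rightarrow> 'c \<Rightarrow> real"
    and D2 :: "'b \<Rightarrow> 'c \<Rightarrow> real"
  assumes fin: "finite (set_pmf px)" "finite (set_pmf pxr)" "\<And>x r. finite (set_pmf (V x r))"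
      "\<And>r. finite (set_pmf (t r))" "\<And>v r. finite (set_pmf (q v r))"
    and nonneg: "\<And>v r u. e v r u \<ge> 0" "\<And>x r y u. D1 x r y u \<ge> 0" "\<And>r y u. A1 r y u \<ge> 0"
      "\<And>x r y. A2 x r y \<ge> 0" "\<And>r y. D2 r y \<ge> 0"
    and e_mean: "\<And>v r. r \<in> set_pmf pxr \<Longrightarrow> expect (t r) (e v r) \<le> 1"
    and e_density: "\<And>x r y v u. x \<in> set_pmf px \<Longrightarrow> r \<in> set_pmf pxr \<Longrightarrow> (y, v) \<in> set_pmf (V x r) \<Longrightarrow>
        pmf (t r) u * e v r u = pmf (q v r) u"
    and D1_mean_x: "\<And>r y u. r \<in> set_pmf pxr \<Longrightarrow> expect px (\<lambda>x. D1 x r y u) \<le> A1 r y u"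
    and D1_mean_u: "\<And>x r y. r \<in> set_pmf pxr \<Longrightarrow> expect (t r) (D1 x r y) \<le> A2 x r y"
    and A2_mean: "\<And>r y. r \<in> set_pmf pxr \<Longrightarrow> expect px (\<lambda>x. A2 x r y) \<le> 1"
    and D2_mean: "\<And>y. expect pxr (\<lambda>r. D2 r y) \<le> 1"
    and pos: "\<And>x r y v u. x \<in> set_pmf px \<Longrightarrow> r \<in> set_pmf pxr \<Longrightarrow> (y, v) \<in> set_pmf (V x r) \<Longrightarrow>
        u \<in> set_pmf (q v r) \<Longrightarrow> e v r u > 0 \<and> D1 x r y u > 0 \<and> A1 r y u > 0 \<and> A2 x r y > 0 \<and> D2 r y > 0"
begin

text \<open>The summands of \<open>beta\<close> are the expected relative weights of the correct pair, of the pairs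
  with a wrong message, with a wrong index, and with both wrong.\<close>

definition beta :: "nat \<Rightarrow> nat \<Rightarrow> 'a \<Rightarrow> 'b \<Rightarrow> 'c \<Rightarrow> 'u \<Rightarrow> 'b \<Rightarrow> 'c \<Rightarrow> real" where
  "beta M K x r y u r2 y2 = 1 + (real M - 1) * (A1 r y u / D1 x r y u)
     + (real K - 1) * (A2 x r y / (D1 x r y u * D2 r2 y2))
     + (real M - 1) * (real K - 1) / (D1 x r y u * D2 r2 y2)"

text \<open>The value of 1 / (a b) at bounds for the means of the two sums: (e + (K - 1)) / K for
  the quantizer's average of \<open>e\<close> over its codebook, whose K - 1 other entries have mean
  at most 1, and \<open>beta\<close> for the receiver.\<close>

definition gain :: "nat \<Rightarrow> nat \<Rightarrow> 'a \<Rightarrow> 'b \<Rightarrow> 'c \<times> 'd \<Rightarrow> 'u \<Rightarrow> 'b \<Rightarrow> 'c \<times> 'd \<Rightarrow> real" where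
  "gain M K x r z u r2 z2 =
     1 / ((e (snd z) r u + (real K - 1)) / real K * beta M K x r (fst z) u r2 (fst z2))"

text \<open>The ideal law: the compression codeword comes directly from the test channel and the
  next block is independent of the current one. The mean of \<open>gain\<close> under it,
  \<open>Phi\<close>, will bound the success probability of the likelihood draw from below.\<close>

definition Q :: "('a \<times> 'b \<times> ('c \<times> 'd) \<times> 'u \<times> 'a \<times> 'b \<times> ('c \<times> 'd)) pmf" where
  "Q = do {x \<leftarrow> px; r \<leftarrow> pxr; z \<leftarrow> V x r; u \<leftarrow> q (snd z) r;
           x2 \<leftarrow> px; r2 \<leftarrow> pxr; z2 \<leftarrow> V x2 r2; return_pmf (x, r, z, u, x2, r2, z2)}"

definition Phi :: "nat \<Rightarrow> nat \<Rightarrow> real" where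
  "Phi M K = expect Q (\<lambda>(x, r, z, u, x2, r2, z2). gain M K x r z u r2 z2)"

text \<open>The likelihood ratio of a pair. In the following block the receiver does not know the
  message yet, so that block enters only through \<open>D2\<close>, with the sender's codeword
  averaged out.\<close>

definition weight ::
  "(nat \<Rightarrow> 'a) \<Rightarrow> 'b \<Rightarrow> (nat \<Rightarrow> 'u) \<Rightarrow> (nat \<Rightarrow> 'b) \<Rightarrow> 'c \<Rightarrow> 'c \<Rightarrow> nat \<times> nat \<Rightarrow> real" where
  "weight X r us \<rho> y y2 = (\<lambda>(m, k). D1 (X m) r y (us k) * D2 (\<rho> k) y2)"

text \<open>The entries \<open>x\<close>, \<open>u\<close>, \<open>r2\<close> of the correct pair
  are held fixed; the remaining codebook entries are independent of them and of the outputs. Both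
  denominators depend on the same random \<open>us\<close>, which is what
  \<open>expect_inverse_mult_ge\<close> tolerates.\<close>

lemma expect_jensen:
  assumes m: "m < M" and k: "k < K" and x: "x \<in> set_pmf px" and r: "r \<in> set_pmf pxr"
    and z: "(y, v) \<in> set_pmf (V x r)" and u: "u \<in> set_pmf (q v r)" and D2: "D2 r2 y2 > 0"
  shows "expect (pair_pmf (Pi_pmf ({..<M} - {m}) dx (\<lambda>_. px))
          (pair_pmf (Pi_pmf ({..<K} - {k}) du (\<lambda>_. t r)) (Pi_pmf ({..<K} - {k}) dr (\<lambda>_. pxr))))
      (\<lambda>(X, us, \<rho>). e v r u / (\<Sum>\<kappa><K. e v r ((us(k := u)) \<kappa>)) *
        (weight (X(m := x)) r (us(k := u)) (\<rho>(k := r2)) y y2 (m, k) /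
        (\<Sum>p\<in>{..<M} \<times> {..<K}. weight (X(m := x)) r (us(k := u)) (\<rho>(k := r2)) y y2 p)))
    \<ge> e v r u / real K * gain M K x r (y, v) u r2 (y2, v2)" (is "expect ?J ?f \<ge> _")
proof -
  note pos = pos[OF x r z u]
  let ?X = "Pi_pmf ({..<M} - {m}) dx (\<lambda>_. px)" and ?U = "Pi_pmf ({..<K} - {k}) du (\<lambda>_. t r)"
    and ?R = "Pi_pmf ({..<K} - {k}) dr (\<lambda>_. pxr)"
  have fX: "finite (set_pmf ?X)" and fU: "finite (set_pmf ?U)" and fR: "finite (set_pmf ?R)"
    using fin by (auto intro!: finite_set_Pi_pmf)
  have fJ: "finite (set_pmf ?J)" using fX fU fR by simp
  \<comment> \<open>The sums are normalized, by K and by the weight \<open>d\<close> of the correct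
    pair, so that the integrand is the constant e / K times 1 / (a b).\<close>
  define a where "a = (\<lambda>(X::nat \<Rightarrow> 'a, us, \<rho>::nat \<Rightarrow> 'b). (\<Sum>\<kappa><K. e v r ((us(k := u)) \<kappa>)) / real K)"
  define d where "d = D1 x r y u * D2 r2 y2"
  define b where "b = (\<lambda>(X, us, \<rho>).
      (\<Sum>p\<in>{..<M} \<times> {..<K}. weight (X(m := x)) r (us(k := u)) (\<rho>(k := r2)) y y2 p) / d)"
  have d: "d > 0" using pos D2 by (simp add: d_def)
  have a_pos: "a w > 0" if "w \<in> set_pmf ?J" for w
  proof -
    obtain X us \<rho> where w: "w = (X, us, \<rho>)" by (cases w)
    have "e v r ((us(k := u)) k) \<le> (\<Sum>\<kappa><K. e v r ((us(k := u)) \<kappa>))"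
      using k by (intro member_le_sum) (auto intro: nonneg)
    then have "0 < (\<Sum>\<kappa><K. e v r ((us(k := u)) \<kappa>))" using pos by simp
    then show ?thesis using k by (simp add: a_def w)
  qed
  have b_pos: "b w > 0" if "w \<in> set_pmf ?J" for w
  proof -
    obtain X us \<rho> where w: "w = (X, us, \<rho>)" by (cases w)
    have "weight (X(m := x)) r (us(k := u)) (\<rho>(k := r2)) y y2 (m, k) \<le>
      (\<Sum>p\<in>{..<M} \<times> {..<K}. weight (X(m := x)) r (us(k := u)) (\<rho>(k := r2)) y y2 p)"
      using m k by (intro member_le_sum) (auto simp: weight_def intro!: nonneg mult_nonneg_nonneg)
    moreover have "weight (X(m := x)) r (us(k := u)) (\<rho>(k := r2)) y y2 (m, k) = d"
      by (simp add: weight_def d_def)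
    ultimately show ?thesis using d by (simp add: b_def w)
  qed
  have f_eq: "?f w = e v r u / real K * (1 / (a w * b w))" for w
  proof -
    obtain X us \<rho> where w: "w = (X, us, \<rho>)" by (cases w)
    have "weight (X(m := x)) r (us(k := u)) (\<rho>(k := r2)) y y2 (m, k) = d"
      by (simp add: weight_def d_def)
    then show ?thesis using k unfolding w a_def b_def by simp
  qed
  have "expect ?J a = ((\<Sum>\<kappa><K. expect ?U (\<lambda>us. e v r ((us(k := u)) \<kappa>)))) / real K"
    unfolding a_def using fX fU fR by (simp add: expect_pair expect_sum case_prod_beta cong: if_cong)
  also have "(\<Sum>\<kappa><K. expect ?U (\<lambda>us. e v r ((us(k := u)) \<kappa>)))
      = e v r u + (\<Sum>\<kappa>\<in>{..<K} - {k}. expect ?U (\<lambda>us. e v r ((us(k := u)) \<kappa>)))"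
    using k by (subst sum.remove[of _ k]) auto
  also have "\<dots> \<le> e v r u + (\<Sum>\<kappa>\<in>{..<K} - {k}. 1)"
  proof (intro add_left_mono sum_mono)
    fix \<kappa> assume \<kappa>: "\<kappa> \<in> {..<K} - {k}"
    have "expect ?U (\<lambda>us. e v r ((us(k := u)) \<kappa>)) = expect ?U (\<lambda>us. e v r (us \<kappa>))"
      using \<kappa> by simp
    also have "\<dots> = expect (t r) (e v r)" using \<kappa> by (intro expect_Pi_pmf_component) auto
    finally show "expect ?U (\<lambda>us. e v r ((us(k := u)) \<kappa>)) \<le> 1" using e_mean[OF r] by simp
  qed
  also have "\<dots> = e v r u + (real K - 1)" using k by simp
  finally have a_mean: "expect ?J a \<le> (e v r u + (real K - 1)) / real K"
    by (simp add: divide_right_mono)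
  define G where "G m' \<kappa> = expect ?X (\<lambda>X. expect ?U (\<lambda>us. expect ?R (\<lambda>\<rho>.
      weight (X(m := x)) r (us(k := u)) (\<rho>(k := r2)) y y2 (m', \<kappa>))))" for m' \<kappa>
  have "expect ?J b = (\<Sum>m'<M. \<Sum>\<kappa><K. G m' \<kappa>) / d"
    unfolding b_def G_def using fX fU fR
    by (simp add: expect_pair expect_sum case_prod_beta sum.cartesian_product)
  \<comment> \<open>Four groups of pairs: the correct one, wrong index, wrong message, both wrong.
    Averaging over the independent entries replaces a wrong \<open>u\<close> by \<open>A2\<close>, a
    wrong \<open>x\<close> by \<open>A1\<close>, and leaves at most 1 when both are wrong; a wrong
    relay codeword makes the \<open>D2\<close> factor at most 1 on average.\<close>
  also have "(\<Sum>m'<M. \<Sum>\<kappa><K. G m' \<kappa>) = G m k + (\<Sum>\<kappa>\<in>{..<K} - {k}. G m \<kappa>)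
      + (\<Sum>m'\<in>{..<M} - {m}. G m' k + (\<Sum>\<kappa>\<in>{..<K} - {k}. G m' \<kappa>))"
    using m k by (simp add: sum.remove[of "{..<M}" m] sum.remove[of "{..<K}" k])
  also have "G m k = d" by (simp add: G_def weight_def d_def)
  also have "(\<Sum>\<kappa>\<in>{..<K} - {k}. G m \<kappa>) \<le> (\<Sum>\<kappa>\<in>{..<K} - {k}. A2 x r y)"
  proof (rule sum_mono)
    fix \<kappa> assume \<kappa>: "\<kappa> \<in> {..<K} - {k}"
    have "G m \<kappa> = expect ?U (\<lambda>us. D1 x r y (us \<kappa>)) * expect ?R (\<lambda>\<rho>. D2 (\<rho> \<kappa>) y2)"
      using \<kappa> by (simp add: G_def weight_def)
    also have "\<dots> = expect (t r) (D1 x r y) * expect pxr (\<lambda>r. D2 r y2)"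
      using \<kappa> expect_Pi_pmf_component[of "{..<K} - {k}" \<kappa> du "\<lambda>_. t r" "D1 x r y"]
       expect_Pi_pmf_component[of "{..<K} - {k}" \<kappa> dr "\<lambda>_. pxr" "\<lambda>r. D2 r y2"] by simp
    also have "\<dots> \<le> A2 x r y * 1"
      by (intro mult_mono D1_mean_u D2_mean r nonneg expect_nonneg)
    finally show "G m \<kappa> \<le> A2 x r y" by simp
  qed
  also have "(\<Sum>m'\<in>{..<M} - {m}. G m' k + (\<Sum>\<kappa>\<in>{..<K} - {k}. G m' \<kappa>))
     \<le> (\<Sum>m'\<in>{..<M} - {m}. A1 r y u * D2 r2 y2 + (\<Sum>\<kappa>\<in>{..<K} - {k}. 1))"
  proof (intro sum_mono add_mono)
    fix m' assume m': "m' \<in> {..<M} - {m}"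
    have "G m' k = expect ?X (\<lambda>X. D1 (X m') r y u) * D2 r2 y2"
      using m' by (simp add: G_def weight_def)
    also have "expect ?X (\<lambda>X. D1 (X m') r y u) = expect px (\<lambda>x. D1 x r y u)"
      using m' by (intro expect_Pi_pmf_component) auto
    also have "\<dots> * D2 r2 y2 \<le> A1 r y u * D2 r2 y2"
      by (intro mult_right_mono D1_mean_x r nonneg)
    finally show "G m' k \<le> A1 r y u * D2 r2 y2" .
    fix \<kappa> assume \<kappa>: "\<kappa> \<in> {..<K} - {k}"
    have "G m' \<kappa> = expect ?X (\<lambda>X. expect ?U (\<lambda>us. D1 (X m') r y (us \<kappa>))) * expect ?R (\<lambda>\<rho>. D2 (\<rho> \<kappa>) y2)"
      using m' \<kappa> by (simp add: G_def weight_def)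
    also have "expect ?R (\<lambda>\<rho>. D2 (\<rho> \<kappa>) y2) = expect pxr (\<lambda>r. D2 r y2)"
      using \<kappa> by (intro expect_Pi_pmf_component) auto
    also have "expect ?X (\<lambda>X. expect ?U (\<lambda>us. D1 (X m') r y (us \<kappa>)))
       = expect ?X (\<lambda>X. expect (t r) (D1 (X m') r y))"
      using \<kappa> by (intro expect_cong expect_Pi_pmf_component) auto
    also have "\<dots> = expect px (\<lambda>x. expect (t r) (D1 x r y))"
      using m' by (intro expect_Pi_pmf_component) auto
    also have "\<dots> \<le> expect px (\<lambda>x. A2 x r y)"
      by (intro expect_mono fin D1_mean_u r)
    also have "\<dots> \<le> 1" by (rule A2_mean[OF r])
    also have "1 * expect pxr (\<lambda>r. D2 r y2) \<le> 1 * 1" by (intro mult_left_mono D2_mean) auto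
    finally show "G m' \<kappa> \<le> 1" 
      by (auto intro: expect_nonneg nonneg mult_right_mono)
  qed
  also have "d + (\<Sum>\<kappa>\<in>{..<K} - {k}. A2 x r y)
      + (\<Sum>m'\<in>{..<M} - {m}. A1 r y u * D2 r2 y2 + (\<Sum>\<kappa>\<in>{..<K} - {k}. 1))
     = d + (real K - 1) * A2 x r y + (real M - 1) * (A1 r y u * D2 r2 y2 + (real K - 1))"
    using m k by (simp add: of_nat_diff)
  also have "\<dots> / d = beta M K x r y u r2 y2"
    using pos D2 by (simp add: beta_def d_def field_simps)
  finally have b_mean: "expect ?J b \<le> beta M K x r y u r2 y2" using d by (simp add: divide_right_mono)
  have beta_pos: "beta M K x r y u r2 y2 > 0"
    unfolding beta_def using pos D2 m k by (intro add_pos_nonneg) auto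
  have "gain M K x r (y, v) u r2 (y2, v2) \<le> expect ?J (\<lambda>w. 1 / (a w * b w))"
    unfolding gain_def fst_conv snd_conv using k pos
    by (intro expect_inverse_mult_ge fJ a_pos b_pos a_mean b_mean beta_pos) auto
  then have "e v r u / real K * gain M K x r (y, v) u r2 (y2, v2)
      \<le> e v r u / real K * expect ?J (\<lambda>w. 1 / (a w * b w))"
    using nonneg by (intro mult_left_mono) auto
  also have "\<dots> = expect ?J (\<lambda>w. e v r u / real K * (1 / (a w * b w)))"
    by (rule integral_mult_right_zero[symmetric])
  also have "\<dots> = expect ?J ?f" by (intro expect_cong) (rule f_eq[symmetric])
  finally show ?thesis .
qed

section \<open>Change of measure from the test channel to a fixed index\<close>

lemma finite_Pi_px: "finite (set_pmf (Pi_pmf {..<n::nat} d (\<lambda>_. px)))"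
  and finite_Pi_pxr: "finite (set_pmf (Pi_pmf {..<n} d' (\<lambda>_. pxr)))"
  and finite_Pi_t: "finite (set_pmf (Pi_pmf {..<n} d'' (\<lambda>_. t r)))"
  using fin by (auto intro!: finite_set_Pi_pmf)

text \<open>Here the index \<open>k\<close> is fixed in advance instead of being chosen by the
  quantizer, so the compression codebook is independent of the relay's observation given
  \<open>r\<close>. The probability of choosing \<open>k\<close> enters later as a factor of the
  integrand.\<close>

definition core :: "nat \<Rightarrow> nat \<Rightarrow> nat \<Rightarrow> nat \<Rightarrow>
    ((nat \<Rightarrow> 'a) \<times> 'b \<times> (nat \<Rightarrow> 'u) \<times> ('c \<times> 'd) \<times> (nat \<Rightarrow> 'b) \<times> ('c \<times> 'd)) pmf" where
  "core M K m k = do {X \<leftarrow> Pi_pmf {..<M} undefined (\<lambda>_. px); r \<leftarrow> pxr;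
     us \<leftarrow> Pi_pmf {..<K} undefined (\<lambda>_. t r); z \<leftarrow> V (X m) r; x2 \<leftarrow> px;
     \<rho> \<leftarrow> Pi_pmf {..<K} undefined (\<lambda>_. pxr); z2 \<leftarrow> V x2 (\<rho> k); return_pmf (X, r, us, z, \<rho>, z2)}"

text \<open>Draws everything that belongs to the pair (m, k) and to the channel first; conditionally
  on it the rest of the codebooks is a fresh product, as \<open>expect_jensen\<close>
  requires.\<close>

lemma core_split:
  assumes m: "m < M" and k: "k < K"
  shows "core M K m k = 
    do {(x, r, u, z, r2, z2) \<leftarrow> do {x \<leftarrow> px; r \<leftarrow> pxr; u \<leftarrow> t r; z \<leftarrow> V x r; x2 \<leftarrow> px; r2 \<leftarrow> pxr; z2 \<leftarrow> V x2 r2;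
                              return_pmf (x, r, u, z, r2, z2)};
      (X, us, \<rho>) \<leftarrow> pair_pmf (Pi_pmf ({..<M} - {m}) undefined (\<lambda>_. px))
          (pair_pmf (Pi_pmf ({..<K} - {k}) undefined (\<lambda>_. t r)) (Pi_pmf ({..<K} - {k}) undefined (\<lambda>_. pxr)));
      return_pmf (X(m := x), r, us(k := u), z, \<rho>(k := r2), z2)}"
proof -
  let ?X = "Pi_pmf ({..<M} - {m}) undefined (\<lambda>_. px)" and ?U = "\<lambda>r. Pi_pmf ({..<K} - {k}) undefined (\<lambda>_. t r)"
    and ?R = "Pi_pmf ({..<K} - {k}) undefined (\<lambda>_. pxr)"
  have "core M K m k = do {x \<leftarrow> px; X \<leftarrow> ?X; r \<leftarrow> pxr; u \<leftarrow> t r; us \<leftarrow> ?U r; z \<leftarrow> V x r; x2 \<leftarrow> px; r2 \<leftarrow> pxr;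
      \<rho> \<leftarrow> ?R; z2 \<leftarrow> V x2 r2; return_pmf (X(m := x), r, us(k := u), z, \<rho>(k := r2), z2)}"
    unfolding core_def using m k
    by (simp add: Pi_pmf_split[of "{..<M}" m] Pi_pmf_split[of "{..<K}" k] bind_assoc_pmf bind_return_pmf)
  also have "\<dots> = do {x \<leftarrow> px; X \<leftarrow> ?X; r \<leftarrow> pxr; u \<leftarrow> t r; us \<leftarrow> ?U r; z \<leftarrow> V x r; x2 \<leftarrow> px; r2 \<leftarrow> pxr;
      z2 \<leftarrow> V x2 r2; \<rho> \<leftarrow> ?R; return_pmf (X(m := x), r, us(k := u), z, \<rho>(k := r2), z2)}"
    by (intro bind_pmf_cong[OF refl]) (rule bind_commute_pmf)
  also have "\<dots> = do {x \<leftarrow> px; X \<leftarrow> ?X; r \<leftarrow> pxr; u \<leftarrow> t r; us \<leftarrow> ?U r;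
      (z, r2, z2) \<leftarrow> do {z \<leftarrow> V x r; x2 \<leftarrow> px; r2 \<leftarrow> pxr; z2 \<leftarrow> V x2 r2; return_pmf (z, r2, z2)};
      \<rho> \<leftarrow> ?R; return_pmf (X(m := x), r, us(k := u), z, \<rho>(k := r2), z2)}"
    by (simp add: bind_assoc_pmf bind_return_pmf)
  also have "\<dots> = do {x \<leftarrow> px; X \<leftarrow> ?X; r \<leftarrow> pxr; u \<leftarrow> t r; 
      (z, r2, z2) \<leftarrow> do {z \<leftarrow> V x r; x2 \<leftarrow> px; r2 \<leftarrow> pxr; z2 \<leftarrow> V x2 r2; return_pmf (z, r2, z2)};
      us \<leftarrow> ?U r; \<rho> \<leftarrow> ?R; return_pmf (X(m := x), r, us(k := u), z, \<rho>(k := r2), z2)}"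
    unfolding case_prod_beta by (intro bind_pmf_cong[OF refl]) (rule bind_commute_pmf)
  also have "\<dots> = do {x \<leftarrow> px; X \<leftarrow> ?X; 
      (r, u, z, r2, z2) \<leftarrow> do {r \<leftarrow> pxr; u \<leftarrow> t r; z \<leftarrow> V x r; x2 \<leftarrow> px; r2 \<leftarrow> pxr; z2 \<leftarrow> V x2 r2; 
          return_pmf (r, u, z, r2, z2)};
      us \<leftarrow> ?U r; \<rho> \<leftarrow> ?R; return_pmf (X(m := x), r, us(k := u), z, \<rho>(k := r2), z2)}"
    by (simp add: bind_assoc_pmf bind_return_pmf)
  also have "\<dots> = do {x \<leftarrow> px; 
      (r, u, z, r2, z2) \<leftarrow> do {r \<leftarrow> pxr; u \<leftarrow> t r; z \<leftarrow> V x r; x2 \<leftarrow> px; r2 \<leftarrow> pxr; z2 \<leftarrow> V x2 r2; 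
          return_pmf (r, u, z, r2, z2)};
      X \<leftarrow> ?X; us \<leftarrow> ?U r; \<rho> \<leftarrow> ?R; return_pmf (X(m := x), r, us(k := u), z, \<rho>(k := r2), z2)}"
    unfolding case_prod_beta by (intro bind_pmf_cong[OF refl]) (rule bind_commute_pmf)
  finally show ?thesis
    by (simp add: bind_assoc_pmf bind_return_pmf pair_pmf_def)
qed

definition success :: "nat \<Rightarrow> nat \<Rightarrow> nat \<Rightarrow> nat \<Rightarrow> (nat \<Rightarrow> 'a) \<Rightarrow> 'b \<Rightarrow> (nat \<Rightarrow> 'u) \<Rightarrow> 'c \<Rightarrow> (nat \<Rightarrow> 'b) \<Rightarrow> 'c \<Rightarrow> real" where
  "success M K m k X r us y \<rho> y2 = weight X r us \<rho> y y2 (m, k) / (\<Sum>p\<in>{..<M} \<times> {..<K}. weight X r us \<rho> y y2 p)"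

text \<open>After \<open>expect_jensen\<close> the integrand carries the factor e / K. By
  \<open>e_density\<close> the factor \<open>e\<close> changes the law \<open>t r\<close> of the
  codeword into the test channel, which turns the mean into \<open>Phi\<close>; the factor 1 / K
  will be cancelled by summing over the indices.\<close>

lemma expect_core_ge:
  assumes m: "m < M" and k: "k < K"
  shows "expect (core M K m k) (\<lambda>(X, r, us, z, \<rho>, z2).
      e (snd z) r (us k) / (\<Sum>\<kappa><K. e (snd z) r (us \<kappa>)) * success M K m k X r us (fst z) \<rho> (fst z2))
     \<ge> Phi M K / real K" (is "expect _ ?F \<ge> _")
proof -
  let ?T = "\<lambda>x r u. do {z \<leftarrow> V x r; x2 \<leftarrow> px; r2 \<leftarrow> pxr; z2 \<leftarrow> V x2 r2; return_pmf (z, r2, z2)}"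
  let ?h = "\<lambda>x r u z r2 z2. e (snd z) r u / real K * gain M K x r z u r2 z2"
  have finU: "finite (set_pmf (Pi_pmf ({..<K} - {k}) undefined (\<lambda>_. t r)))"
   and finX: "finite (set_pmf (Pi_pmf ({..<M} - {m}) undefined (\<lambda>_. px)))"
   and finR: "finite (set_pmf (Pi_pmf ({..<K} - {k}) undefined (\<lambda>_. pxr)))" for r
    using fin by (auto intro!: finite_set_Pi_pmf)
  define qq where "qq = do {x \<leftarrow> px; r \<leftarrow> pxr; u \<leftarrow> t r; z \<leftarrow> V x r; x2 \<leftarrow> px; r2 \<leftarrow> pxr; z2 \<leftarrow> V x2 r2;
                              return_pmf (x, r, u, z, r2, z2)}"
  have fin_qq: "finite (set_pmf qq)" unfolding qq_def by (intro finite_set_bind_pmf fin) auto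
  have "Phi M K / real K = expect px (\<lambda>x. expect pxr (\<lambda>r. expect (V x r) (\<lambda>z. expect (q (snd z) r) (\<lambda>u. 
      expect px (\<lambda>x2. expect pxr (\<lambda>r2. expect (V x2 r2) (\<lambda>z2. gain M K x r z u r2 z2 / real K)))))))"
    unfolding Phi_def Q_def by (simp add: expect_bind fin set_bind_pmf)
  also have "\<dots> = expect px (\<lambda>x. expect pxr (\<lambda>r. expect (V x r) (\<lambda>z. expect (t r) (\<lambda>u. 
      expect px (\<lambda>x2. expect pxr (\<lambda>r2. expect (V x2 r2) (\<lambda>z2. ?h x r u z r2 z2)))))))"
  proof (intro expect_cong)
    fix x r z assume x: "x \<in> set_pmf px" and r: "r \<in> set_pmf pxr" and z: "z \<in> set_pmf (V x r)"
    define g where "g u = expect px (\<lambda>x2. expect pxr (\<lambda>r2. expect (V x2 r2) (\<lambda>z2. gain M K x r z u r2 z2)))" for u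
    have dens: "pmf (t r) u * e (snd z) r u = pmf (q (snd z) r) u" for u
      using e_density[OF x r, of "fst z" "snd z" u] z by simp
    have sub: "set_pmf (q (snd z) r) \<subseteq> set_pmf (t r)"
      using dens by (metis mult_zero_left set_pmf_iff subsetI)
    have "expect (q (snd z) r) (\<lambda>u. g u / real K) = (\<Sum>u\<in>set_pmf (t r). pmf (q (snd z) r) u * (g u / real K))"
      using sub fin by (subst integral_measure_pmf[of "set_pmf (t r)"]) auto
    also have "\<dots> = expect (t r) (\<lambda>u. e (snd z) r u / real K * g u)"
      using fin by (simp add: expect_finite dens[symmetric] mult_ac sum_divide_distrib)
    finally show "expect (q (snd z) r) (\<lambda>u. expect px (\<lambda>x2. expect pxr (\<lambda>r2. expect (V x2 r2) 
        (\<lambda>z2. gain M K x r z u r2 z2 / real K))))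
     = expect (t r) (\<lambda>u. expect px (\<lambda>x2. expect pxr (\<lambda>r2. expect (V x2 r2) (\<lambda>z2. ?h x r u z r2 z2))))"
      unfolding g_def by simp
  qed
  also have "\<dots> = expect px (\<lambda>x. expect pxr (\<lambda>r. expect (t r) (\<lambda>u. expect (V x r) (\<lambda>z. 
      expect px (\<lambda>x2. expect pxr (\<lambda>r2. expect (V x2 r2) (\<lambda>z2. ?h x r u z r2 z2)))))))"
    by (intro expect_cong expect_commute fin)
  also have "\<dots> = expect qq (\<lambda>(x, r, u, z, r2, z2). ?h x r u z r2 z2)"
    unfolding qq_def by (simp add: expect_bind fin set_bind_pmf)
  also have "\<dots> \<le> expect qq (\<lambda>(x, r, u, z, r2, z2). expect 
      (pair_pmf (Pi_pmf ({..<M} - {m}) undefined (\<lambda>_. px))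
          (pair_pmf (Pi_pmf ({..<K} - {k}) undefined (\<lambda>_. t r)) (Pi_pmf ({..<K} - {k}) undefined (\<lambda>_. pxr))))
      (\<lambda>(X, us, \<rho>). ?F (X(m := x), r, us(k := u), z, \<rho>(k := r2), z2)))"
  proof (rule expect_mono[OF fin_qq])
    fix w assume "w \<in> set_pmf qq"
    moreover obtain x r u y v r2 y2 v2 where w: "w = (x, r, u, (y, v), r2, (y2, v2))"
      by (metis prod_cases6 surj_pair)
    ultimately obtain x2 where x: "x \<in> set_pmf px" and r: "r \<in> set_pmf pxr" and u: "u \<in> set_pmf (t r)"
        and z: "(y, v) \<in> set_pmf (V x r)" and x2: "x2 \<in> set_pmf px" and r2: "r2 \<in> set_pmf pxr" 
        and z2: "(y2, v2) \<in> set_pmf (V x2 r2)"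
      by (auto simp: qq_def set_bind_pmf)
    have "?h x r u (y, v) r2 (y2, v2) \<le> expect (pair_pmf (Pi_pmf ({..<M} - {m}) undefined (\<lambda>_. px))
          (pair_pmf (Pi_pmf ({..<K} - {k}) undefined (\<lambda>_. t r)) (Pi_pmf ({..<K} - {k}) undefined (\<lambda>_. pxr))))
      (\<lambda>(X, us, \<rho>). ?F (X(m := x), r, us(k := u), (y, v), \<rho>(k := r2), (y2, v2)))"
    \<comment> \<open>Codewords outside the support of the test channel have e = 0 and contribute
      nothing to the left side; only for the others does \<open>pos\<close> give positive
      weights.\<close>
    proof (cases "e v r u = 0")
      case True
      then show ?thesis by (auto intro!: expect_nonneg)
    next
      case False
      then have "u \<in> set_pmf (q v r)"
        using e_density[OF x r z, of u] u by (auto simp: set_pmf_iff)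
      \<comment> \<open>\<open>pos\<close> speaks about a complete letter; any compression symbol
        completes the second block, since \<open>D2\<close> does not depend on it.\<close>
      moreover obtain u' where "u' \<in> set_pmf (q v2 r2)" using set_pmf_not_empty[of "q v2 r2"] by blast
      with pos[OF x2 r2 z2] have "D2 r2 y2 > 0" by blast
      ultimately show ?thesis
        using expect_jensen[OF m k x r z, where u = u and ?r2.0 = r2 and ?y2.0 = y2 and ?v2.0 = v2
             and dx = undefined and du = undefined and dr = undefined]
        by (simp add: success_def)
    qed
    then show "(case w of (x, r, u, z, r2, z2) \<Rightarrow> ?h x r u z r2 z2) \<le> (case w of (x, r, u, z, r2, z2) \<Rightarrow> expect 
      (pair_pmf (Pi_pmf ({..<M} - {m}) undefined (\<lambda>_. px))
          (pair_pmf (Pi_pmf ({..<K} - {k}) undefined (\<lambda>_. t r)) (Pi_pmf ({..<K} - {k}) undefined (\<lambda>_. pxr))))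
      (\<lambda>(X, us, \<rho>). ?F (X(m := x), r, us(k := u), z, \<rho>(k := r2), z2)))"
      unfolding w by simp
  qed
  also have "\<dots> = expect (core M K m k) ?F"
    unfolding core_split[OF m k] qq_def[symmetric] using fin_qq finX finU finR
    by (subst expect_bind) (auto simp: expect_bind set_bind_pmf case_prod_unfold)
  finally show ?thesis .
qed

text \<open>A cell is the part of the relay's codebook that belongs to one value of the previous
  compression index: the relay codeword, the list of compression codewords superposed on it, and the
  outcome of the randomized choice of the next index for every possible relay observation.\<close>

definition observations :: "'d set" where
  "observations = (\<Union>x\<in>set_pmf px. \<Union>r\<in>set_pmf pxr. snd ` set_pmf (V x r))"

definition index_pmf :: "nat \<Rightarrow> 'b \<Rightarrow> (nat \<Rightarrow> 'u) \<Rightarrow> 'd \<Rightarrow> nat pmf" where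
  "index_pmf K r us v = likelihood_pmf K (\<lambda>k. e v r (us k))"

definition cell_pmf :: "nat \<Rightarrow> ('b \<times> (nat \<Rightarrow> 'u) \<times> ('d \<Rightarrow> nat)) pmf" where
  "cell_pmf K = do {r \<leftarrow> pxr; us \<leftarrow> Pi_pmf {..<K} undefined (\<lambda>_. t r);
     g \<leftarrow> Pi_pmf observations 0 (index_pmf K r us); return_pmf (r, us, g)}"

text \<open>A seed holds all randomness of one block, including that of the quantizer, so fixing the
  seeds leaves the deterministic maps that a relay code consists of.\<close>

definition seed_pmf :: "nat \<Rightarrow> nat \<Rightarrow> ((nat \<Rightarrow> 'a) \<times> (nat \<Rightarrow> 'b \<times> (nat \<Rightarrow> 'u) \<times> ('d \<Rightarrow> nat))) pmf" where
  "seed_pmf M K = pair_pmf (Pi_pmf {..<M} undefined (\<lambda>_. px)) (Pi_pmf {..<K} (undefined, undefined) (\<lambda>_. cell_pmf K))"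

text \<open>The index \<open>k\<close> of the previous block is already known to the receiver and
  selects the cell of \<open>s\<close>. Of the next seed only the relay codewords matter, since they
  carry the new index.\<close>

definition decode_pair where
  "decode_pair M K s s2 k y y2 =
     strict_argmax ({..<M} \<times> {..<K})
       (weight (fst s) (fst (snd s k)) (fst (snd (snd s k))) (\<lambda>k. fst (snd s2 k)) y y2)"

definition next_index where "next_index s k v = snd (snd (snd s k)) v"

lemma finite_observations: "finite observations"
  using fin by (auto simp: observations_def)

lemma set_index_pmf: "0 < K \<Longrightarrow> set_pmf (index_pmf K r us v) \<subseteq> {..<K}"
  unfolding index_pmf_def by (rule likelihood_pmf(1)) (auto intro: nonneg)

lemma finite_set_index_pmf: "0 < K \<Longrightarrow> finite (set_pmf (index_pmf K r us v))"
  by (rule finite_subset[OF set_index_pmf]) auto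

lemma finite_set_cell_pmf: "0 < K \<Longrightarrow> finite (set_pmf (cell_pmf K))"
  unfolding cell_pmf_def
  by (rule finite_set_bind_pmf[OF fin(2)], rule finite_set_bind_pmf[OF finite_Pi_t], rule finite_set_bind_pmf)
    (auto intro!: finite_set_Pi_pmf finite_observations finite_set_index_pmf)

lemma finite_set_seed_pmf: "0 < K \<Longrightarrow> finite (set_pmf (seed_pmf M K))"
  unfolding seed_pmf_def using finite_set_Pi_pmf[of "{..<K}" "\<lambda>_. cell_pmf K" "(undefined, undefined)"]
  by (simp add: finite_Pi_px finite_set_cell_pmf)

lemma next_index_less:
  assumes s: "s \<in> set_pmf (seed_pmf M K)" and k: "k < K"
  shows "next_index s k v < K"
proof -
  have "snd s k \<in> set_pmf (cell_pmf K)"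
    using s k by (auto simp: seed_pmf_def set_Pi_pmf PiE_dflt_def)
  then obtain r us g where c: "snd s k = (r, us, g)" 
      and g: "g \<in> set_pmf (Pi_pmf observations 0 (index_pmf K r us))"
    by (auto simp: cell_pmf_def set_bind_pmf)
  \<comment> \<open>Outside \<open>observations\<close> the choice is the default 0, which is below
    K because k is.\<close>
  then have "g v < K" using k set_index_pmf[of K r us v]
    by (cases "v \<in> observations") (auto simp: set_Pi_pmf finite_observations PiE_dflt_def)
  then show ?thesis by (simp add: next_index_def c)
qed

lemma map_fst_cell_pmf: "map_pmf fst (cell_pmf K) = pxr"
  by (simp add: cell_pmf_def map_bind_pmf bind_return_pmf')

lemma relay_codebook_pmf:
  "map_pmf (\<lambda>c k. fst (c k)) (Pi_pmf {..<K} (undefined, undefined) (\<lambda>_. cell_pmf K))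
   = Pi_pmf {..<K} undefined (\<lambda>_. pxr)"
proof -
  have "Pi_pmf {..<K} (fst (undefined, undefined)) (\<lambda>_. map_pmf fst (cell_pmf K))
    = map_pmf (\<lambda>h. fst \<circ> h) (Pi_pmf {..<K} (undefined, undefined) (\<lambda>_. cell_pmf K))"
    by (rule Pi_pmf_map) auto
  then show ?thesis by (simp add: map_fst_cell_pmf comp_def)
qed

text \<open>Replacing the maximizer by the likelihood draw costs the factor 2. The success
  probability of the draw is then split according to the index picked by the quantizer, and each of
  the K values contributes at least Phi / K.\<close>

theorem oneshot_error:
  assumes m: "m < M" and m2: "m2 < M" and k: "k < K"
  shows "measure_pmf.prob (do {s \<leftarrow> seed_pmf M K; z \<leftarrow> V (fst s m) (fst (snd s k));
             s2 \<leftarrow> seed_pmf M K; z2 \<leftarrow> V (fst s2 m2) (fst (snd s2 (next_index s k (snd z))));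
             return_pmf (s, z, s2, z2)})
           {(s, z, s2, z2). decode_pair M K s s2 k (fst z) (fst z2) \<noteq> (m, next_index s k (snd z))}
         \<le> 2 * (1 - Phi M K)" (is "measure_pmf.prob ?L ?B \<le> _")
proof -
  have K: "0 < K" and M: "0 < M" using m k by auto
  let ?X = "Pi_pmf {..<M} undefined (\<lambda>_. px)" and ?C = "Pi_pmf {..<K} (undefined, undefined) (\<lambda>_. cell_pmf K)"
    and ?R = "Pi_pmf {..<K} undefined (\<lambda>_. pxr)" and ?U = "\<lambda>r. Pi_pmf {..<K} undefined (\<lambda>_. t r)"
  let ?S = "{..<M} \<times> {..<K}"
  \<comment> \<open>\<open>G\<close> is the error event with the whole table \<open>g\<close> of
    index choices given; by \<open>GH\<close> it depends on \<open>g\<close> only through the index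
    actually chosen, which is the form \<open>H\<close>.\<close>
  define G where "G X r us g z = do {s2 \<leftarrow> seed_pmf M K; z2 \<leftarrow> V (fst s2 m2) (fst (snd s2 (g (snd z))));
       return_pmf (strict_argmax ?S (weight X r us (\<lambda>k. fst (snd s2 k)) (fst z) (fst z2)) \<noteq> (m, g (snd z)))}"
    for X r us and g :: "'d \<Rightarrow> nat" and z :: "'c \<times> 'd"
  define H where "H X r us k1 z = do {x2 \<leftarrow> px; \<rho> \<leftarrow> ?R; z2 \<leftarrow> V x2 (\<rho> k1);
       return_pmf (strict_argmax ?S (weight X r us \<rho> (fst z) (fst z2)) \<noteq> (m, k1))}"
    for X r us and k1 :: nat and z :: "'c \<times> 'd"
  have GH: "G X r us g z = H X r us (g (snd z)) z" for X r us g z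
  proof -
    have "G X r us g z = do {X2 \<leftarrow> ?X; \<rho> \<leftarrow> map_pmf (\<lambda>c k. fst (c k)) ?C; z2 \<leftarrow> V (X2 m2) (\<rho> (g (snd z)));
       return_pmf (strict_argmax ?S (weight X r us \<rho> (fst z) (fst z2)) \<noteq> (m, g (snd z)))}"
      unfolding G_def seed_pmf_def pair_pmf_def
      by (simp add: bind_assoc_pmf bind_return_pmf bind_map_pmf)
    also have "\<dots> = H X r us (g (snd z)) z"
      unfolding relay_codebook_pmf H_def using m2
        bind_Pi_pmf_component[of "{..<M}" m2 undefined "\<lambda>_. px" "\<lambda>x2. do {\<rho> \<leftarrow> ?R; z2 \<leftarrow> V x2 (\<rho> (g (snd z)));
       return_pmf (strict_argmax ?S (weight X r us \<rho> (fst z) (fst z2)) \<noteq> (m, g (snd z)))}"] by simp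
    finally show ?thesis .
  qed
  have "map_pmf (\<lambda>w. w \<in> ?B) ?L = do {X \<leftarrow> ?X; c \<leftarrow> ?C; z \<leftarrow> V (X m) (fst (c k)); 
      G X (fst (c k)) (fst (snd (c k))) (snd (snd (c k))) z}"
    unfolding G_def seed_pmf_def[of M K, THEN arg_cong[of _ _ "\<lambda>p. bind_pmf p _"]] pair_pmf_def decode_pair_def next_index_def
    by (simp add: map_bind_pmf bind_assoc_pmf bind_return_pmf)
  also have "\<dots> = do {X \<leftarrow> ?X; cell \<leftarrow> cell_pmf K; z \<leftarrow> V (X m) (fst cell); G X (fst cell) (fst (snd cell)) (snd (snd cell)) z}"
    (is "_ = bind_pmf ?X (\<lambda>X. bind_pmf (cell_pmf K) (?g X))")
  proof (intro bind_pmf_cong[OF refl])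
    fix X
    show "bind_pmf ?C (\<lambda>c. bind_pmf (V (X m) (fst (c k)))
        (G X (fst (c k)) (fst (snd (c k))) (snd (snd (c k))))) = bind_pmf (cell_pmf K) (?g X)"
      using k bind_Pi_pmf_component[of "{..<K}" k "(undefined, undefined)" "\<lambda>_. cell_pmf K" "?g X"] by simp
  qed
  also have "\<dots> = do {X \<leftarrow> ?X; r \<leftarrow> pxr; us \<leftarrow> ?U r; g \<leftarrow> Pi_pmf observations 0 (index_pmf K r us); 
       z \<leftarrow> V (X m) r; H X r us (g (snd z)) z}"
    by (simp add: cell_pmf_def bind_assoc_pmf bind_return_pmf GH)
  also have "\<dots> = do {X \<leftarrow> ?X; r \<leftarrow> pxr; us \<leftarrow> ?U r; z \<leftarrow> V (X m) r; g \<leftarrow> Pi_pmf observations 0 (index_pmf K r us); 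
       H X r us (g (snd z)) z}"
    by (intro bind_pmf_cong[OF refl]) (rule bind_commute_pmf)
  \<comment> \<open>The table is read at a single place, the observation that occurs, so it can be
    replaced by one index drawn after the observation.\<close>
  also have "\<dots> = do {X \<leftarrow> ?X; r \<leftarrow> pxr; us \<leftarrow> ?U r; z \<leftarrow> V (X m) r; k1 \<leftarrow> index_pmf K r us (snd z); H X r us k1 z}"
  proof (intro bind_pmf_cong[OF refl])
    fix X r us z assume X: "X \<in> set_pmf ?X" and r: "r \<in> set_pmf pxr" and z: "z \<in> set_pmf (V (X m) r)"
    have "X m \<in> set_pmf px" using X m by (auto simp: set_Pi_pmf PiE_dflt_def)
    then have "snd z \<in> observations" using r z by (auto simp: observations_def)
    then show "bind_pmf (Pi_pmf observations 0 (index_pmf K r us)) (\<lambda>g. H X r us (g (snd z)) z) 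
       = bind_pmf (index_pmf K r us (snd z)) (\<lambda>k1. H X r us k1 z)"
      by (intro bind_Pi_pmf_component finite_observations)
  qed
  finally have L: "map_pmf (\<lambda>w. w \<in> ?B) ?L = \<dots>" .
  note fins = finite_Pi_px finite_Pi_pxr finite_Pi_t fin finite_set_index_pmf[OF K]
  define \<sigma> where "\<sigma> X r us z k1 \<rho> z2 = success M K m k1 X r us (fst z) \<rho> (fst z2)" for X r us k1 \<rho> and z z2 :: "'c \<times> 'd"
  have \<sigma>_nonneg: "\<sigma> X r us z k1 \<rho> z2 \<ge> 0" for X r us z k1 \<rho> z2
    unfolding \<sigma>_def success_def weight_def
    by (auto intro!: divide_nonneg_nonneg sum_nonneg mult_nonneg_nonneg nonneg)
  have "measure_pmf.prob ?L ?B = expect (map_pmf (\<lambda>w. w \<in> ?B) ?L) of_bool"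
    by (simp add: expect_indicator_Collect)
  also have "\<dots> = expect ?X (\<lambda>X. expect pxr (\<lambda>r. expect (?U r) (\<lambda>us. expect (V (X m) r) (\<lambda>z.
      expect (index_pmf K r us (snd z)) (\<lambda>k1. expect px (\<lambda>x2. expect ?R (\<lambda>\<rho>. expect (V x2 (\<rho> k1)) (\<lambda>z2.
        of_bool (strict_argmax ?S (weight X r us \<rho> (fst z) (fst z2)) \<noteq> (m, k1))))))))))"
    unfolding L H_def by (simp add: expect_bind set_bind_pmf fins)
  also have "\<dots> \<le> expect ?X (\<lambda>X. expect pxr (\<lambda>r. expect (?U r) (\<lambda>us. expect (V (X m) r) (\<lambda>z.
      expect (index_pmf K r us (snd z)) (\<lambda>k1. expect px (\<lambda>x2. expect ?R (\<lambda>\<rho>. expect (V x2 (\<rho> k1)) (\<lambda>z2.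
        2 * (1 - \<sigma> X r us z k1 \<rho> z2)))))))))"
  proof (intro expect_mono fins)
    fix X r us k1 x2 \<rho> and z z2 :: "'c \<times> 'd" assume "k1 \<in> set_pmf (index_pmf K r us (snd z))"
    then have "k1 < K" using set_index_pmf[OF K] by auto
    then show "of_bool (strict_argmax ?S (weight X r us \<rho> (fst z) (fst z2)) \<noteq> (m, k1)) \<le> 2 * (1 - \<sigma> X r us z k1 \<rho> z2)"
      unfolding \<sigma>_def success_def using m
      by (intro strict_argmax_error_le) (auto simp: weight_def intro!: mult_nonneg_nonneg nonneg)
  qed
  also have "\<dots> = 2 * (1 - expect ?X (\<lambda>X. expect pxr (\<lambda>r. expect (?U r) (\<lambda>us. expect (V (X m) r) (\<lambda>z.
      expect (index_pmf K r us (snd z)) (\<lambda>k1. expect px (\<lambda>x2. expect ?R (\<lambda>\<rho>. expect (V x2 (\<rho> k1)) (\<lambda>z2.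
        \<sigma> X r us z k1 \<rho> z2)))))))))"
    by (simp add: expect_diff fins)
  also have "\<dots> \<le> 2 * (1 - Phi M K)"
  proof -
    \<comment> \<open>The quantizer picks \<open>k1\<close> with probability at least its share of
      the likelihoods, which is the extra factor in \<open>expect_core_ge\<close>.\<close>
    have "Phi M K = (\<Sum>k1<K. Phi M K / real K)" using K by simp
    also have "\<dots> \<le> (\<Sum>k1<K. expect (core M K m k1) (\<lambda>(X, r, us, z, \<rho>, z2).
      e (snd z) r (us k1) / (\<Sum>\<kappa><K. e (snd z) r (us \<kappa>)) * success M K m k1 X r us (fst z) \<rho> (fst z2)))"
      by (intro sum_mono expect_core_ge m) auto
    also have "\<dots> = (\<Sum>k1<K. expect ?X (\<lambda>X. expect pxr (\<lambda>r. expect (?U r) (\<lambda>us. expect (V (X m) r) (\<lambda>z.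
      expect px (\<lambda>x2. expect ?R (\<lambda>\<rho>. expect (V x2 (\<rho> k1)) (\<lambda>z2.
        e (snd z) r (us k1) / (\<Sum>\<kappa><K. e (snd z) r (us \<kappa>)) * \<sigma> X r us z k1 \<rho> z2))))))))"
      unfolding core_def \<sigma>_def by (simp add: expect_bind set_bind_pmf fins del: integral_mult_right_zero)
    also have "\<dots> = expect ?X (\<lambda>X. expect pxr (\<lambda>r. expect (?U r) (\<lambda>us. expect (V (X m) r) (\<lambda>z.
      (\<Sum>k1<K. e (snd z) r (us k1) / (\<Sum>\<kappa><K. e (snd z) r (us \<kappa>)) * 
         expect px (\<lambda>x2. expect ?R (\<lambda>\<rho>. expect (V x2 (\<rho> k1)) (\<lambda>z2. \<sigma> X r us z k1 \<rho> z2))))))))"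
      by (simp add: expect_sum fins)
    also have "\<dots> \<le> expect ?X (\<lambda>X. expect pxr (\<lambda>r. expect (?U r) (\<lambda>us. expect (V (X m) r) (\<lambda>z.
      expect (index_pmf K r us (snd z)) (\<lambda>k1. expect px (\<lambda>x2. expect ?R (\<lambda>\<rho>. expect (V x2 (\<rho> k1)) (\<lambda>z2.
        \<sigma> X r us z k1 \<rho> z2))))))))"
    proof (intro expect_mono fins)
      fix X r us z
      let ?g = "\<lambda>k1. expect px (\<lambda>x2. expect ?R (\<lambda>\<rho>. expect (V x2 (\<rho> k1)) (\<lambda>z2. \<sigma> X r us z k1 \<rho> z2)))"
      have "(\<Sum>k1<K. e (snd z) r (us k1) / (\<Sum>\<kappa><K. e (snd z) r (us \<kappa>)) * ?g k1)
        \<le> (\<Sum>k1<K. pmf (index_pmf K r us (snd z)) k1 * ?g k1)"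
        unfolding index_pmf_def using K
        by (intro sum_mono mult_right_mono likelihood_pmf(2) expect_nonneg \<sigma>_nonneg nonneg) auto
      also have "\<dots> = expect (index_pmf K r us (snd z)) ?g"
        using set_index_pmf[OF K] by (subst integral_measure_pmf[of "{..<K}"]) auto
      finally show "(\<Sum>k1<K. e (snd z) r (us k1) / (\<Sum>\<kappa><K. e (snd z) r (us \<kappa>)) * ?g k1)
        \<le> expect (index_pmf K r us (snd z)) ?g" .
    qed
    finally show ?thesis by simp
  qed
  finally show ?thesis .
qed

end

section \<open>Block Markov coding\<close>

text \<open>\<open>channel_outputs\<close> appends at the end; \<open>run\<close> describes the same process from the front, passing
  on the residual relay strategy.\<close>

primrec run :: "('x, 'xr, 'y, 'yr) relay_channel \<Rightarrow> 'x list \<Rightarrow> ('yr list \<Rightarrow> 'xr) \<Rightarrow> ('y \<times> 'yr) list pmf" where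
  "run W [] F = return_pmf []"
| "run W (x # xs) F = do {z \<leftarrow> W x (F []); zs \<leftarrow> run W xs (\<lambda>v. F (snd z # v)); return_pmf (z # zs)}"

lemma run_append:
  "run W (xs @ xs') F = do {h \<leftarrow> run W xs F; h' \<leftarrow> run W xs' (\<lambda>v. F (map snd h @ v)); return_pmf (h @ h')}"
  by (induction xs arbitrary: F) (simp_all add: bind_assoc_pmf bind_return_pmf bind_return_pmf')

lemma length_run: "h \<in> set_pmf (run W xs F) \<Longrightarrow> length h = length xs"
  by (induction xs arbitrary: F h) (auto simp: set_bind_pmf)

text \<open>The time argument of the relay encoder is one more than the number of outputs seen so
  far, so a strategy on histories alone suffices.\<close>

lemma channel_outputs_eq_run:
  "i \<le> length xs \<Longrightarrow> channel_outputs W xs f i = run W (take i xs) (\<lambda>v. f (Suc (length v)) v)"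
proof (induction i)
  case (Suc i)
  have "run W (take (Suc i) xs) (\<lambda>v. f (Suc (length v)) v) =
     do {h \<leftarrow> run W (take i xs) (\<lambda>v. f (Suc (length v)) v);
         z \<leftarrow> W (xs ! i) (f (Suc (length h)) (map snd h)); return_pmf (h @ [z])}"
    using Suc.prems by (simp add: take_Suc_conv_app_nth run_append bind_assoc_pmf bind_return_pmf)
  also have "\<dots> = channel_outputs W xs f (Suc i)"
    using Suc by (auto intro!: bind_pmf_cong dest!: length_run)
  finally show ?case ..
qed simp

definition memoryless :: "('x, 'xr, 'y, 'yr) relay_channel \<Rightarrow> 'x list \<Rightarrow> 'xr list \<Rightarrow> ('y \<times> 'yr) list pmf" where
  "memoryless W xs rs = mapM_pmf (\<lambda>(x, r). W x r) (zip xs rs)"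

text \<open>Within a block the relay's codeword is settled before the block begins, so its inputs
  depend on the history only through its length and the feedback disappears.\<close>

lemma run_eq_memoryless:
  assumes "length rs = length xs" "\<And>v. length v < length xs \<Longrightarrow> F v = rs ! length v"
  shows "run W xs F = memoryless W xs rs"
  using assms
proof (induction xs arbitrary: rs F)
  case (Cons x xs)
  then obtain r rs' where rs: "rs = r # rs'" by (cases rs) auto
  have "run W xs (\<lambda>v. F (v0 # v)) = memoryless W xs rs'" for v0
    using Cons.prems rs by (intro Cons.IH) auto
  moreover have "F [] = r" using Cons.prems rs by auto
  ultimately show ?case by (simp add: rs memoryless_def)
qed (simp add: memoryless_def)

lemma length_memoryless: "h \<in> set_pmf (memoryless W xs rs) \<Longrightarrow> length h = min (length xs) (length rs)"
  unfolding memoryless_def by (auto dest!: length_mapM_pmf)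

lemma finite_memoryless:
  fixes W :: "('x, 'xr, 'y::finite, 'yr::finite) relay_channel"
  shows "finite (set_pmf (memoryless W xs rs))"
  unfolding memoryless_def by (rule finite_set_mapM_pmf) auto

lemma prob_bind_finite:
  assumes "finite (set_pmf p)"
  shows "measure_pmf.prob (bind_pmf p f) S = expect p (\<lambda>x. measure_pmf.prob (f x) S)"
proof -
  have "emeasure (bind_pmf p f) S = (\<integral>\<^sup>+x. emeasure (f x) S \<partial>p)"
    by (rule emeasure_bind_pmf)
  also have "\<dots> = (\<integral>\<^sup>+x. ennreal (measure_pmf.prob (f x) S) \<partial>p)"
    by (simp add: measure_pmf.emeasure_eq_measure)
  also have "\<dots> = ennreal (expect p (\<lambda>x. measure_pmf.prob (f x) S))"
    by (intro nn_integral_eq_integral integrable_measure_pmf_finite assms) auto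
  finally show ?thesis
    by (simp add: measure_pmf.emeasure_eq_measure)
qed

lemma exists_le_expect:
  assumes "finite (set_pmf p)" "expect p g \<le> c"
  shows "\<exists>x\<in>set_pmf p. g x \<le> c"
proof (rule ccontr)
  assume "\<not> ?thesis"
  then have gt: "\<And>x. x \<in> set_pmf p \<Longrightarrow> c < g x" by (auto simp: not_le)
  have "c = (\<Sum>x\<in>set_pmf p. pmf p x * c)"
    using expect_finite[OF assms(1), of "\<lambda>_. c"] by simp
  also have "\<dots> < (\<Sum>x\<in>set_pmf p. pmf p x * g x)"
    using gt assms(1) by (intro sum_strict_mono) (auto simp: set_pmf_not_empty pmf_positive)
  also have "\<dots> = expect p g" using expect_finite[OF assms(1)] by simp
  finally show False using assms(2) by simp
qed

text \<open>\<open>step_error\<close> is required for every fixed previous index and every pair of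
  messages. Since each block has a fresh seed, the bound therefore applies whatever the past was
  that produced the index.\<close>

locale block_scheme =
  fixes W :: "('x::finite, 'xr::finite, 'y::finite, 'yr::finite) relay_channel"
    and n M K :: nat and S :: "'s pmf"
    and enc :: "'s \<Rightarrow> nat \<Rightarrow> 'x list" and rel :: "'s \<Rightarrow> nat \<Rightarrow> 'xr list"
    and nxt :: "'s \<Rightarrow> nat \<Rightarrow> 'yr list \<Rightarrow> nat"
    and dec :: "'s \<Rightarrow> 's \<Rightarrow> nat \<Rightarrow> 'y list \<Rightarrow> 'y list \<Rightarrow> nat \<times> nat"
    and \<epsilon> :: real
  assumes M: "0 < M" and K: "0 < K" and fin_S: "finite (set_pmf S)"
    and len_enc: "\<And>s m. s \<in> set_pmf S \<Longrightarrow> m < M \<Longrightarrow> length (enc s m) = n"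
    and len_rel: "\<And>s k. s \<in> set_pmf S \<Longrightarrow> k < K \<Longrightarrow> length (rel s k) = n"
    and nxt_less: "\<And>s k v. s \<in> set_pmf S \<Longrightarrow> k < K \<Longrightarrow> nxt s k v < K"
    and step_error: "\<And>m m2 k. m < M \<Longrightarrow> m2 < M \<Longrightarrow> k < K \<Longrightarrow>
      measure_pmf.prob (do {s \<leftarrow> S; zs \<leftarrow> memoryless W (enc s m) (rel s k); s2 \<leftarrow> S;
          zs2 \<leftarrow> memoryless W (enc s2 m2) (rel s2 (nxt s k (map snd zs))); return_pmf (s, zs, s2, zs2)})
        {(s, zs, s2, zs2). dec s s2 k (map fst zs) (map fst zs2) \<noteq> (m, nxt s k (map snd zs))} \<le> \<epsilon>"
begin

primrec strategy :: "'s list \<Rightarrow> nat \<Rightarrow> 'yr list \<Rightarrow> 'xr" where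
  "strategy [] k v = undefined"
| "strategy (s # ss) k v = (if length v < n then rel s k ! length v
     else strategy ss (nxt s k (take n v)) (drop n v))"

primrec blocks :: "'s list \<Rightarrow> nat list \<Rightarrow> nat \<Rightarrow> ('y \<times> 'yr) list pmf" where
  "blocks [] ms k = return_pmf []"
| "blocks (s # ss) ms k = do {zs \<leftarrow> memoryless W (enc s (hd ms)) (rel s k);
     h \<leftarrow> blocks ss (tl ms) (nxt s k (map snd zs)); return_pmf (zs @ h)}"

text \<open>Each decision needs the following block as well. The last block only delivers the index
  of the one before it, so \<open>Suc B\<close> blocks carry B messages.\<close>

primrec decode :: "'s list \<Rightarrow> nat \<Rightarrow> 'y list \<Rightarrow> nat list" where
  "decode [] k ys = []"
| "decode (s # ss) k ys = (if ss = [] then [] else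
     (let (m, k1) = dec s (hd ss) k (take n ys) (take n (drop n ys)) in m # decode ss k1 (drop n ys)))"

lemma run_blocks:
  assumes "length ms = length ss" "set ss \<subseteq> set_pmf S" "set ms \<subseteq> {..<M}" "k < K"
  shows "run W (concat (map2 enc ss ms)) (strategy ss k) = blocks ss ms k"
  using assms
proof (induction ss arbitrary: ms k)
  case (Cons s ss)
  then obtain m ms' where ms: "ms = m # ms'" by (cases ms) auto
  have s: "s \<in> set_pmf S" and m: "m < M" using Cons.prems ms by auto
  have "run W (concat (map2 enc (s # ss) ms)) (strategy (s # ss) k) =
     do {h \<leftarrow> run W (enc s m) (strategy (s # ss) k);
         h' \<leftarrow> run W (concat (map2 enc ss ms')) (\<lambda>v. strategy (s # ss) k (map snd h @ v)); return_pmf (h @ h')}"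
    by (simp add: ms run_append)
  also have "run W (enc s m) (strategy (s # ss) k) = memoryless W (enc s m) (rel s k)"
    by (rule run_eq_memoryless) (use len_enc[OF s m] len_rel[OF s] Cons.prems in auto)
  also have "do {h \<leftarrow> memoryless W (enc s m) (rel s k);
         h' \<leftarrow> run W (concat (map2 enc ss ms')) (\<lambda>v. strategy (s # ss) k (map snd h @ v)); return_pmf (h @ h')}
     = blocks (s # ss) ms k"
  proof (simp only: blocks.simps ms list.sel, intro bind_pmf_cong[OF refl] arg_cong2[of _ _ _ _ bind_pmf] refl)
    fix h assume "h \<in> set_pmf (memoryless W (enc s m) (rel s k))"
    then have "length h = n"
      using len_enc[OF s m] len_rel[OF s] Cons.prems by (auto dest: length_memoryless)
    then have "(\<lambda>v. strategy (s # ss) k (map snd h @ v)) = strategy ss (nxt s k (map snd h))"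
      by auto
    then show "run W (concat (map2 enc ss ms')) (\<lambda>v. strategy (s # ss) k (map snd h @ v))
      = blocks ss ms' (nxt s k (map snd h))"
      using Cons.IH[of ms' "nxt s k (map snd h)"] Cons.prems ms s by (simp add: nxt_less)
  qed
  finally show ?case .
qed simp

lemma finite_seeds: "finite (set_pmf (replicate_pmf b S))"
  by (induction b) (auto simp: set_bind_pmf fin_S)

text \<open>A union bound along the blocks. As long as the first decision is correct, the decoder
  proceeds with the true index, so the remaining error is that of a decoder told this index.\<close>

lemma expect_decode_error:
  assumes "length ms = Suc B" "set ms \<subseteq> {..<M}" "k < K"
  shows "measure_pmf.prob (do {ss \<leftarrow> replicate_pmf (Suc B) S; h \<leftarrow> blocks ss ms k; return_pmf (ss, h)})
      {(ss, h). decode ss k (map fst h) \<noteq> butlast ms} \<le> real B * \<epsilon>"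
  using assms
proof (induction B arbitrary: ms k)
  case 0
  then obtain m where "ms = [m]" by (auto simp: length_Suc_conv)
  then show ?case
    by (auto simp: measure_le_0_iff measure_pmf_zero_iff set_bind_pmf)
next
  case (Suc B)
  then obtain m m2 ms' where ms: "ms = m # m2 # ms'" and len: "length ms' = B"
    by (auto simp: length_Suc_conv)
  have m: "m < M" "m2 < M" using Suc.prems ms by auto
  define L where "L = do {s \<leftarrow> S; zs \<leftarrow> memoryless W (enc s m) (rel s k); ss \<leftarrow> replicate_pmf (Suc B) S;
      h \<leftarrow> blocks ss (m2 # ms') (nxt s k (map snd zs)); return_pmf (s, zs, ss, h)}"
  \<comment> \<open>\<open>E1\<close> is an error of the first decision. \<open>E2\<close> is an
    error of the later ones when they start from the true index instead of the decoded one; the two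
    starts agree outside \<open>E1\<close>.\<close>
  define E1 where "E1 = {(s, zs :: ('y \<times> 'yr) list, ss, h :: ('y \<times> 'yr) list). dec s (hd ss) k (map fst zs) (map fst (take n h)) \<noteq> (m, nxt s k (map snd zs))}"
  define E2 where "E2 = {(s :: 's, zs :: ('y \<times> 'yr) list, ss, h :: ('y \<times> 'yr) list). decode ss (nxt s k (map snd zs)) (map fst h) \<noteq> butlast (m2 # ms')}"
  have "do {ss \<leftarrow> replicate_pmf (Suc (Suc B)) S; h \<leftarrow> blocks ss ms k; return_pmf (ss, h)} =
    do {s \<leftarrow> S; ss \<leftarrow> replicate_pmf (Suc B) S; zs \<leftarrow> memoryless W (enc s m) (rel s k);
        h \<leftarrow> blocks ss (m2 # ms') (nxt s k (map snd zs)); return_pmf (s # ss, zs @ h)}"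
    unfolding ms replicate_pmf.simps(2)[of "Suc B"] by (simp add: bind_assoc_pmf bind_return_pmf)
  also have "\<dots> = do {s \<leftarrow> S; zs \<leftarrow> memoryless W (enc s m) (rel s k); ss \<leftarrow> replicate_pmf (Suc B) S;
        h \<leftarrow> blocks ss (m2 # ms') (nxt s k (map snd zs)); return_pmf (s # ss, zs @ h)}"
    by (intro bind_pmf_cong[OF refl]) (rule bind_commute_pmf)
  also have "\<dots> = map_pmf (\<lambda>(s, zs, ss, h). (s # ss, zs @ h)) L"
    by (simp add: L_def map_bind_pmf del: replicate_pmf.simps)
  finally have "measure_pmf.prob (do {ss \<leftarrow> replicate_pmf (Suc (Suc B)) S; h \<leftarrow> blocks ss ms k; return_pmf (ss, h)})
      {(ss, h). decode ss k (map fst h) \<noteq> butlast ms}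
    = measure_pmf.prob L {(s, zs, ss, h). decode (s # ss) k (map fst (zs @ h)) \<noteq> butlast ms}"
    by (simp add: vimage_def case_prod_unfold del: decode.simps)
  also have "\<dots> \<le> measure_pmf.prob L (E1 \<union> E2)"
  proof (rule measure_pmf.finite_measure_mono_AE)
    show "AE w in L. w \<in> {(s, zs, ss, h). decode (s # ss) k (map fst (zs @ h)) \<noteq> butlast ms} \<longrightarrow> w \<in> E1 \<union> E2"
      unfolding AE_measure_pmf_iff
    proof (intro ballI impI)
      fix w assume w: "w \<in> set_pmf L" and err: "w \<in> {(s, zs, ss, h). decode (s # ss) k (map fst (zs @ h)) \<noteq> butlast ms}"
      then obtain s zs ss h where weq: "w = (s, zs, ss, h)" and s: "s \<in> set_pmf S"
          and zs: "zs \<in> set_pmf (memoryless W (enc s m) (rel s k))" and ss: "ss \<in> set_pmf (replicate_pmf (Suc B) S)"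
        unfolding L_def by (auto simp: set_bind_pmf simp del: replicate_pmf.simps)
      have "length zs = n"
        using zs len_enc[OF s m(1)] len_rel[OF s] Suc.prems by (auto dest: length_memoryless)
      moreover have "ss \<noteq> []" using ss by (auto simp: set_replicate_pmf simp del: replicate_pmf.simps)
      ultimately show "w \<in> E1 \<union> E2"
        using err by (auto simp: weq E1_def E2_def ms take_map split: prod.splits)
    qed
  qed simp
  also have "\<dots> \<le> measure_pmf.prob L E1 + measure_pmf.prob L E2"
    by (rule measure_Un_le) auto
  also have "measure_pmf.prob L E1 \<le> \<epsilon>"
  proof -
    \<comment> \<open>The first decision sees one block of the continuation; the later blocks are
      marginalized out to reach the form of \<open>step_error\<close>.\<close>
    let ?g = "\<lambda>(s, zs, ss, h). (s, zs, hd ss, take n h)"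
    have "map_pmf ?g L = do {s \<leftarrow> S; zs \<leftarrow> memoryless W (enc s m) (rel s k); s2 \<leftarrow> S; ss \<leftarrow> replicate_pmf B S;
          zs2 \<leftarrow> memoryless W (enc s2 m2) (rel s2 (nxt s k (map snd zs)));
          h \<leftarrow> blocks ss ms' (nxt s2 (nxt s k (map snd zs)) (map snd zs2)); return_pmf (s, zs, s2, take n (zs2 @ h))}"
      by (simp add: L_def map_bind_pmf bind_assoc_pmf bind_return_pmf)
    also have "\<dots> = do {s \<leftarrow> S; zs \<leftarrow> memoryless W (enc s m) (rel s k); s2 \<leftarrow> S; ss \<leftarrow> replicate_pmf B S;
          zs2 \<leftarrow> memoryless W (enc s2 m2) (rel s2 (nxt s k (map snd zs)));
          h \<leftarrow> blocks ss ms' (nxt s2 (nxt s k (map snd zs)) (map snd zs2)); return_pmf (s, zs, s2, zs2)}"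
    proof (intro bind_pmf_cong[OF refl] arg_cong[of _ _ return_pmf] arg_cong2[of _ _ _ _ Pair] refl)
      fix s zs s2 ss zs2 h assume s: "s \<in> set_pmf S" "s2 \<in> set_pmf S" 
        and zs2: "zs2 \<in> set_pmf (memoryless W (enc s2 m2) (rel s2 (nxt s k (map snd zs))))"
      have "length zs2 = n"
        using zs2 len_enc[OF s(2) m(2)] len_rel[OF s(2) nxt_less[OF s(1) \<open>k < K\<close>]] by (auto dest: length_memoryless)
      then show "take n (zs2 @ h) = zs2" by simp
    qed
    also have "\<dots> = do {s \<leftarrow> S; zs \<leftarrow> memoryless W (enc s m) (rel s k); s2 \<leftarrow> S;
          zs2 \<leftarrow> memoryless W (enc s2 m2) (rel s2 (nxt s k (map snd zs))); return_pmf (s, zs, s2, zs2)}"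
      by simp
    finally have "measure_pmf.prob (map_pmf ?g L)
        {(s, zs, s2, zs2). dec s s2 k (map fst zs) (map fst zs2) \<noteq> (m, nxt s k (map snd zs))} \<le> \<epsilon>"
      using step_error[OF m \<open>k < K\<close>] by simp
    then show ?thesis by (simp add: E1_def vimage_def case_prod_unfold)
  qed
  also have "measure_pmf.prob L E2 \<le> real B * \<epsilon>"
    unfolding L_def
  \<comment> \<open>The induction hypothesis holds for every initial index, hence conditionally on
    the first seed and the first block outputs.\<close>
  proof (rule prob_bind_le, rule prob_bind_le)
    fix s and zs :: "('y \<times> 'yr) list" assume s: "s \<in> set_pmf S"
    let ?k = "nxt s k (map snd zs)"
    have "do {ss \<leftarrow> replicate_pmf (Suc B) S; h \<leftarrow> blocks ss (m2 # ms') ?k; return_pmf (s, zs, ss, h)} =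
      map_pmf (\<lambda>(ss, h). (s, zs, ss, h)) (do {ss \<leftarrow> replicate_pmf (Suc B) S; h \<leftarrow> blocks ss (m2 # ms') ?k; return_pmf (ss, h)})"
      by (simp add: map_bind_pmf del: replicate_pmf.simps)
    also have "measure_pmf.prob \<dots> E2 = measure_pmf.prob (do {ss \<leftarrow> replicate_pmf (Suc B) S; h \<leftarrow> blocks ss (m2 # ms') ?k; return_pmf (ss, h)})
        {(ss, h). decode ss ?k (map fst h) \<noteq> butlast (m2 # ms')}"
      by (simp add: E2_def vimage_def case_prod_unfold del: replicate_pmf.simps)
    also have "\<dots> \<le> real B * \<epsilon>"
      using Suc.prems ms len by (intro Suc.IH nxt_less s) auto
    finally show "measure_pmf.prob (do {ss \<leftarrow> replicate_pmf (Suc B) S; h \<leftarrow> blocks ss (m2 # ms') ?k; 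
       return_pmf (s, zs, ss, h)}) E2 \<le> real B * \<epsilon>" .
  qed
  finally show ?case by (simp add: algebra_simps)
qed

text \<open>The error averaged over both the seeds and the uniform message is bounded, so some fixed
  list of seeds does at least as well. Messages are embedded injectively into words of B block
  messages.\<close>

theorem exists_code:
  assumes n: "Suc B * n \<le> N" and card: "card (messages R N) \<le> M ^ B"
  shows "\<exists>c. is_code R N c \<and> error_prob W R N c \<le> real B * \<epsilon>"
proof -
  let ?Words = "{ms. set ms \<subseteq> {..<M} \<and> length ms = B}"
  have fin_mes: "finite (messages R N)" and mes_ne: "messages R N \<noteq> {}"
    by (auto simp: messages_def less_eq_Suc_le[symmetric])
  have "card (messages R N) \<le> card ?Words"
    using card card_lists_length_eq[of "{..<M}" B] by simp
  then obtain \<phi> where \<phi>: "\<phi> ` messages R N \<subseteq> ?Words" "inj_on \<phi> (messages R N)"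
    using card_le_inj[OF fin_mes finite_lists_length_eq[of "{..<M}" B]] by auto
  \<comment> \<open>The appended 0 is a dummy message for the last block, and 0 is the initial index
    agreed upon beforehand.\<close>
  define err where "err ss m = measure_pmf.prob (blocks ss (\<phi> m @ [0]) 0) {h. decode ss 0 (map fst h) \<noteq> \<phi> m}" for ss m
  let ?SS = "replicate_pmf (Suc B) S" and ?Mes = "pmf_of_set (messages R N)"
  have fin_M: "finite (set_pmf ?Mes)" using fin_mes mes_ne by simp
  have "expect ?SS (\<lambda>ss. expect ?Mes (err ss)) = expect ?Mes (\<lambda>m. expect ?SS (\<lambda>ss. err ss m))"
    by (rule expect_commute[OF finite_seeds fin_M])
  also have "\<dots> \<le> real B * \<epsilon>"
  proof (rule expect_le_const[OF fin_M])
    fix m assume "m \<in> set_pmf ?Mes"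
    then have m: "\<phi> m \<in> ?Words" using \<phi> fin_mes mes_ne by auto
    have "expect ?SS (\<lambda>ss. err ss m) = 
      measure_pmf.prob (do {ss \<leftarrow> replicate_pmf (Suc B) S; h \<leftarrow> blocks ss (\<phi> m @ [0]) 0; return_pmf (ss, h)})
      {(ss, h). decode ss 0 (map fst h) \<noteq> butlast (\<phi> m @ [0])}"
      unfolding err_def
      by (subst prob_bind_finite[OF finite_seeds])
        (simp add: vimage_def map_pmf_def[symmetric] del: replicate_pmf.simps)
    also have "\<dots> \<le> real B * \<epsilon>" using m M K by (intro expect_decode_error) auto
    finally show "expect ?SS (\<lambda>ss. err ss m) \<le> real B * \<epsilon>" .
  qed
  finally obtain ss where ss: "ss \<in> set_pmf ?SS" and err: "expect ?Mes (err ss) \<le> real B * \<epsilon>"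
    using exists_le_expect[OF finite_seeds] by blast
  have ss_S: "set ss \<subseteq> set_pmf S" and len_ss: "length ss = Suc B"
    using ss by (auto simp: set_replicate_pmf simp del: replicate_pmf.simps)
  define cw where "cw m = concat (map2 enc ss (\<phi> m @ [0]))" for m
  \<comment> \<open>Unspecified symbols pad the codeword to length N and the decoder drops their
    outputs. Decoded words that belong to no message yield \<open>None\<close>, since a code may
    output valid messages only.\<close>
  define c where "c = \<lparr>encoder = \<lambda>m. cw m @ replicate (N - Suc B * n) undefined,
     relay_encoder = \<lambda>i. strategy ss 0,
     decoder = \<lambda>ys. let l = decode ss 0 (take (Suc B * n) ys) in
        if l \<in> \<phi> ` messages R N then Some (inv_into (messages R N) \<phi> l) else None\<rparr>"
  have len_cw: "length (cw m) = Suc B * n" if m: "m \<in> messages R N" for m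
  proof -
    have "length xs = n" if in_map: "xs \<in> set (map2 enc ss (\<phi> m @ [0]))" for xs
    proof -
      obtain s b where "(s, b) \<in> set (zip ss (\<phi> m @ [0]))" and xs: "xs = enc s b"
        using in_map by auto
      then have "s \<in> set ss" "b \<in> set (\<phi> m @ [0])" by (blast dest: set_zip_leftD set_zip_rightD)+
      then show ?thesis using ss_S \<phi> m M unfolding xs by (intro len_enc) auto
    qed
    then have "map length (map2 enc ss (\<phi> m @ [0])) = replicate (length (map2 enc ss (\<phi> m @ [0]))) n"
      by (intro replicate_eqI) auto
    moreover have "length (map2 enc ss (\<phi> m @ [0])) = Suc B" using len_ss \<phi> m by auto
    ultimately show ?thesis
      unfolding cw_def length_concat by (simp only: sum_list_replicate of_nat_id)
  qed
  have "is_code R N c"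
    using n by (auto simp: is_code_def c_def len_cw Let_def inv_into_into split: if_splits)
  moreover have "error_prob W R N c = expect ?Mes (\<lambda>m. measure_pmf.prob
     (channel_outputs W (encoder c m) (relay_encoder c) N) {h. decoder c (map fst h) \<noteq> Some m})"
    unfolding error_prob_def message_estimate_def
    by (subst prob_bind_finite[OF fin_M]) (simp add: map_pmf_def[symmetric] vimage_def)
  moreover have "\<dots> = expect ?Mes (err ss)"
  proof (rule expect_cong)
    fix m assume "m \<in> set_pmf ?Mes"
    then have m: "m \<in> messages R N" using fin_mes mes_ne by auto
    have \<phi>m: "\<phi> m \<in> ?Words" using \<phi> m by auto
    have run: "run W (cw m) (strategy ss 0) = blocks ss (\<phi> m @ [0]) 0"
      unfolding cw_def using \<phi>m len_ss ss_S M K by (intro run_blocks) auto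
    have "channel_outputs W (encoder c m) (relay_encoder c) N = run W (encoder c m) (strategy ss 0)"
      using n len_cw[OF m] by (subst channel_outputs_eq_run) (auto simp: c_def)
    also have "\<dots> = do {h \<leftarrow> blocks ss (\<phi> m @ [0]) 0; h' \<leftarrow> run W (replicate (N - Suc B * n) undefined) 
        (\<lambda>v. strategy ss 0 (map snd h @ v)); return_pmf (h @ h')}"
      by (simp add: c_def run_append run)
    finally have "map_pmf (take (Suc B * n)) (channel_outputs W (encoder c m) (relay_encoder c) N) =
        do {h \<leftarrow> blocks ss (\<phi> m @ [0]) 0; h' \<leftarrow> run W (replicate (N - Suc B * n) undefined) 
        (\<lambda>v. strategy ss 0 (map snd h @ v)); return_pmf (take (Suc B * n) (h @ h'))}"
      by (simp add: map_bind_pmf)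
    also have "\<dots> = do {h \<leftarrow> blocks ss (\<phi> m @ [0]) 0; h' \<leftarrow> run W (replicate (N - Suc B * n) undefined) 
        (\<lambda>v. strategy ss 0 (map snd h @ v)); return_pmf h}"
    proof (intro bind_pmf_cong[OF refl] arg_cong[of _ _ return_pmf])
      fix h h' assume "h \<in> set_pmf (blocks ss (\<phi> m @ [0]) 0)"
      then have "length h = Suc B * n" using length_run[of h W "cw m" "strategy ss 0"] run len_cw[OF m] by auto
      then show "take (Suc B * n) (h @ h') = h" by simp
    qed
    also have "\<dots> = blocks ss (\<phi> m @ [0]) 0" by (simp add: bind_return_pmf')
    finally have *: "map_pmf (take (Suc B * n)) (channel_outputs W (encoder c m) (relay_encoder c) N) 
      = blocks ss (\<phi> m @ [0]) 0" .
    have dec_iff: "decoder c (map fst h) \<noteq> Some m \<longleftrightarrow> decode ss 0 (map fst (take (Suc B * n) h)) \<noteq> \<phi> m" for h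
      using \<phi>(2) m by (auto simp: c_def Let_def take_map inv_into_f_f f_inv_into_f dest: inj_onD)
    show "measure_pmf.prob (channel_outputs W (encoder c m) (relay_encoder c) N) {h. decoder c (map fst h) \<noteq> Some m} = err ss m"
      unfolding err_def *[symmetric] dec_iff by (simp add: vimage_def)
  qed
  ultimately show ?thesis using err by auto
qed

end

section \<open>Product codes and the law of large numbers\<close>

lemma sum_list_map_eq_sum_nth: "length ws = n \<Longrightarrow> sum_list (map f ws) = (\<Sum>i<n. f (ws ! i))"
  by (simp add: sum_list_sum_nth atLeast0LessThan)

lemma finite_replicate_pmf: "finite (set_pmf p) \<Longrightarrow> finite (set_pmf (replicate_pmf n p))"
  by (induction n) (auto simp: set_bind_pmf)

lemma expect_replicate_square:
  fixes f :: "'a \<Rightarrow> real"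
  assumes fin: "finite (set_pmf p)" and mean: "expect p f = 0"
  shows "expect (replicate_pmf n p) (\<lambda>ws. (sum_list (map f ws))\<^sup>2) = real n * expect p (\<lambda>w. (f w)\<^sup>2)"
proof (induction n)
  case (Suc n)
  have finr: "finite (set_pmf (replicate_pmf n p))" by (rule finite_replicate_pmf[OF fin])
  have "expect (replicate_pmf (Suc n) p) (\<lambda>ws. (sum_list (map f ws))\<^sup>2)
     = expect p (\<lambda>w. expect (replicate_pmf n p) (\<lambda>ws. (f w)\<^sup>2 + 2 * f w * sum_list (map f ws) + (sum_list (map f ws))\<^sup>2))"
    using fin finr by (simp add: expect_bind set_bind_pmf power2_sum algebra_simps)
  also have "\<dots> = expect p (\<lambda>w. (f w)\<^sup>2) + 2 * expect p f * expect (replicate_pmf n p) (\<lambda>ws. sum_list (map f ws))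
      + expect (replicate_pmf n p) (\<lambda>ws. (sum_list (map f ws))\<^sup>2)"
    using fin finr by (simp add: expect_add)
  finally show ?case using Suc mean by (simp add: algebra_simps)
qed simp

lemma chebyshev_replicate:
  fixes f :: "'a \<Rightarrow> real"
  assumes fin: "finite (set_pmf p)" and n: "0 < n" and \<gamma>: "0 < \<gamma>"
  shows "measure_pmf.prob (replicate_pmf n p) {ws. \<bar>sum_list (map f ws) - real n * expect p f\<bar> > real n * \<gamma>}
      \<le> expect p (\<lambda>w. (f w - expect p f)\<^sup>2) / (real n * \<gamma>\<^sup>2)" (is "measure_pmf.prob ?P ?B \<le> ?v / _")
proof -
  let ?g = "\<lambda>w. f w - expect p f"
  have sum_g: "sum_list (map ?g ws) = sum_list (map f ws) - real (length ws) * expect p f" for ws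
    by (induction ws) (auto simp: algebra_simps)
  have "measure_pmf.prob ?P ?B = expect ?P (\<lambda>ws. of_bool (ws \<in> ?B))"
    by (simp add: expect_indicator_Collect)
  also have "\<dots> \<le> expect ?P (\<lambda>ws. (sum_list (map ?g ws))\<^sup>2 / (real n * \<gamma>)\<^sup>2)"
  proof (rule expect_mono[OF finite_replicate_pmf[OF fin]])
    fix ws assume "ws \<in> set_pmf ?P"
    then have len: "length ws = n" by (simp add: set_replicate_pmf)
    show "of_bool (ws \<in> ?B) \<le> (sum_list (map ?g ws))\<^sup>2 / (real n * \<gamma>)\<^sup>2"
    proof (cases "ws \<in> ?B")
      case True
      then have "\<bar>real n * \<gamma>\<bar> \<le> \<bar>sum_list (map ?g ws)\<bar>"
        using n \<gamma> unfolding sum_g len by simp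
      then have "(real n * \<gamma>)\<^sup>2 \<le> (sum_list (map ?g ws))\<^sup>2" by (simp add: abs_le_square_iff)
      then show ?thesis using True n \<gamma> by simp
    qed simp
  qed
  also have "\<dots> = real n * ?v / (real n * \<gamma>)\<^sup>2"
    using expect_replicate_square[OF fin, of ?g n] fin by (simp add: expect_diff)
  also have "\<dots> = ?v / (real n * \<gamma>\<^sup>2)" using n by (simp add: power2_eq_square)
  finally show ?thesis .
qed

text \<open>An input word followed by its memoryless output is a word of independent pairs; keeping
  an arbitrary continuation \<open>F\<close> allows repeated rewriting.\<close>

lemma bind_replicate_mapM:
  "do {ws \<leftarrow> replicate_pmf n p; ys \<leftarrow> mapM_pmf f ws; F ws ys}
   = do {ps \<leftarrow> replicate_pmf n (do {w \<leftarrow> p; y \<leftarrow> f w; return_pmf (w, y)}); F (map fst ps) (map snd ps)}"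
proof -
  let ?v = "replicate n ()"
  have "do {ps \<leftarrow> replicate_pmf n (do {w \<leftarrow> p; y \<leftarrow> f w; return_pmf (w, y)}); F (map fst ps) (map snd ps)}
    = do {ps \<leftarrow> do {ws \<leftarrow> mapM_pmf (\<lambda>_. p) ?v; ys \<leftarrow> mapM_pmf f ws; return_pmf (zip ws ys)}; F (map fst ps) (map snd ps)}"
    unfolding zip_mapM_pmf by (simp add: mapM_pmf_const)
  also have "\<dots> = do {ws \<leftarrow> replicate_pmf n p; ys \<leftarrow> mapM_pmf f ws; F (map fst (zip ws ys)) (map snd (zip ws ys))}"
    by (simp add: mapM_pmf_const bind_assoc_pmf bind_return_pmf)
  also have "\<dots> = do {ws \<leftarrow> replicate_pmf n p; ys \<leftarrow> mapM_pmf f ws; F ws ys}"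
    by (intro bind_pmf_cong refl) (auto dest!: length_mapM_pmf)
  finally show ?thesis ..
qed

lemma mapM_pmf_map: "mapM_pmf f (map g ws) = mapM_pmf (\<lambda>w. f (g w)) ws"
  by (induction ws) auto

lemma bind_replicate_replicate:
  "do {ws \<leftarrow> replicate_pmf n p; ys \<leftarrow> replicate_pmf n p'; F ws ys}
   = do {ps \<leftarrow> replicate_pmf n (do {w \<leftarrow> p; y \<leftarrow> p'; return_pmf (w, y)}); F (map fst ps) (map snd ps)}"
  unfolding bind_replicate_mapM[of n p "\<lambda>_. p'", symmetric]
  by (intro bind_pmf_cong refl) (simp add: mapM_pmf_const set_replicate_pmf)

text \<open>The one-shot setting needs the two output sequences as a pair, whereas the channel
  produces a list of pairs.\<close>

definition unzip_pmf :: "('y \<times> 'yr) list pmf \<Rightarrow> ('y list \<times> 'yr list) pmf" where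
  "unzip_pmf = map_pmf (\<lambda>zs. (map fst zs, map snd zs))"

section \<open>Weights of a block as products of letter weights\<close>

locale cf_letter = cf_weights px pxr W t q e D1 A1 A2 D2
  for px :: "'x::finite pmf" and pxr :: "'xr::finite pmf"
    and W :: "('x, 'xr, 'y::finite, 'yr::finite) relay_channel"
    and t :: "'xr \<Rightarrow> 'u pmf" and q and e D1 A1 A2 D2
begin

abbreviation "pxn n \<equiv> replicate_pmf n px"
abbreviation "pxrn n \<equiv> replicate_pmf n pxr"
definition "Wn xs rs = unzip_pmf (memoryless W xs rs)"
definition "qn vs rs = mapM_pmf (\<lambda>(v, r). q v r) (zip vs rs)"
definition "en n vs rs us = (\<Prod>i<n. e (vs ! i) (rs ! i) (us ! i))"
definition "D1n n xs rs ys us = (\<Prod>i<n. D1 (xs ! i) (rs ! i) (ys ! i) (us ! i))"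
definition "A1n n rs ys us = (\<Prod>i<n. A1 (rs ! i) (ys ! i) (us ! i))"
definition "A2n n xs rs ys = (\<Prod>i<n. A2 (xs ! i) (rs ! i) (ys ! i))"
definition "D2n n rs ys = (\<Prod>i<n. D2 (rs ! i) (ys ! i))"

lemma expect_replicate_prod:
  assumes "finite (set_pmf p)"
  shows "expect (replicate_pmf n p) (\<lambda>ws. \<Prod>i<n. f i (ws ! i)) = (\<Prod>i<n. expect p (f i))"
  using expect_mapM_prod[of "replicate n ()" "\<lambda>_. p" f] assms by (simp add: mapM_pmf_const)

lemma Wn_nth:
  assumes "(ys, vs) \<in> set_pmf (Wn xs rs)" "length xs = n" "length rs = n"
  shows "length ys = n" "length vs = n" "i < n \<Longrightarrow> (ys ! i, vs ! i) \<in> set_pmf (W (xs ! i) (rs ! i))"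
proof -
  obtain zs where zs: "zs \<in> set_pmf (memoryless W xs rs)" "ys = map fst zs" "vs = map snd zs"
    using assms by (auto simp: Wn_def unzip_pmf_def)
  have "length zs = n" using length_memoryless[OF zs(1)] assms by simp
  moreover have "i < n \<Longrightarrow> zs ! i \<in> set_pmf (W (xs ! i) (rs ! i))"
    using zs(1) assms by (auto simp: memoryless_def set_mapM_pmf)
  ultimately show "length ys = n" "length vs = n" "i < n \<Longrightarrow> (ys ! i, vs ! i) \<in> set_pmf (W (xs ! i) (rs ! i))"
    using zs by auto
qed

lemma pxn_nth: "xs \<in> set_pmf (pxn n) \<Longrightarrow> length xs = n \<and> (\<forall>i<n. xs ! i \<in> set_pmf px)"
  and pxrn_nth: "rs \<in> set_pmf (pxrn n) \<Longrightarrow> length rs = n \<and> (\<forall>i<n. rs ! i \<in> set_pmf pxr)"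
  by (auto simp: set_replicate_pmf lists_eq_set dest: nth_mem)

text \<open>Nonnegative inequalities and the density identity multiply over positions. The weights
  read exactly n positions, so the mean bounds hold even for output lists of another length;
  compression words of a wrong length have probability 0 on both sides of the density
  identity.\<close>

lemma cf_weights_lift:
  "cf_weights (pxn n) (pxrn n) Wn (mapM_pmf t) qn (en n) (D1n n) (A1n n) (A2n n) (D2n n)"
proof
  show "finite (set_pmf (pxn n))" "finite (set_pmf (pxrn n))" "finite (set_pmf (mapM_pmf t rs))"
    and "finite (set_pmf (qn vs rs))" for vs rs
    using fin by (auto intro!: finite_replicate_pmf finite_set_mapM_pmf simp: qn_def)
  show "finite (set_pmf (Wn xs rs))" for xs rs
    using finite_memoryless[of W xs rs] by (simp add: Wn_def unzip_pmf_def)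
  show "en n vs rs us \<ge> 0" "D1n n xs rs ys us \<ge> 0" "A1n n rs ys us \<ge> 0" "A2n n xs rs ys \<ge> 0" "D2n n rs ys \<ge> 0"
    for xs rs ys vs us
    by (auto simp: en_def D1n_def A1n_def A2n_def D2n_def intro!: prod_nonneg nonneg)
  show "expect (mapM_pmf t rs) (en n vs rs) \<le> 1" if "rs \<in> set_pmf (pxrn n)" for vs rs
    using expect_mapM_prod[of rs t "\<lambda>i. e (vs ! i) (rs ! i)"] pxrn_nth[OF that] fin
    by (auto simp: en_def[abs_def] intro!: prod_le_1 e_mean expect_nonneg nonneg)
  show "expect (mapM_pmf t rs) (D1n n xs rs ys) \<le> A2n n xs rs ys" if "rs \<in> set_pmf (pxrn n)" for xs rs ys
    using expect_mapM_prod[of rs t "\<lambda>i. D1 (xs ! i) (rs ! i) (ys ! i)"] pxrn_nth[OF that] fin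
    by (auto simp: D1n_def[abs_def] A2n_def intro!: prod_mono D1_mean_u expect_nonneg nonneg)
  show "expect (pxn n) (\<lambda>xs. D1n n xs rs ys us) \<le> A1n n rs ys us" if "rs \<in> set_pmf (pxrn n)" for rs ys us
    unfolding D1n_def A1n_def using pxrn_nth[OF that]
    by (subst expect_replicate_prod[OF fin(1), where f = "\<lambda>i x. D1 x (rs ! i) (ys ! i) (us ! i)"])
      (auto intro!: prod_mono D1_mean_x expect_nonneg nonneg)
  show "expect (pxn n) (\<lambda>xs. A2n n xs rs ys) \<le> 1" if "rs \<in> set_pmf (pxrn n)" for rs ys
    unfolding A2n_def using pxrn_nth[OF that]
    by (subst expect_replicate_prod[OF fin(1), where f = "\<lambda>i x. A2 x (rs ! i) (ys ! i)"])
      (auto intro!: prod_le_1 A2_mean expect_nonneg nonneg)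
  show "expect (pxrn n) (\<lambda>rs. D2n n rs ys) \<le> 1" for ys
    unfolding D2n_def
    by (subst expect_replicate_prod[OF fin(2), where f = "\<lambda>i r. D2 r (ys ! i)"])
      (auto intro!: prod_le_1 D2_mean expect_nonneg nonneg)
  fix xs rs ys vs us
  assume xs: "xs \<in> set_pmf (pxn n)" and rs: "rs \<in> set_pmf (pxrn n)" and z: "(ys, vs) \<in> set_pmf (Wn xs rs)"
  note nth = pxn_nth[OF xs] pxrn_nth[OF rs] Wn_nth[OF z]
  show "pmf (mapM_pmf t rs) us * en n vs rs us = pmf (qn vs rs) us"
  proof (cases "length us = n")
    case True
    then show ?thesis using nth
      by (auto simp: pmf_mapM_pmf qn_def en_def prod.distrib[symmetric] intro!: prod.cong e_density)
  next
    case False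
    then have "pmf (mapM_pmf t rs) us = 0" "pmf (qn vs rs) us = 0"
      using nth by (auto simp: pmf_eq_0_set_pmf qn_def dest: length_mapM_pmf)
    then show ?thesis by simp
  qed
  assume "us \<in> set_pmf (qn vs rs)"
  then have "us ! i \<in> set_pmf (q (vs ! i) (rs ! i))" if "i < n" for i
    using nth that by (auto simp: qn_def set_mapM_pmf)
  then have "e (vs ! i) (rs ! i) (us ! i) > 0 \<and> D1 (xs ! i) (rs ! i) (ys ! i) (us ! i) > 0 \<and>
     A1 (rs ! i) (ys ! i) (us ! i) > 0 \<and> A2 (xs ! i) (rs ! i) (ys ! i) > 0 \<and> D2 (rs ! i) (ys ! i) > 0" if "i < n" for i
    using that nth by (intro pos) auto
  then show "en n vs rs us > 0 \<and> D1n n xs rs ys us > 0 \<and> A1n n rs ys us > 0 \<and> A2n n xs rs ys > 0 \<and> D2n n rs ys > 0"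
    by (auto simp: en_def D1n_def A1n_def A2n_def D2n_def intro!: prod_pos)
qed

text \<open>One letter of the ideal law \<open>Q\<close>; the nesting of the pairs is the one in
  which the regrouping lemmas for lists deliver them.\<close>

definition letter :: "(((('x \<times> 'xr) \<times> ('y \<times> 'yr)) \<times> 'u) \<times> (('x \<times> 'xr) \<times> ('y \<times> 'yr))) pmf" where
  "letter = do {x \<leftarrow> px; r \<leftarrow> pxr; z \<leftarrow> W x r; u \<leftarrow> q (snd z) r;
           x2 \<leftarrow> px; r2 \<leftarrow> pxr; z2 \<leftarrow> W x2 r2; return_pmf ((((x, r), z), u), ((x2, r2), z2))}"

lemma finite_letter: "finite (set_pmf letter)"
  unfolding letter_def by (intro finite_set_bind_pmf fin) auto

abbreviation "lx \<equiv> \<lambda>w. fst (fst (fst (fst w)))"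
abbreviation "lr \<equiv> \<lambda>w. snd (fst (fst (fst w)))"
abbreviation "lz \<equiv> \<lambda>w. snd (fst (fst w))"
abbreviation "lu \<equiv> \<lambda>w. snd (fst w)"
abbreviation "lx2 \<equiv> \<lambda>w. fst (fst (snd w))"
abbreviation "lr2 \<equiv> \<lambda>w. snd (fst (snd w))"
abbreviation "lz2 \<equiv> \<lambda>w. snd (snd w)"

text \<open>The ideal law of a block is a word of independent letters, so the logarithms of the
  block weights are sums of independent, identically distributed terms.\<close>

lemma bind_Q_lift:
  "do {xs \<leftarrow> pxn n; rs \<leftarrow> pxrn n; z \<leftarrow> Wn xs rs; us \<leftarrow> qn (snd z) rs; x2s \<leftarrow> pxn n; r2s \<leftarrow> pxrn n; 
       z2 \<leftarrow> Wn x2s r2s; F xs rs z us x2s r2s z2}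
   = do {ws \<leftarrow> replicate_pmf n letter; F (map lx ws) (map lr ws) (map (\<lambda>w. fst (lz w)) ws, map (\<lambda>w. snd (lz w)) ws)
       (map lu ws) (map lx2 ws) (map lr2 ws) (map (\<lambda>w. fst (lz2 w)) ws, map (\<lambda>w. snd (lz2 w)) ws)}"
proof -
  have zip_maps: "zip (map f ws) (map g ws) = map (\<lambda>w. (f w, g w)) ws" for f :: "'i \<Rightarrow> 'j" and g :: "'i \<Rightarrow> 'k" and ws
    by (induction ws) auto
  show ?thesis
    unfolding Wn_def unzip_pmf_def qn_def memoryless_def
    by (simp add: bind_map_pmf bind_replicate_replicate zip_maps mapM_pmf_map bind_replicate_mapM
      letter_def bind_assoc_pmf bind_return_pmf comp_def case_prod_unfold)
qed

definition "w_e w = e (snd (lz w)) (lr w) (lu w)"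
definition "w_D1 w = D1 (lx w) (lr w) (fst (lz w)) (lu w)"
definition "w_A1 w = A1 (lr w) (fst (lz w)) (lu w)"
definition "w_A2 w = A2 (lx w) (lr w) (fst (lz w))"
definition "w_D2 w = D2 (lr2 w) (fst (lz2 w))"

lemma w_pos:
  assumes "w \<in> set_pmf letter"
  shows "w_e w > 0" "w_D1 w > 0" "w_A1 w > 0" "w_A2 w > 0" "w_D2 w > 0"
proof -
  obtain x r y v u x2 r2 y2 v2 where w: "w = ((((x, r), (y, v)), u), ((x2, r2), (y2, v2)))"
    by (metis surj_pair)
  have "x \<in> set_pmf px" "r \<in> set_pmf pxr" "(y, v) \<in> set_pmf (W x r)" "u \<in> set_pmf (q v r)"
    "x2 \<in> set_pmf px" "r2 \<in> set_pmf pxr" "(y2, v2) \<in> set_pmf (W x2 r2)"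
    using assms unfolding w letter_def by (auto simp: set_bind_pmf)
  moreover obtain u2 where "u2 \<in> set_pmf (q v2 r2)" using set_pmf_not_empty[of "q v2 r2"] by blast
  ultimately show "w_e w > 0" "w_D1 w > 0" "w_A1 w > 0" "w_A2 w > 0" "w_D2 w > 0"
    using pos[of x r y v u] pos[of x2 r2 y2 v2 u2]
    by (auto simp: w w_e_def w_D1_def w_A1_def w_A2_def w_D2_def)
qed

section \<open>Concentration of the block weights\<close>

abbreviation "mean_log f \<equiv> expect letter (\<lambda>w. log 2 (f w))"
abbreviation "var_log f \<equiv> expect letter (\<lambda>w. (log 2 (f w) - mean_log f)\<^sup>2)"

lemma prod_concentration:
  assumes pos: "\<And>w. w \<in> set_pmf letter \<Longrightarrow> f w > 0" and n: "0 < n" and \<gamma>: "0 < \<gamma>"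
  shows "measure_pmf.prob (replicate_pmf n letter)
     {ws. \<not> ((\<Prod>i<n. f (ws ! i)) \<le> 2 powr (real n * (mean_log f + \<gamma>)) \<and>
             2 powr (real n * (mean_log f - \<gamma>)) \<le> (\<Prod>i<n. f (ws ! i)))}
     \<le> var_log f / (real n * \<gamma>\<^sup>2)"
proof -
  let ?g = "\<lambda>w. log 2 (f w)"
  have "measure_pmf.prob (replicate_pmf n letter)
     {ws. \<not> ((\<Prod>i<n. f (ws ! i)) \<le> 2 powr (real n * (mean_log f + \<gamma>)) \<and>
             2 powr (real n * (mean_log f - \<gamma>)) \<le> (\<Prod>i<n. f (ws ! i)))}
    \<le> measure_pmf.prob (replicate_pmf n letter) {ws. \<bar>sum_list (map ?g ws) - real n * mean_log f\<bar> > real n * \<gamma>}"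
  proof (rule measure_pmf.finite_measure_mono_AE)
    show "AE ws in replicate_pmf n letter. ws \<in> {ws. \<not> ((\<Prod>i<n. f (ws ! i)) \<le> 2 powr (real n * (mean_log f + \<gamma>)) \<and>
             2 powr (real n * (mean_log f - \<gamma>)) \<le> (\<Prod>i<n. f (ws ! i)))} \<longrightarrow>
          ws \<in> {ws. \<bar>sum_list (map ?g ws) - real n * mean_log f\<bar> > real n * \<gamma>}"
      unfolding AE_measure_pmf_iff
    proof (intro ballI impI)
      fix ws assume ws: "ws \<in> set_pmf (replicate_pmf n letter)"
        and bad: "ws \<in> {ws. \<not> ((\<Prod>i<n. f (ws ! i)) \<le> 2 powr (real n * (mean_log f + \<gamma>)) \<and>
             2 powr (real n * (mean_log f - \<gamma>)) \<le> (\<Prod>i<n. f (ws ! i)))}"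
      have len: "length ws = n" and fpos: "\<And>i. i < n \<Longrightarrow> f (ws ! i) > 0"
        using ws by (auto simp: set_replicate_pmf lists_eq_set intro!: pos dest: nth_mem)
      have "(\<Prod>i<n. f (ws ! i)) = 2 powr (\<Sum>i<n. ?g (ws ! i))"
        using fpos by (simp add: powr_sum)
      also have "(\<Sum>i<n. ?g (ws ! i)) = sum_list (map ?g ws)"
        by (rule sum_list_map_eq_sum_nth[OF len, symmetric])
      finally have "\<not> (sum_list (map ?g ws) \<le> real n * (mean_log f + \<gamma>) \<and> real n * (mean_log f - \<gamma>) \<le> sum_list (map ?g ws))"
        using bad by simp
      then show "ws \<in> {ws. \<bar>sum_list (map ?g ws) - real n * mean_log f\<bar> > real n * \<gamma>}"
        by (auto simp: algebra_simps abs_if)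
    qed
  qed simp
  also have "\<dots> \<le> var_log f / (real n * \<gamma>\<^sup>2)"
    by (rule chebyshev_replicate[OF finite_letter n \<gamma>])
  finally show ?thesis .
qed

text \<open>In this order: enough indices to quantize, few enough to identify the index given the
  message, and few enough pairs when both are wrong. Of the margin \<open>2 * \<gamma>\<close>, one
  \<open>\<gamma>\<close> is spent on typicality and the other leaves a factor 2^(-n
  \<open>\<gamma>\<close>). The condition on \<open>R\<close> alone stays separate because it is
  also imposed when the relay has a single index.\<close>

definition "rates_ok R Rr \<gamma> \<longleftrightarrow> mean_log w_e + 2 * \<gamma> \<le> Rr \<and>
   Rr + 2 * \<gamma> \<le> mean_log (\<lambda>w. w_D1 w * w_D2 w / w_A2 w) \<and>
   R + Rr + 2 * \<gamma> \<le> mean_log (\<lambda>w. w_D1 w * w_D2 w)"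

definition "spread = var_log w_e + var_log (\<lambda>w. w_D1 w / w_A1 w) +
   var_log (\<lambda>w. w_D1 w * w_D2 w / w_A2 w) + var_log (\<lambda>w. w_D1 w * w_D2 w)"

text \<open>One error term comes from the quantizer and three from \<open>beta\<close>. The product
  (1 - 4h)(1 + h)(1 + 3h) is 1 - 13h^2 - 12h^3, so the linear terms cancel.\<close>

lemma gain_lower_bound:
  fixes \<eta> f b :: real
  assumes "0 < f" "f \<le> 1 + \<eta>" "0 < b" "b \<le> 1 + 3 * \<eta>" "0 \<le> \<eta>"
  shows "1 - 4 * \<eta> \<le> 1 / (f * b)"
proof -
  have "(1 - 4 * \<eta>) * (f * b) \<le> 1"
  proof (cases "1 - 4 * \<eta> \<le> 0")
    case True
    then have "(1 - 4 * \<eta>) * (f * b) \<le> 0" using assms by (intro mult_nonpos_nonneg) auto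
    then show ?thesis by simp
  next
    case False
    have "f * b \<le> (1 + \<eta>) * (1 + 3 * \<eta>)" using assms by (intro mult_mono) auto
    then have "(1 - 4 * \<eta>) * (f * b) \<le> (1 - 4 * \<eta>) * ((1 + \<eta>) * (1 + 3 * \<eta>))"
      using False by (intro mult_left_mono) auto
    also have "\<dots> = 1 - 13 * (\<eta> * \<eta>) - 12 * (\<eta> * \<eta> * \<eta>)" by (simp add: algebra_simps)
    also have "\<dots> \<le> 1"
    proof -
      have "0 \<le> \<eta> * \<eta>" "0 \<le> \<eta> * \<eta> * \<eta>" using assms by auto
      then show ?thesis by linarith
    qed
    finally show ?thesis .
  qed
  then show ?thesis using assms by (simp add: field_simps)
qed

text \<open>On words typical for all four products every error term in \<open>gain\<close> is at
  most 2^(-n \<open>\<gamma>\<close>). On the other words \<open>gain\<close> is still positive, so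
  they cost no more than their probability, which Chebyshev's inequality bounds by
  \<open>spread\<close>.\<close>

lemma Phi_lift_ge:
  assumes n: "0 < n" and \<gamma>: "0 < \<gamma>" and M: "0 < M" and K: "0 < K"
    and M_le: "real M - 1 \<le> 2 powr (real n * R)"
    and R: "R + 2 * \<gamma> \<le> mean_log (\<lambda>w. w_D1 w / w_A1 w)"
    and relay: "K = 1 \<and> (\<forall>w\<in>set_pmf letter. w_e w = 1) \<or>
       real K - 1 \<le> 2 powr (real n * Rr) \<and> 2 powr (real n * Rr) \<le> real K \<and> rates_ok R Rr \<gamma>"
  shows "cf_weights.Phi (pxn n) (pxrn n) Wn qn (en n) (D1n n) (A1n n) (A2n n) (D2n n) M K
     \<ge> 1 - (4 * 2 powr (- (real n * \<gamma>)) + spread / (real n * \<gamma>\<^sup>2))"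
proof -
  interpret N: cf_weights "pxn n" "pxrn n" Wn "mapM_pmf t" qn "en n" "D1n n" "A1n n" "A2n n" "D2n n"
    by (rule cf_weights_lift)
  let ?P = "replicate_pmf n letter"
  define \<eta> where "\<eta> = 2 powr (- (real n * \<gamma>))"
  define typical where "typical f ws \<longleftrightarrow> (\<Prod>i<n. f (ws ! i)) \<le> 2 powr (real n * (mean_log f + \<gamma>)) \<and>
             2 powr (real n * (mean_log f - \<gamma>)) \<le> (\<Prod>i<n. f (ws ! i))" for f ws
  define good where "good ws \<longleftrightarrow> typical w_e ws \<and> typical (\<lambda>w. w_D1 w / w_A1 w) ws \<and> 
     typical (\<lambda>w. w_D1 w * w_D2 w / w_A2 w) ws \<and> typical (\<lambda>w. w_D1 w * w_D2 w) ws" for ws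
  define G where "G ws = N.gain M K (map lx ws) (map lr ws) (map (\<lambda>w. fst (lz w)) ws, map (\<lambda>w. snd (lz w)) ws)
       (map lu ws) (map lr2 ws) (map (\<lambda>w. fst (lz2 w)) ws, map (\<lambda>w. snd (lz2 w)) ws)"
    for ws :: "(((('x \<times> 'xr) \<times> ('y \<times> 'yr)) \<times> 'u) \<times> (('x \<times> 'xr) \<times> ('y \<times> 'yr))) list"
  have finP: "finite (set_pmf ?P)" by (intro finite_replicate_pmf finite_letter)
  have "N.Q = do {ws \<leftarrow> ?P; return_pmf (map lx ws, map lr ws, (map (\<lambda>w. fst (lz w)) ws, map (\<lambda>w. snd (lz w)) ws),
       map lu ws, map lx2 ws, map lr2 ws, (map (\<lambda>w. fst (lz2 w)) ws, map (\<lambda>w. snd (lz2 w)) ws))}"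
    unfolding N.Q_def by (rule bind_Q_lift)
  then have "N.Phi M K = expect ?P G"
    unfolding N.Phi_def G_def by (simp add: map_pmf_def[symmetric] del: replicate_pmf.simps)
  moreover have "1 - (4 * \<eta> + spread / (real n * \<gamma>\<^sup>2)) \<le> expect ?P (\<lambda>ws. 1 - 4 * \<eta> - of_bool (\<not> good ws))"
  proof -
    have "expect ?P (\<lambda>ws. of_bool (\<not> good ws)) = measure_pmf.prob ?P {ws. \<not> good ws}"
      by (rule expect_indicator_Collect)
    also have "{ws. \<not> good ws} = {ws. \<not> typical w_e ws} \<union> ({ws. \<not> typical (\<lambda>w. w_D1 w / w_A1 w) ws} \<union>
        ({ws. \<not> typical (\<lambda>w. w_D1 w * w_D2 w / w_A2 w) ws} \<union> {ws. \<not> typical (\<lambda>w. w_D1 w * w_D2 w) ws}))"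
      by (auto simp: good_def)
    also have "measure_pmf.prob ?P \<dots> \<le> measure_pmf.prob ?P {ws. \<not> typical w_e ws} +
       (measure_pmf.prob ?P {ws. \<not> typical (\<lambda>w. w_D1 w / w_A1 w) ws} + 
       (measure_pmf.prob ?P {ws. \<not> typical (\<lambda>w. w_D1 w * w_D2 w / w_A2 w) ws} + 
        measure_pmf.prob ?P {ws. \<not> typical (\<lambda>w. w_D1 w * w_D2 w) ws}))"
      by (intro order_trans[OF measure_Un_le] add_left_mono) auto
    also have "\<dots> \<le> var_log w_e / (real n * \<gamma>\<^sup>2) + (var_log (\<lambda>w. w_D1 w / w_A1 w) / (real n * \<gamma>\<^sup>2) +
       (var_log (\<lambda>w. w_D1 w * w_D2 w / w_A2 w) / (real n * \<gamma>\<^sup>2) + var_log (\<lambda>w. w_D1 w * w_D2 w) / (real n * \<gamma>\<^sup>2)))"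
      unfolding typical_def
      by (intro add_mono prod_concentration n \<gamma>) (simp_all add: w_pos)
    also have "\<dots> = spread / (real n * \<gamma>\<^sup>2)" by (simp add: spread_def add_divide_distrib)
    finally show ?thesis using finP by (simp add: expect_diff)
  qed
  moreover have "expect ?P (\<lambda>ws. 1 - 4 * \<eta> - of_bool (\<not> good ws)) \<le> expect ?P G"
  proof (rule expect_mono[OF finP])
    fix ws assume ws: "ws \<in> set_pmf ?P"
    have len: "length ws = n" and in_letter: "\<And>i. i < n \<Longrightarrow> ws ! i \<in> set_pmf letter"
      using ws by (auto simp: set_replicate_pmf lists_eq_set dest: nth_mem)
    note wpos = w_pos[OF in_letter]
    define ee dd aa1 aa2 dd2 where defs: "ee = (\<Prod>i<n. w_e (ws ! i))" "dd = (\<Prod>i<n. w_D1 (ws ! i))"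
      "aa1 = (\<Prod>i<n. w_A1 (ws ! i))" "aa2 = (\<Prod>i<n. w_A2 (ws ! i))" "dd2 = (\<Prod>i<n. w_D2 (ws ! i))"
    have pos: "ee > 0" "dd > 0" "aa1 > 0" "aa2 > 0" "dd2 > 0"
      unfolding defs by (auto intro!: prod_pos wpos)
    define f b where "f = (ee + (real K - 1)) / real K" 
      and "b = 1 + (real M - 1) * (aa1 / dd) + (real K - 1) * (aa2 / (dd * dd2)) + (real M - 1) * (real K - 1) / (dd * dd2)"
    have G: "G ws = 1 / (f * b)"
      unfolding G_def N.gain_def N.beta_def f_def b_def defs using len
      by (simp add: en_def D1n_def A1n_def A2n_def D2n_def w_e_def w_D1_def w_A1_def w_A2_def w_D2_def)
    have \<eta>: "0 \<le> \<eta>" by (simp add: \<eta>_def)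
    have f_pos: "f > 0" unfolding f_def using pos K by (intro divide_pos_pos add_pos_nonneg) auto
    have b_pos: "b > 0" unfolding b_def using pos M K by (intro add_pos_nonneg) auto
    show "1 - 4 * \<eta> - of_bool (\<not> good ws) \<le> G ws"
    proof (cases "good ws")
      case False
      then have "of_bool (\<not> good ws) = (1 :: real)" by simp
      moreover have "0 \<le> 1 / (f * b)" using f_pos b_pos by simp
      ultimately show ?thesis unfolding G using \<eta> by linarith
    next
      case True
      have bnd: "(real M - 1) * (aa1 / dd) \<le> \<eta>"
      proof -
        have "2 powr (real n * (R + \<gamma>)) \<le> 2 powr (real n * (mean_log (\<lambda>w. w_D1 w / w_A1 w) - \<gamma>))"
          using R n by (intro powr_mono mult_left_mono) auto
        also have "\<dots> \<le> dd / aa1"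
          using True unfolding good_def typical_def defs by (simp add: prod_dividef)
        finally have "aa1 / dd \<le> 1 / 2 powr (real n * (R + \<gamma>))"
          using pos by (simp add: field_simps)
        then have "(real M - 1) * (aa1 / dd) \<le> 2 powr (real n * R) * (1 / 2 powr (real n * (R + \<gamma>)))"
          using M M_le pos by (intro mult_mono) auto
        also have "\<dots> = \<eta>" by (simp add: \<eta>_def powr_minus_divide algebra_simps powr_add)
        finally show ?thesis .
      qed
      show ?thesis
        using relay
      proof (elim disjE conjE)
        \<comment> \<open>With a single index and e = 1 the quantizer factor is exactly 1, and all
          terms of \<open>beta\<close> with K - 1 vanish.\<close>
        assume K1: "K = 1" and e1: "\<forall>w\<in>set_pmf letter. w_e w = 1"
        have "ee = 1" unfolding defs using e1 in_letter by (intro prod.neutral) auto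
        then have "f = 1" "b \<le> 1 + 3 * \<eta>" using K1 bnd \<eta> by (auto simp: f_def b_def)
        then show ?thesis unfolding G using True \<eta> b_pos gain_lower_bound[of f \<eta> b] by simp
      next
        assume K_le: "real K - 1 \<le> 2 powr (real n * Rr)" and K_ge: "2 powr (real n * Rr) \<le> real K"
          and ok: "rates_ok R Rr \<gamma>"
        have "ee \<le> 2 powr (real n * (mean_log w_e + \<gamma>))" using True unfolding good_def typical_def defs by simp
        also have "\<dots> \<le> 2 powr (real n * (Rr - \<gamma>))"
          using ok n unfolding rates_ok_def by (intro powr_mono mult_left_mono) auto
        also have "\<dots> = \<eta> * 2 powr (real n * Rr)" by (simp add: \<eta>_def powr_add[symmetric] algebra_simps)
        also have "\<dots> \<le> \<eta> * real K" using K_ge \<eta> by (intro mult_left_mono)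
        finally have "f \<le> 1 + \<eta>" using K unfolding f_def by (simp add: field_simps)
        moreover have "(real K - 1) * (aa2 / (dd * dd2)) \<le> \<eta>"
        proof -
          have "2 powr (real n * (Rr + \<gamma>)) \<le> 2 powr (real n * (mean_log (\<lambda>w. w_D1 w * w_D2 w / w_A2 w) - \<gamma>))"
            using ok n unfolding rates_ok_def by (intro powr_mono mult_left_mono) auto
          also have "\<dots> \<le> dd * dd2 / aa2"
            using True unfolding good_def typical_def defs by (simp add: prod_dividef prod.distrib)
          finally have "aa2 / (dd * dd2) \<le> 1 / 2 powr (real n * (Rr + \<gamma>))"
            using pos by (simp add: field_simps)
          then have "(real K - 1) * (aa2 / (dd * dd2)) \<le> 2 powr (real n * Rr) * (1 / 2 powr (real n * (Rr + \<gamma>)))"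
            using K K_le pos by (intro mult_mono) auto
          also have "\<dots> = \<eta>" by (simp add: \<eta>_def powr_minus_divide algebra_simps powr_add)
          finally show ?thesis .
        qed
        moreover have "(real M - 1) * (real K - 1) / (dd * dd2) \<le> \<eta>"
        proof -
          have "2 powr (real n * (R + Rr + \<gamma>)) \<le> 2 powr (real n * (mean_log (\<lambda>w. w_D1 w * w_D2 w) - \<gamma>))"
            using ok n unfolding rates_ok_def by (intro powr_mono mult_left_mono) auto
          also have "\<dots> \<le> dd * dd2"
            using True unfolding good_def typical_def defs by (simp add: prod.distrib)
          finally have le: "2 powr (real n * (R + Rr + \<gamma>)) \<le> dd * dd2" .
          have "(real M - 1) * (real K - 1) / (dd * dd2) \<le> (2 powr (real n * R) * 2 powr (real n * Rr)) / 2 powr (real n * (R + Rr + \<gamma>))"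
            using M K K_le M_le pos le by (intro frac_le mult_mono) auto
          also have "\<dots> = \<eta>" by (simp add: \<eta>_def powr_minus_divide algebra_simps powr_add)
          finally show ?thesis .
        qed
        ultimately have "f \<le> 1 + \<eta>" "b \<le> 1 + 3 * \<eta>" using bnd by (auto simp: b_def)
        then show ?thesis unfolding G using True \<eta> b_pos f_pos gain_lower_bound[of f \<eta> b] by simp
      qed
    qed
  qed
  ultimately show ?thesis by (simp add: \<eta>_def)
qed

lemma exists_product_code:
  assumes n: "0 < n" and \<gamma>: "0 < \<gamma>" and M: "0 < M" and K: "0 < K"
    and M_le: "real M - 1 \<le> 2 powr (real n * R)"
    and R: "R + 2 * \<gamma> \<le> mean_log (\<lambda>w. w_D1 w / w_A1 w)"
    and relay: "K = 1 \<and> (\<forall>w\<in>set_pmf letter. w_e w = 1) \<or>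
       real K - 1 \<le> 2 powr (real n * Rr) \<and> 2 powr (real n * Rr) \<le> real K \<and> rates_ok R Rr \<gamma>"
    and N: "Suc B * n \<le> N" and card: "card (messages R' N) \<le> M ^ B"
  shows "\<exists>c. is_code R' N c \<and>
    error_prob W R' N c \<le> real B * (2 * (4 * 2 powr (- (real n * \<gamma>)) + spread / (real n * \<gamma>\<^sup>2)))"
proof -
  interpret N: cf_weights "pxn n" "pxrn n" Wn "mapM_pmf t" qn "en n" "D1n n" "A1n n" "A2n n" "D2n n"
    by (rule cf_weights_lift)
  let ?S = "N.seed_pmf M K"
  have enc: "fst s m \<in> set_pmf (pxn n)" if "s \<in> set_pmf ?S" "m < M" for s m
    using that by (auto simp: N.seed_pmf_def set_Pi_pmf PiE_dflt_def)
  have rel: "fst (snd s k) \<in> set_pmf (pxrn n)" if "s \<in> set_pmf ?S" "k < K" for s k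
  proof -
    have "snd s k \<in> set_pmf (N.cell_pmf K)"
      using that by (auto simp: N.seed_pmf_def set_Pi_pmf PiE_dflt_def)
    then have "fst (snd s k) \<in> set_pmf (map_pmf fst (N.cell_pmf K))" by simp
    then show ?thesis unfolding N.map_fst_cell_pmf .
  qed
  interpret block_scheme W n M K ?S "\<lambda>s m. fst s m" "\<lambda>s k. fst (snd s k)" N.next_index "N.decode_pair M K"
    "2 * (1 - N.Phi M K)"
  proof
    show "finite (set_pmf ?S)" using K by (rule N.finite_set_seed_pmf)
    show "length (fst s m) = n" if "s \<in> set_pmf ?S" "m < M" for s m
      using enc[OF that] by (simp add: set_replicate_pmf)
    show "length (fst (snd s k)) = n" if "s \<in> set_pmf ?S" "k < K" for s k
      using rel[OF that] by (simp add: set_replicate_pmf)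
    show "N.next_index s k v < K" if "s \<in> set_pmf ?S" "k < K" for s k v
      using that by (rule N.next_index_less)
    fix m m2 k assume m: "m < M" "m2 < M" and k: "k < K"
    let ?unz = "\<lambda>zs. (map fst zs, map snd zs)"
    let ?L = "do {s \<leftarrow> ?S; zs \<leftarrow> memoryless W (fst s m) (fst (snd s k)); s2 \<leftarrow> ?S;
          zs2 \<leftarrow> memoryless W (fst s2 m2) (fst (snd s2 (N.next_index s k (map snd zs)))); return_pmf (s, zs, s2, zs2)}"
    have "do {s \<leftarrow> ?S; z \<leftarrow> Wn (fst s m) (fst (snd s k)); s2 \<leftarrow> ?S;
          z2 \<leftarrow> Wn (fst s2 m2) (fst (snd s2 (N.next_index s k (snd z)))); return_pmf (s, z, s2, z2)}
       = map_pmf (\<lambda>(s, zs, s2, zs2). (s, ?unz zs, s2, ?unz zs2)) ?L"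
      by (simp add: Wn_def unzip_pmf_def map_bind_pmf bind_map_pmf)
    with N.oneshot_error[OF m k] show "measure_pmf.prob ?L 
        {(s, zs, s2, zs2). N.decode_pair M K s s2 k (map fst zs) (map fst zs2) \<noteq> (m, N.next_index s k (map snd zs))}
       \<le> 2 * (1 - N.Phi M K)"
      by (simp add: vimage_def case_prod_unfold)
  qed (use M K in auto)
  obtain c where c: "is_code R' N c" "error_prob W R' N c \<le> real B * (2 * (1 - N.Phi M K))"
    using exists_code[OF N card] by auto
  note c(2)
  also have "real B * (2 * (1 - N.Phi M K)) 
      \<le> real B * (2 * (4 * 2 powr (- (real n * \<gamma>)) + spread / (real n * \<gamma>\<^sup>2)))"
    using Phi_lift_ge[OF n \<gamma> M K M_le R relay] by (intro mult_left_mono) auto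
  finally show ?thesis using c(1) by auto
qed

section \<open>From block codes to sequences of codes\<close>

lemma nat_ceiling_bounds:
  fixes x :: real assumes "0 < x"
  shows "x \<le> real (nat \<lceil>x\<rceil>)" "real (nat \<lceil>x\<rceil>) - 1 \<le> x" "0 < nat \<lceil>x\<rceil>"
  using assms by (auto simp: of_nat_nat)

text \<open>The number B of messages per code stays fixed while the block length grows, so B times
  the step error still tends to 0; the rate lost in the additional block and in rounding is paid by
  the gap between R' and R.\<close>

theorem codes_of_rate_less:
  assumes R': "0 \<le> R'" "R' < R" and \<gamma>: "0 < \<gamma>"
    and R: "R + 2 * \<gamma> \<le> mean_log (\<lambda>w. w_D1 w / w_A1 w)"
    and relay: "(\<forall>w\<in>set_pmf letter. w_e w = 1) \<or> rates_ok R Rr \<gamma>"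
  shows "\<exists>c. (\<forall>N. is_code R' N (c N)) \<and> (\<lambda>N. error_prob W R' N (c N)) \<longlonglongrightarrow> 0"
proof -
  \<comment> \<open>This choice of B is equivalent to B R > (B + 1) R', that is, to a positive
    \<open>\<delta>\<close>.\<close>
  obtain B :: nat where B: "R' / (R - R') < real B" using reals_Archimedean2 by blast
  define \<delta> where "\<delta> = real B * R - real (Suc B) * R'"
  have \<delta>: "\<delta> > 0" using B R' by (simp add: \<delta>_def field_simps)
  have "B > 0" using B R' by (cases B) (auto simp: divide_less_0_iff)
  define bl where "bl N = N div Suc B" for N
  define err where "err n = real B * (2 * (4 * 2 powr (- (real n * \<gamma>)) + spread / (real n * \<gamma>\<^sup>2)))" for n
  \<comment> \<open>The length N is below (B + 1)(n + 1). The condition absorbs this rounding, and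
    the extra 1 absorbs the ceiling, because a ceiling of 2^a with a >= 0 is at most 2^(a +
    1).\<close>
  define large where "large N \<longleftrightarrow> 0 < bl N \<and> real (Suc B) * R' + 1 \<le> real (bl N) * \<delta>" for N
  have code: "\<exists>c. is_code R' N c \<and> error_prob W R' N c \<le> err (bl N)" if N: "large N" for N
  proof -
    define n where "n = bl N"
    have n: "0 < n" using N by (simp add: large_def n_def)
    define M where "M = nat \<lceil>2 powr (real n * R)\<rceil>"
    have M: "0 < M" "real M - 1 \<le> 2 powr (real n * R)" "2 powr (real n * R) \<le> real M"
      unfolding M_def by (rule nat_ceiling_bounds; simp)+
    obtain K where K: "0 < K" "K = 1 \<and> (\<forall>w\<in>set_pmf letter. w_e w = 1) \<or>
       real K - 1 \<le> 2 powr (real n * Rr) \<and> 2 powr (real n * Rr) \<le> real K \<and> rates_ok R Rr \<gamma>"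
      using relay
    proof
      assume "\<forall>w\<in>set_pmf letter. w_e w = 1"
      then show ?thesis using that[of 1] by simp
    next
      assume "rates_ok R Rr \<gamma>"
      then show ?thesis using that[of "nat \<lceil>2 powr (real n * Rr)\<rceil>"] nat_ceiling_bounds[of "2 powr (real n * Rr)"] by simp
    qed
    have "N < Suc B * Suc n"
      unfolding n_def bl_def using dividend_less_times_div[of "Suc B" N] by simp
    then have "real N \<le> real (Suc B) * (real n + 1)"
      by (metis less_imp_le of_nat_Suc of_nat_le_iff of_nat_mult add.commute)
    then have "real N * R' \<le> real (Suc B) * (real n + 1) * R'" using R' by (intro mult_right_mono) auto
    also have "\<dots> + 1 \<le> real n * (real B * R)"
      using N by (simp add: large_def n_def[symmetric] \<delta>_def algebra_simps)
    finally have exp_le: "real N * R' + 1 \<le> real n * (real B * R)" by simp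
    have "real (card (messages R' N)) = real (nat \<lceil>2 powr (real N * R')\<rceil>)" by (simp add: messages_def)
    also have "\<dots> \<le> 2 powr (real N * R') + 1" using nat_ceiling_bounds(2)[of "2 powr (real N * R')"] by simp
    also have "\<dots> \<le> 2 powr (real N * R') + 2 powr (real N * R')"
      using R' by (intro add_left_mono) (simp add: ge_one_powr_ge_zero)
    also have "\<dots> = 2 powr (real N * R' + 1)" by (simp add: powr_add)
    also have "\<dots> \<le> 2 powr (real n * (real B * R))" using exp_le by (intro powr_mono) auto
    also have "\<dots> = (2 powr (real n * R)) ^ B" by (simp add: powr_power mult_ac)
    also have "\<dots> \<le> real M ^ B" using M by (intro power_mono) auto
    finally have "card (messages R' N) \<le> M ^ B" by (metis of_nat_le_iff of_nat_power)
    moreover have "Suc B * n \<le> N" unfolding n_def bl_def by (rule times_div_less_eq_dividend)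
    ultimately show ?thesis
      unfolding err_def n_def[symmetric]
      using exists_product_code[OF n \<gamma> M(1) K(1) M(2) R K(2)] by blast
  qed
  have "\<exists>c. is_code R' N c \<and> (large N \<longrightarrow> error_prob W R' N c \<le> err (bl N))" for N
  proof (cases "large N")
    case True
    then show ?thesis using code by blast
  next
    case False
    \<comment> \<open>Lengths that are too short get an arbitrary code; they are finitely many and
      do not affect the limit.\<close>
    have "is_code R' N \<lparr>encoder = \<lambda>_. replicate N undefined, relay_encoder = \<lambda>_ _. undefined, decoder = \<lambda>_. None\<rparr>"
      by (simp add: is_code_def)
    then show ?thesis using False by blast
  qed
  then obtain c where c: "\<And>N. is_code R' N (c N)" "\<And>N. large N \<Longrightarrow> error_prob W R' N (c N) \<le> err (bl N)"
    by metis
  have bl_lim: "filterlim bl at_top sequentially"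
    unfolding bl_def filterlim_at_top
  proof
    fix Z
    show "\<forall>\<^sub>F N in sequentially. Z \<le> N div Suc B"
      unfolding eventually_sequentially by (intro exI[of _ "Z * Suc B"]) (auto simp: less_eq_div_iff_mult_less_eq)
  qed
  then have real_bl: "filterlim (\<lambda>N. real (bl N)) at_top sequentially"
    by (rule filterlim_compose[OF filterlim_real_sequentially])
  have large: "eventually large sequentially"
  proof -
    have "eventually (\<lambda>N. real (bl N) \<ge> (real (Suc B) * R' + 1) / \<delta>) sequentially"
      using real_bl by (simp add: filterlim_at_top)
    moreover have "eventually (\<lambda>N. bl N \<ge> 1) sequentially"
      using bl_lim by (simp add: filterlim_at_top)
    ultimately show ?thesis
      by eventually_elim (use \<delta> in \<open>auto simp: large_def pos_divide_le_eq\<close>)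
  qed
  have "err \<longlonglongrightarrow> real B * (2 * (4 * 0 + 0))"
    unfolding err_def
  proof (intro tendsto_intros)
    have "filterlim (\<lambda>n. real n * \<gamma>) at_top sequentially"
      using \<gamma> by (intro filterlim_at_top_mult_tendsto_pos[OF tendsto_const _ filterlim_real_sequentially])
    moreover have "((\<lambda>x::real. 2 powr (- x)) \<longlongrightarrow> 0) at_top" by real_asymp
    ultimately show "(\<lambda>n. 2 powr (- (real n * \<gamma>))) \<longlonglongrightarrow> 0"
      by (rule filterlim_compose[rotated])
    have "(\<lambda>n. (spread / \<gamma>\<^sup>2) * (1 / real n)) \<longlonglongrightarrow> (spread / \<gamma>\<^sup>2) * 0"
      by (intro tendsto_intros lim_1_over_n)
    then show "(\<lambda>n. spread / (real n * \<gamma>\<^sup>2)) \<longlonglongrightarrow> 0" by (simp add: mult.commute)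
  qed
  then have err_lim: "(\<lambda>N. err (bl N)) \<longlonglongrightarrow> 0"
    using filterlim_compose[OF _ bl_lim] by simp
  have "(\<lambda>N. error_prob W R' N (c N)) \<longlonglongrightarrow> 0"
  proof (rule tendsto_sandwich[OF _ _ tendsto_const err_lim])
    show "\<forall>\<^sub>F N in sequentially. 0 \<le> error_prob W R' N (c N)" by (simp add: error_prob_def)
    show "\<forall>\<^sub>F N in sequentially. error_prob W R' N (c N) \<le> err (bl N)"
      using large by eventually_elim (rule c(2))
  qed
  with c(1) show ?thesis by blast
qed

end

section \<open>Erasing the compressed observation\<close>

text \<open>Erasing the compressed observation with probability \<open>\<epsilon>\<close> scales \<open>I_e\<close> and \<open>I_b\<close> by \<open>1 - \<epsilon>\<close> and so
  turns the condition \<open>I_e \<le> I_c + I_b\<close> into a strict inequality whenever \<open>I_c > 0\<close>; if \<open>I_c = 0\<close>,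
  everything is erased and the relay has only one index.\<close>

definition erase :: "real \<Rightarrow> 'u pmf \<Rightarrow> 'u option pmf" where
  "erase \<epsilon> p = do {b \<leftarrow> bernoulli_pmf \<epsilon>; if b then return_pmf None else map_pmf Some p}"

lemma expect_erase:
  assumes "finite (set_pmf p)" "0 \<le> \<epsilon>" "\<epsilon> \<le> 1"
  shows "expect (erase \<epsilon> p) f = \<epsilon> * f None + (1 - \<epsilon>) * expect p (\<lambda>u. f (Some u))"
  unfolding erase_def using assms by (subst expect_bind) auto

lemma finite_set_erase: "finite (set_pmf p) \<Longrightarrow> finite (set_pmf (erase \<epsilon> p))"
  unfolding erase_def by (rule finite_set_bind_pmf) auto

lemma pmf_erase:
  assumes "0 \<le> \<epsilon>" "\<epsilon> \<le> 1"
  shows "pmf (erase \<epsilon> p) None = \<epsilon>" "pmf (erase \<epsilon> p) (Some u) = (1 - \<epsilon>) * pmf p u"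
proof -
  have "pmf (map_pmf Some p) None = 0" by (simp add: pmf_eq_0_set_pmf)
  then show "pmf (erase \<epsilon> p) None = \<epsilon>" "pmf (erase \<epsilon> p) (Some u) = (1 - \<epsilon>) * pmf p u"
    unfolding erase_def using assms by (auto simp: pmf_bind pmf_map_inj')
qed

lemma set_erase: "Some u \<in> set_pmf (erase \<epsilon> p) \<Longrightarrow> u \<in> set_pmf p"
  by (auto simp: erase_def set_bind_pmf split: if_splits)

lemma set_erase_1: "set_pmf (erase 1 p) = {None}"
proof (rule set_eqI)
  fix u show "u \<in> set_pmf (erase 1 p) \<longleftrightarrow> u \<in> {None}"
    by (cases u) (auto simp: set_pmf_iff pmf_erase)
qed

context cf_letter
begin

definition "e' v r u = (case u of None \<Rightarrow> 1 | Some u \<Rightarrow> e v r u)"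
text \<open>An erased symbol leaves only the ratio of the output y, which is \<open>A2\<close>; this
  also preserves the mean of \<open>D1'\<close> over the compression symbol.\<close>

definition "D1' x r y u = (case u of None \<Rightarrow> A2 x r y | Some u \<Rightarrow> D1 x r y u)"
definition "A1' r y u = (case u of None \<Rightarrow> 1 | Some u \<Rightarrow> A1 r y u)"

lemma cf_letter_erase:
  assumes \<epsilon>: "0 \<le> \<epsilon>" "\<epsilon> \<le> 1"
  shows "cf_letter px pxr W (\<lambda>r. erase \<epsilon> (t r)) (\<lambda>v r. erase \<epsilon> (q v r)) e' D1' A1' A2 D2"
proof
  show "finite (set_pmf px)" "finite (set_pmf pxr)" "finite (set_pmf (W x r))"
    "finite (set_pmf (erase \<epsilon> (t r)))" "finite (set_pmf (erase \<epsilon> (q v r)))" for x r v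
    by (auto intro: fin finite_set_erase)
  show "0 \<le> e' v r u" "0 \<le> D1' x r y u" "0 \<le> A1' r y u" "0 \<le> A2 x r y" "0 \<le> D2 r y" for v r u x y
    by (auto simp: e'_def D1'_def A1'_def nonneg split: option.split)
  show "expect (erase \<epsilon> (t r)) (e' v r) \<le> 1" if "r \<in> set_pmf pxr" for v r
  proof -
    have "expect (erase \<epsilon> (t r)) (e' v r) = \<epsilon> * 1 + (1 - \<epsilon>) * expect (t r) (e v r)"
      by (simp add: expect_erase[OF fin(4) \<epsilon>] e'_def)
    also have "\<dots> \<le> \<epsilon> * 1 + (1 - \<epsilon>) * 1"
      using \<epsilon> e_mean[OF that] by (intro add_left_mono mult_left_mono) auto
    finally show ?thesis by simp
  qed
  show "pmf (erase \<epsilon> (t r)) u * e' v r u = pmf (erase \<epsilon> (q v r)) u"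
    if "x \<in> set_pmf px" "r \<in> set_pmf pxr" "(y, v) \<in> set_pmf (W x r)" for x r y v u
    using e_density[OF that] by (cases u) (auto simp: pmf_erase[OF \<epsilon>] e'_def mult.assoc)
  show "expect px (\<lambda>x. D1' x r y u) \<le> A1' r y u" if "r \<in> set_pmf pxr" for r y u
    using A2_mean[OF that] D1_mean_x[OF that] by (cases u) (auto simp: D1'_def A1'_def)
  show "expect (erase \<epsilon> (t r)) (D1' x r y) \<le> A2 x r y" if "r \<in> set_pmf pxr" for x r y
  proof -
    have "expect (erase \<epsilon> (t r)) (D1' x r y) = \<epsilon> * A2 x r y + (1 - \<epsilon>) * expect (t r) (D1 x r y)"
      by (simp add: expect_erase[OF fin(4) \<epsilon>] D1'_def)
    also have "\<dots> \<le> \<epsilon> * A2 x r y + (1 - \<epsilon>) * A2 x r y"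
      using \<epsilon> D1_mean_u[OF that] by (intro add_left_mono mult_left_mono) auto
    finally show ?thesis by (simp add: algebra_simps)
  qed
  show "expect px (\<lambda>x. A2 x r y) \<le> 1" if "r \<in> set_pmf pxr" for r y by (rule A2_mean[OF that])
  show "expect pxr (\<lambda>r. D2 r y) \<le> 1" for y by (rule D2_mean)
  show "0 < e' v r u \<and> 0 < D1' x r y u \<and> 0 < A1' r y u \<and> 0 < A2 x r y \<and> 0 < D2 r y"
    if "x \<in> set_pmf px" "r \<in> set_pmf pxr" "(y, v) \<in> set_pmf (W x r)" "u \<in> set_pmf (erase \<epsilon> (q v r))" for x r y v u
  proof -
    obtain u0 where "u0 \<in> set_pmf (q v r)" using set_pmf_not_empty[of "q v r"] by blast
    then show ?thesis
      using pos[OF that(1-3)] that(4) by (cases u) (auto simp: e'_def D1'_def A1'_def dest!: set_erase)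
  qed
qed

lemma letter_erase_expect:
  assumes \<epsilon>: "0 \<le> \<epsilon>" "\<epsilon> \<le> 1"
  shows "expect (cf_letter.letter px pxr W (\<lambda>v r. erase \<epsilon> (q v r))) F
    = \<epsilon> * expect letter (\<lambda>((w, u), w'). F ((w, None), w')) + (1 - \<epsilon>) * expect letter (\<lambda>((w, u), w'). F ((w, Some u), w'))"
proof -
  interpret er: cf_letter px pxr W "\<lambda>r. erase \<epsilon> (t r)" "\<lambda>v r. erase \<epsilon> (q v r)" e' D1' A1' A2 D2
    by (rule cf_letter_erase[OF \<epsilon>])
  have "expect er.letter F = expect px (\<lambda>x. expect pxr (\<lambda>r. expect (W x r) (\<lambda>z. expect (erase \<epsilon> (q (snd z) r)) (\<lambda>u.
      expect px (\<lambda>x2. expect pxr (\<lambda>r2. expect (W x2 r2) (\<lambda>z2. F ((((x, r), z), u), ((x2, r2), z2)))))))))"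
    unfolding er.letter_def by (simp add: expect_bind set_bind_pmf fin finite_set_erase)
  also have "\<dots> = \<epsilon> * expect px (\<lambda>x. expect pxr (\<lambda>r. expect (W x r) (\<lambda>z. 
      expect px (\<lambda>x2. expect pxr (\<lambda>r2. expect (W x2 r2) (\<lambda>z2. F ((((x, r), z), None), ((x2, r2), z2))))))))
    + (1 - \<epsilon>) * expect px (\<lambda>x. expect pxr (\<lambda>r. expect (W x r) (\<lambda>z. expect (q (snd z) r) (\<lambda>u.
      expect px (\<lambda>x2. expect pxr (\<lambda>r2. expect (W x2 r2) (\<lambda>z2. F ((((x, r), z), Some u), ((x2, r2), z2)))))))))"
    by (simp add: expect_erase \<epsilon> fin expect_add)
  also have "\<dots> = \<epsilon> * expect letter (\<lambda>((w, u), w'). F ((w, None), w')) + (1 - \<epsilon>) * expect letter (\<lambda>((w, u), w'). F ((w, Some u), w'))"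
    unfolding letter_def by (simp add: expect_bind set_bind_pmf fin)
  finally show ?thesis .
qed

text \<open>For the weights derived from a joint distribution these are, in this order,
  \<open>I(Yh\<^sub>r; Y\<^sub>r | X\<^sub>r)\<close>, \<open>I(X; Y, Yh\<^sub>r | X\<^sub>r)\<close>, \<open>I(Yh\<^sub>r; X, Y | X\<^sub>r)\<close>, \<open>I(X\<^sub>r; Y)\<close> and
  \<open>I(X; Y | X\<^sub>r)\<close>.\<close>

definition "I_e = mean_log w_e"
definition "I_a = mean_log (\<lambda>w. w_D1 w / w_A1 w)"
definition "I_b = mean_log (\<lambda>w. w_D1 w / w_A2 w)"
definition "I_c = mean_log w_D2"
definition "I_2 = mean_log w_A2"

text \<open>For the erased weights the mean logarithms are I_e and I_b scaled by
  \<open>1 - \<epsilon>\<close>, while I_c is unchanged. The condition then has slack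
  \<open>\<epsilon> * I_c\<close>, at the price of moving I_a by a small amount towards I_2.\<close>

theorem codes_of_rate_below:
  assumes R': "0 \<le> R'" "R' < R" and Ra: "R \<le> I_a" and Rb: "R \<le> I_2 + I_c - (I_e - I_b)"
    and c: "0 \<le> I_c" and eb: "I_b \<le> I_e" and cond: "I_e \<le> I_c + I_b"
  shows "\<exists>c. (\<forall>N. is_code R' N (c N)) \<and> (\<lambda>N. error_prob W R' N (c N)) \<longlonglongrightarrow> 0"
proof -
  \<comment> \<open>Half of the gap, \<open>\<delta>\<close>, is given up in the rate. The erasure
    probability keeps the change of I_a within \<open>\<delta> / 2\<close>, the 1 in its denominator
    guarding against I_2 = I_a. The margin \<open>\<gamma>\<close> satisfies
    \<open>4 * \<gamma> \<le> \<delta>\<close> for the rate and, if I_c > 0,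
    \<open>4 * \<gamma> \<le> \<epsilon> * I_c\<close> for the index; \<open>Rr\<close> is the least
    rate the quantizer permits.\<close>
  define \<delta> where "\<delta> = (R - R') / 2"
  define \<epsilon> where "\<epsilon> = (if I_c = 0 then 1 else min 1 (\<delta> / (2 * (\<bar>I_2 - I_a\<bar> + 1))))"
  define \<gamma> where "\<gamma> = (if I_c = 0 then \<delta> / 4 else min (\<delta> / 4) (\<epsilon> * I_c / 4))"
  define Rr where "Rr = (1 - \<epsilon>) * I_e + 2 * \<gamma>"
  have \<delta>: "0 < \<delta>" using R' by (simp add: \<delta>_def)
  have \<epsilon>_pos: "0 < \<epsilon>" and \<epsilon>: "0 \<le> \<epsilon>" "\<epsilon> \<le> 1"
    using \<delta> by (auto simp: \<epsilon>_def less_imp_le intro!: divide_pos_pos add_nonneg_pos)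
  have \<gamma>: "0 < \<gamma>" "\<gamma> \<le> \<delta> / 4" using \<delta> \<epsilon>_pos c by (auto simp: \<gamma>_def)
  interpret er: cf_letter px pxr W "\<lambda>r. erase \<epsilon> (t r)" "\<lambda>v r. erase \<epsilon> (q v r)" e' D1' A1' A2 D2
    by (rule cf_letter_erase[OF \<epsilon>])
  note er_defs = er.w_e_def er.w_D1_def er.w_A1_def er.w_A2_def er.w_D2_def
  note defs = w_e_def w_D1_def w_A1_def w_A2_def w_D2_def
  have log_add: "expect letter (\<lambda>w. log 2 (f w * g w)) = mean_log f + mean_log g"
    and log_diff: "expect letter (\<lambda>w. log 2 (f w / g w)) = mean_log f - mean_log g"
    if "\<And>w. w \<in> set_pmf letter \<Longrightarrow> f w > 0" "\<And>w. w \<in> set_pmf letter \<Longrightarrow> g w > 0" for f g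
  proof -
    have "expect letter (\<lambda>w. log 2 (f w * g w)) = expect letter (\<lambda>w. log 2 (f w) + log 2 (g w))"
    proof (rule expect_cong)
      fix w assume "w \<in> set_pmf letter"
      from that[OF this] show "log 2 (f w * g w) = log 2 (f w) + log 2 (g w)" by (simp add: log_mult)
    qed
    then show "expect letter (\<lambda>w. log 2 (f w * g w)) = mean_log f + mean_log g"
      by (simp add: expect_add finite_letter)
    have "expect letter (\<lambda>w. log 2 (f w / g w)) = expect letter (\<lambda>w. log 2 (f w) - log 2 (g w))"
    proof (rule expect_cong)
      fix w assume "w \<in> set_pmf letter"
      from that[OF this] show "log 2 (f w / g w) = log 2 (f w) - log 2 (g w)" by (simp add: log_divide)
    qed
    then show "expect letter (\<lambda>w. log 2 (f w / g w)) = mean_log f - mean_log g"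
      by (simp add: expect_diff finite_letter)
  qed
  have I_b: "I_b = mean_log w_D1 - I_2" unfolding I_b_def I_2_def by (intro log_diff w_pos)
  have "er.mean_log er.w_e = \<epsilon> * 0 + (1 - \<epsilon>) * mean_log w_e"
    unfolding letter_erase_expect[OF \<epsilon>] er_defs defs by (simp add: e'_def case_prod_unfold)
  then have m_e: "er.mean_log er.w_e = (1 - \<epsilon>) * I_e" by (simp add: I_e_def)
  have "er.mean_log (\<lambda>w. er.w_D1 w / er.w_A1 w) = \<epsilon> * mean_log w_A2 + (1 - \<epsilon>) * mean_log (\<lambda>w. w_D1 w / w_A1 w)"
    unfolding letter_erase_expect[OF \<epsilon>] er_defs defs by (simp add: D1'_def A1'_def case_prod_unfold)
  then have m_a: "er.mean_log (\<lambda>w. er.w_D1 w / er.w_A1 w) = \<epsilon> * I_2 + (1 - \<epsilon>) * I_a" by (simp add: I_a_def I_2_def)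
  have "er.mean_log (\<lambda>w. er.w_D1 w * er.w_D2 w / er.w_A2 w) 
     = \<epsilon> * mean_log (\<lambda>w. w_A2 w * w_D2 w / w_A2 w) + (1 - \<epsilon>) * mean_log (\<lambda>w. w_D1 w * w_D2 w / w_A2 w)"
    unfolding letter_erase_expect[OF \<epsilon>] er_defs defs by (simp add: D1'_def case_prod_unfold)
  also have "mean_log (\<lambda>w. w_A2 w * w_D2 w / w_A2 w) = I_c"
    unfolding I_c_def
  proof (rule expect_cong)
    fix w assume "w \<in> set_pmf letter"
    from w_pos(4)[OF this] show "log 2 (w_A2 w * w_D2 w / w_A2 w) = log 2 (w_D2 w)" by simp
  qed
  also have "mean_log (\<lambda>w. w_D1 w * w_D2 w / w_A2 w) = I_c + I_b"
    by (simp add: log_add log_diff w_pos I_c_def I_b I_2_def)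
  finally have m_b: "er.mean_log (\<lambda>w. er.w_D1 w * er.w_D2 w / er.w_A2 w) = I_c + (1 - \<epsilon>) * I_b"
    by (simp add: algebra_simps)
  have "er.mean_log (\<lambda>w. er.w_D1 w * er.w_D2 w) 
     = \<epsilon> * mean_log (\<lambda>w. w_A2 w * w_D2 w) + (1 - \<epsilon>) * mean_log (\<lambda>w. w_D1 w * w_D2 w)"
    unfolding letter_erase_expect[OF \<epsilon>] er_defs defs by (simp add: D1'_def case_prod_unfold)
  also have "\<dots> = \<epsilon> * (I_2 + I_c) + (1 - \<epsilon>) * (I_2 + I_b + I_c)"
    by (simp add: log_add w_pos I_c_def I_b I_2_def)
  finally have m_d: "er.mean_log (\<lambda>w. er.w_D1 w * er.w_D2 w) = I_2 + I_c + (1 - \<epsilon>) * I_b"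
    by (simp add: algebra_simps)
  show ?thesis
  proof (rule er.codes_of_rate_less[of R' "R - \<delta>" \<gamma> Rr])
    show "0 \<le> R'" "R' < R - \<delta>" "0 < \<gamma>" using R' \<gamma>(1) by (auto simp: \<delta>_def field_simps)
    show "R - \<delta> + 2 * \<gamma> \<le> er.mean_log (\<lambda>w. er.w_D1 w / er.w_A1 w)"
    proof (cases "I_c = 0")
      \<comment> \<open>Everything is erased, so the mean is I_2; \<open>Rb\<close> together with
        I_b <= I_e gives R <= I_2.\<close>
      case True
      then show ?thesis unfolding m_a using \<gamma> \<delta> Rb eb by (simp add: \<epsilon>_def)
    next
      case False
      have "\<epsilon> * \<bar>I_2 - I_a\<bar> \<le> \<delta> / (2 * (\<bar>I_2 - I_a\<bar> + 1)) * (\<bar>I_2 - I_a\<bar> + 1)"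
        using False \<delta> by (intro mult_mono) (auto simp: \<epsilon>_def)
      also have "\<dots> = \<delta> / 2"
      proof -
        have "\<delta> / (2 * a) * a = \<delta> / 2" if "0 < a" for a :: real using that by simp
        from this[of "\<bar>I_2 - I_a\<bar> + 1"] show ?thesis by linarith
      qed
      finally have "\<epsilon> * \<bar>I_2 - I_a\<bar> \<le> \<delta> / 2" .
      moreover have "- (\<epsilon> * (I_2 - I_a)) \<le> \<epsilon> * \<bar>I_2 - I_a\<bar>"
        using \<epsilon> by (metis abs_ge_minus_self abs_mult abs_of_nonneg)
      ultimately show ?thesis unfolding m_a using \<gamma> Ra by (simp add: algebra_simps)
    qed
    show "(\<forall>w\<in>set_pmf er.letter. er.w_e w = 1) \<or> er.rates_ok (R - \<delta>) Rr \<gamma>"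
    proof (cases "I_c = 0")
      case True
      then have "\<epsilon> = 1" by (simp add: \<epsilon>_def)
      have "er.w_e w = 1" if "w \<in> set_pmf er.letter" for w
        using that unfolding er.letter_def unfolding \<open>\<epsilon> = 1\<close>
        by (auto simp: er.w_e_def e'_def set_bind_pmf set_erase_1)
      then show ?thesis by blast
    next
      case False
      \<comment> \<open>Scaling the condition by \<open>1 - \<epsilon>\<close> leaves
        \<open>\<epsilon> * I_c\<close> of I_c unspent, which pays for both margins around
        \<open>Rr\<close>.\<close>
      have "4 * \<gamma> \<le> \<epsilon> * I_c" using False by (auto simp: \<gamma>_def)
      moreover have "(1 - \<epsilon>) * (I_e - I_b) \<le> (1 - \<epsilon>) * I_c"
        using \<epsilon> cond by (intro mult_left_mono) auto
      ultimately have 1: "Rr + 2 * \<gamma> \<le> I_c + (1 - \<epsilon>) * I_b"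
        by (simp add: Rr_def algebra_simps)
      have "(1 - \<epsilon>) * (I_e - I_b) \<le> 1 * (I_e - I_b)"
        using \<epsilon> eb by (intro mult_right_mono) auto
      then have "R - \<delta> + Rr + 2 * \<gamma> \<le> I_2 + I_c + (1 - \<epsilon>) * I_b"
        using Rb \<gamma> by (simp add: Rr_def algebra_simps)
      with 1 show ?thesis unfolding er.rates_ok_def m_e m_b m_d by (simp add: Rr_def)
    qed
  qed
qed

end

section \<open>Mutual information on finite spaces\<close>

text \<open>Minus the entropy of \<open>A\<close> in bits.\<close>

definition log_mean :: "'s pmf \<Rightarrow> ('s \<Rightarrow> 'a) \<Rightarrow> real" where
  "log_mean P A = expect P (\<lambda>\<omega>. log 2 (pmf (map_pmf A P) (A \<omega>)))"

lemma distributed_pmf: "distributed (measure_pmf P) (count_space UNIV) A (\<lambda>a. ennreal (pmf (map_pmf A P) a))"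
  using measure_pmf_eq_density[of "map_pmf A P"] by (auto simp: distributed_def map_pmf_rep_eq)

lemma pair_count_space_finite:
  "count_space (UNIV :: 'a::finite set) \<Otimes>\<^sub>M count_space (UNIV :: 'b::finite set) = count_space UNIV"
  by (simp add: pair_measure_count_space)

lemma pmf_map_pos: "\<omega> \<in> set_pmf P \<Longrightarrow> pmf (map_pmf A P) (A \<omega>) > 0"
  by (auto simp: pmf_positive_iff)

lemma mutual_info_eq:
  fixes P :: "'s::finite pmf" and A :: "'s \<Rightarrow> 'a::finite" and B :: "'s \<Rightarrow> 'b::finite"
  shows "mutual_info P A B = log_mean P (\<lambda>\<omega>. (A \<omega>, B \<omega>)) - log_mean P A - log_mean P B"
    and "0 \<le> mutual_info P A B"
proof -
  interpret P: information_space "measure_pmf P" 2 by standard auto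
  let ?f = "\<lambda>c. pmf (map_pmf (\<lambda>\<omega>. (A \<omega>, B \<omega>)) P) c * 
      log 2 (pmf (map_pmf (\<lambda>\<omega>. (A \<omega>, B \<omega>)) P) c / (pmf (map_pmf A P) (fst c) * pmf (map_pmf B P) (snd c)))"
  have sf: "sigma_finite_measure (count_space (UNIV :: 'a set))" "sigma_finite_measure (count_space (UNIV :: 'b set))"
    by (auto intro: sigma_finite_measure_count_space_finite)
  have "mutual_info P A B = (\<integral>c. ?f c \<partial>(count_space UNIV \<Otimes>\<^sub>M count_space UNIV))"
    by (rule P.mutual_information_distr[OF sf distributed_pmf _ distributed_pmf])
      (auto simp: pair_count_space_finite distributed_pmf)
  also have "\<dots> = (\<Sum>c\<in>UNIV. ?f c)"
    unfolding pair_count_space_finite by (simp add: lebesgue_integral_count_space_finite)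
  also have "\<dots> = expect (map_pmf (\<lambda>\<omega>. (A \<omega>, B \<omega>)) P) (\<lambda>c. 
      log 2 (pmf (map_pmf (\<lambda>\<omega>. (A \<omega>, B \<omega>)) P) c / (pmf (map_pmf A P) (fst c) * pmf (map_pmf B P) (snd c))))"
    by (subst integral_measure_pmf[of UNIV]) auto
  also have "\<dots> = expect P (\<lambda>\<omega>. log 2 (pmf (map_pmf (\<lambda>\<omega>. (A \<omega>, B \<omega>)) P) (A \<omega>, B \<omega>)) - 
      log 2 (pmf (map_pmf A P) (A \<omega>)) - log 2 (pmf (map_pmf B P) (B \<omega>)))"
    unfolding integral_map_pmf
  proof (rule expect_cong)
    fix \<omega> assume \<omega>: "\<omega> \<in> set_pmf P"
    show "log 2 (pmf (map_pmf (\<lambda>\<omega>. (A \<omega>, B \<omega>)) P) (A \<omega>, B \<omega>) /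
       (pmf (map_pmf A P) (fst (A \<omega>, B \<omega>)) * pmf (map_pmf B P) (snd (A \<omega>, B \<omega>)))) =
      log 2 (pmf (map_pmf (\<lambda>\<omega>. (A \<omega>, B \<omega>)) P) (A \<omega>, B \<omega>)) - log 2 (pmf (map_pmf A P) (A \<omega>)) - log 2 (pmf (map_pmf B P) (B \<omega>))"
      using pmf_map_pos[OF \<omega>, of "\<lambda>\<omega>. (A \<omega>, B \<omega>)"] pmf_map_pos[OF \<omega>, of A] pmf_map_pos[OF \<omega>, of B]
      by (simp add: log_divide log_mult)
  qed
  also have "\<dots> = log_mean P (\<lambda>\<omega>. (A \<omega>, B \<omega>)) - log_mean P A - log_mean P B"
    by (simp add: log_mean_def expect_diff)
  finally show "mutual_info P A B = log_mean P (\<lambda>\<omega>. (A \<omega>, B \<omega>)) - log_mean P A - log_mean P B" .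
  show "0 \<le> mutual_info P A B"
    by (rule P.mutual_information_nonneg[OF sf, where Px = "pmf (map_pmf A P)" and Py = "pmf (map_pmf B P)"
        and Pxy = "pmf (map_pmf (\<lambda>\<omega>. (A \<omega>, B \<omega>)) P)"])
      (auto simp: pair_count_space_finite distributed_pmf intro!: integrable_count_space)
qed

text \<open>The library defines I(A; B | C) as I(A; (B, C)) - I(A; C), so the formula follows from
  the unconditional case; the terms of \<open>A\<close> alone cancel.\<close>

lemma cond_mutual_info_eq:
  fixes P :: "'s::finite pmf" and A :: "'s \<Rightarrow> 'a::finite" and B :: "'s \<Rightarrow> 'b::finite" and C :: "'s \<Rightarrow> 'c::finite"
  shows "cond_mutual_info P A B C = log_mean P (\<lambda>\<omega>. (A \<omega>, B \<omega>, C \<omega>)) + log_mean P C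
     - log_mean P (\<lambda>\<omega>. (A \<omega>, C \<omega>)) - log_mean P (\<lambda>\<omega>. (B \<omega>, C \<omega>))"
    and "0 \<le> cond_mutual_info P A B C"
proof -
  interpret P: information_space "measure_pmf P" 2 by standard auto
  have sf: "sigma_finite_measure (count_space (UNIV :: 'd::finite set))"
    by (auto intro: sigma_finite_measure_count_space_finite)
  show "cond_mutual_info P A B C = log_mean P (\<lambda>\<omega>. (A \<omega>, B \<omega>, C \<omega>)) + log_mean P C
     - log_mean P (\<lambda>\<omega>. (A \<omega>, C \<omega>)) - log_mean P (\<lambda>\<omega>. (B \<omega>, C \<omega>))"
    unfolding prob_space.conditional_mutual_information_def[OF prob_space_measure_pmf] by (simp add: pair_count_space_finite mutual_info_eq)
  show "0 \<le> cond_mutual_info P A B C"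
    by (rule P.conditional_mutual_information_generic_nonneg[where Px = "pmf (map_pmf A P)" and Pz = "pmf (map_pmf C P)"
        and Pyz = "pmf (map_pmf (\<lambda>\<omega>. (B \<omega>, C \<omega>)) P)" and Pxz = "pmf (map_pmf (\<lambda>\<omega>. (A \<omega>, C \<omega>)) P)"
        and Pxyz = "pmf (map_pmf (\<lambda>\<omega>. (A \<omega>, B \<omega>, C \<omega>)) P)"])
      (auto simp: pair_count_space_finite distributed_pmf intro!: integrable_count_space sigma_finite_measure_count_space_finite)
qed

text \<open>Entropy is invariant under injective relabelling; this serves to bring tuples of
  variables into a fixed order.\<close>

lemma log_mean_reorder:
  assumes "\<And>\<omega>. B \<omega> = f (A \<omega>)" "inj f"
  shows "log_mean P A = log_mean P B"
proof -
  have "map_pmf B P = map_pmf f (map_pmf A P)"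
    using assms(1) by (simp add: map_pmf_comp) (metis)
  then show ?thesis using assms by (simp add: log_mean_def pmf_map_inj')
qed

section \<open>The single-letter weights\<close>

text \<open>Marginalization, with the summed coordinate described by an embedding \<open>f\<close>
  so that one rule covers every position in a tuple.\<close>

lemma sum_pmf_fiber:
  fixes f :: "'a::finite \<Rightarrow> 'c"
  assumes "inj f" "\<And>\<omega>. C \<omega> \<in> range f \<longleftrightarrow> B \<omega> = b"
  shows "(\<Sum>a\<in>UNIV. pmf (map_pmf C P) (f a)) = pmf (map_pmf B P) b"
proof -
  have "(\<Sum>a\<in>UNIV. pmf (map_pmf C P) (f a)) = (\<Sum>c\<in>range f. pmf (map_pmf C P) c)"
    using assms(1) by (simp add: sum.reindex)
  also have "\<dots> = measure_pmf.prob (map_pmf C P) (range f)"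
    by (rule measure_measure_pmf_finite[symmetric]) simp
  also have "\<dots> = measure_pmf.prob P {\<omega>. B \<omega> = b}"
    using assms(2) by (simp add: vimage_def)
  also have "\<dots> = pmf (map_pmf B P) b"
    by (simp add: pmf_map vimage_def)
  finally show ?thesis .
qed

lemma pmf_dependent_pair:
  "pmf (do {a \<leftarrow> p; b \<leftarrow> f a; return_pmf (a, b)}) (a, b) = pmf p a * pmf (f a) b"
proof -
  have "pmf (map_pmf (Pair a') (f a')) (a, b) = indicator {a} a' * pmf (f a) b" for a'
  proof (cases "a' = a")
    case True
    then show ?thesis by (simp add: pmf_map_inj' inj_def)
  next
    case False
    then show ?thesis by (auto simp: pmf_eq_0_set_pmf)
  qed
  then show ?thesis by (simp add: map_pmf_def[symmetric] pmf_bind measure_pmf_single)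
qed

text \<open>Equality holds unless k = 0, where the left side is 0 by the convention for division.
  Such degenerate ratios are why \<open>cf_weights\<close> asks for inequalities of means.\<close>

lemma cancel_ratio_le:
  fixes c d k p s :: real
  assumes "0 < p" "0 \<le> c" "0 \<le> d" "0 \<le> s"
  shows "k / p * (c * p / (k * d)) \<le> c / d" and "k / p * (c * p / (d * k)) \<le> c / d"
  using assms by (cases "k = 0"; simp)+

section \<open>Marginals of the joint distribution and the resulting weights\<close>

locale relay_joint =
  fixes W :: "('x::finite, 'xr::finite, 'y::finite, 'yr::finite) relay_channel"
    and px :: "'x pmf" and pxr :: "'xr pmf" and q :: "'yr \<Rightarrow> 'xr \<Rightarrow> ('yh::finite) pmf"
begin

definition "P = joint_pmf W px pxr q"

definition "p_r r = pmf (map_pmf rv_Xr P) r"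
definition "p_y y = pmf (map_pmf rv_Y P) y"
definition "p_xr x r = pmf (map_pmf (\<lambda>\<omega>. (rv_X \<omega>, rv_Xr \<omega>)) P) (x, r)"
definition "p_ru r u = pmf (map_pmf (\<lambda>\<omega>. (rv_Xr \<omega>, rv_Yh \<omega>)) P) (r, u)"
definition "p_rv r v = pmf (map_pmf (\<lambda>\<omega>. (rv_Xr \<omega>, rv_Yr \<omega>)) P) (r, v)"
definition "p_ry r y = pmf (map_pmf (\<lambda>\<omega>. (rv_Xr \<omega>, rv_Y \<omega>)) P) (r, y)"
definition "p_rvu r v u = pmf (map_pmf (\<lambda>\<omega>. ((rv_Xr \<omega>, rv_Yr \<omega>), rv_Yh \<omega>)) P) ((r, v), u)"
definition "p_ryu r y u = pmf (map_pmf (\<lambda>\<omega>. (rv_Xr \<omega>, rv_Y \<omega>, rv_Yh \<omega>)) P) (r, y, u)"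
definition "p_xry x r y = pmf (map_pmf (\<lambda>\<omega>. (rv_X \<omega>, rv_Xr \<omega>, rv_Y \<omega>)) P) (x, r, y)"
definition "p_xryu x r y u = pmf (map_pmf (\<lambda>\<omega>. (rv_X \<omega>, rv_Xr \<omega>, rv_Y \<omega>, rv_Yh \<omega>)) P) (x, r, y, u)"
lemmas p_defs = p_r_def p_y_def p_xr_def p_ru_def p_rv_def p_ry_def p_rvu_def p_ryu_def p_xry_def p_xryu_def

text \<open>Since X and X_r are independent, this is the conditional law of Yh_r given X_r = r,
  defined for every r without a division.\<close>

definition "t r = do {x \<leftarrow> px; z \<leftarrow> W x r; q (snd z) r}"

lemma rv_simps [simp]:
  "rv_X (x, r, y, v, u) = x" "rv_Xr (x, r, y, v, u) = r" "rv_Y (x, r, y, v, u) = y"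
  "rv_Yr (x, r, y, v, u) = v" "rv_Yh (x, r, y, v, u) = u"
  by (simp_all add: rv_X_def rv_Xr_def rv_Y_def rv_Yr_def rv_Yh_def)

lemma map_P: "map_pmf f P = do {x \<leftarrow> px; r \<leftarrow> pxr; z \<leftarrow> W x r; u \<leftarrow> q (snd z) r; return_pmf (f (x, r, fst z, snd z, u))}"
  by (simp add: P_def joint_pmf_def map_bind_pmf case_prod_unfold)

lemma p_r: "p_r r = pmf pxr r"
  by (simp add: p_r_def map_P bind_return_pmf')

lemma p_xr: "p_xr x r = pmf px x * pmf pxr r"
  unfolding p_xr_def map_P by (simp add: pmf_dependent_pair)

lemma p_ru: "p_ru r u = pmf pxr r * pmf (t r) u"
proof -
  have "map_pmf (\<lambda>\<omega>. (rv_Xr \<omega>, rv_Yh \<omega>)) P = do {r \<leftarrow> pxr; x \<leftarrow> px; z \<leftarrow> W x r; u \<leftarrow> q (snd z) r; return_pmf (r, u)}"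
    unfolding map_P by (simp add: bind_commute_pmf[of px pxr])
  also have "\<dots> = do {r \<leftarrow> pxr; u \<leftarrow> t r; return_pmf (r, u)}"
    by (simp add: t_def bind_assoc_pmf)
  finally show ?thesis by (simp add: p_ru_def pmf_dependent_pair)
qed

lemma p_rvu: "p_rvu r v u = p_rv r v * pmf (q v r) u"
proof -
  have "map_pmf (\<lambda>\<omega>. ((rv_Xr \<omega>, rv_Yr \<omega>), rv_Yh \<omega>)) P = do {rv \<leftarrow> map_pmf (\<lambda>\<omega>. (rv_Xr \<omega>, rv_Yr \<omega>)) P; 
       u \<leftarrow> q (snd rv) (fst rv); return_pmf (rv, u)}"
    unfolding map_P by (simp add: bind_assoc_pmf bind_return_pmf)
  then show ?thesis by (simp add: p_rvu_def p_rv_def pmf_dependent_pair)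
qed

lemma p_all: "pmf (map_pmf (\<lambda>\<omega>. ((rv_X \<omega>, rv_Xr \<omega>, rv_Y \<omega>, rv_Yr \<omega>), rv_Yh \<omega>)) P) ((x, r, y, v), u) 
   = pmf (map_pmf (\<lambda>\<omega>. (rv_X \<omega>, rv_Xr \<omega>, rv_Y \<omega>, rv_Yr \<omega>)) P) (x, r, y, v) * pmf (q v r) u"
proof -
  have "map_pmf (\<lambda>\<omega>. ((rv_X \<omega>, rv_Xr \<omega>, rv_Y \<omega>, rv_Yr \<omega>), rv_Yh \<omega>)) P = do {w \<leftarrow> map_pmf (\<lambda>\<omega>. (rv_X \<omega>, rv_Xr \<omega>, rv_Y \<omega>, rv_Yr \<omega>)) P; 
       u \<leftarrow> q (snd (snd (snd w))) (fst (snd w)); return_pmf (w, u)}"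
    unfolding map_P by (simp add: bind_assoc_pmf bind_return_pmf)
  then show ?thesis by (simp add: pmf_dependent_pair)
qed

lemma p_nonneg [simp]: "0 \<le> p_r r" "0 \<le> p_y y" "0 \<le> p_xr x r" "0 \<le> p_ru r u" "0 \<le> p_rv r v" "0 \<le> p_ry r y"
  "0 \<le> p_rvu r v u" "0 \<le> p_ryu r y u" "0 \<le> p_xry x r y" "0 \<le> p_xryu x r y u"
  by (simp_all add: p_defs)

lemma marginals:
  "(\<Sum>u\<in>UNIV. p_rvu r v u) = p_rv r v" "(\<Sum>x\<in>UNIV. p_xryu x r y u) = p_ryu r y u"
  "(\<Sum>u\<in>UNIV. p_xryu x r y u) = p_xry x r y" "(\<Sum>x\<in>UNIV. p_xry x r y) = p_ry r y" "(\<Sum>r\<in>UNIV. p_ry r y) = p_y y"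
  unfolding p_defs by (rule sum_pmf_fiber; force simp: inj_def)+

lemma p_pos:
  assumes "(x, r, y, v, u) \<in> set_pmf P"
  shows "0 < p_r r" "0 < p_y y" "0 < p_xr x r" "0 < p_ru r u" "0 < p_rv r v" "0 < p_ry r y"
  "0 < p_rvu r v u" "0 < p_ryu r y u" "0 < p_xry x r y" "0 < p_xryu x r y u"
  unfolding p_defs
  using pmf_map_pos[OF assms, of rv_Xr] pmf_map_pos[OF assms, of rv_Y]
    pmf_map_pos[OF assms, of "\<lambda>\<omega>. (rv_X \<omega>, rv_Xr \<omega>)"] pmf_map_pos[OF assms, of "\<lambda>\<omega>. (rv_Xr \<omega>, rv_Yh \<omega>)"]
    pmf_map_pos[OF assms, of "\<lambda>\<omega>. (rv_Xr \<omega>, rv_Yr \<omega>)"] pmf_map_pos[OF assms, of "\<lambda>\<omega>. (rv_Xr \<omega>, rv_Y \<omega>)"]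
    pmf_map_pos[OF assms, of "\<lambda>\<omega>. ((rv_Xr \<omega>, rv_Yr \<omega>), rv_Yh \<omega>)"] pmf_map_pos[OF assms, of "\<lambda>\<omega>. (rv_Xr \<omega>, rv_Y \<omega>, rv_Yh \<omega>)"]
    pmf_map_pos[OF assms, of "\<lambda>\<omega>. (rv_X \<omega>, rv_Xr \<omega>, rv_Y \<omega>)"] pmf_map_pos[OF assms, of "\<lambda>\<omega>. (rv_X \<omega>, rv_Xr \<omega>, rv_Y \<omega>, rv_Yh \<omega>)"]
  by simp_all

text \<open>The density ratios are written with joint marginals, so that their mean logarithms
  become signed sums of \<open>log_mean\<close> terms.\<close>

definition "e v r u = p_rvu r v u * p_r r / (p_ru r u * p_rv r v)"
definition "D1 x r y u = p_xryu x r y u * (p_r r)\<^sup>2 / (p_xr x r * p_ry r y * p_ru r u)"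
definition "A1 r y u = p_ryu r y u * p_r r / (p_ry r y * p_ru r u)"
definition "A2 x r y = p_xry x r y * p_r r / (p_xr x r * p_ry r y)"
definition "D2 r y = p_ry r y / (p_r r * p_y y)"

lemma expect_UNIV: "expect p f = (\<Sum>a\<in>UNIV. pmf p a * f a)" for p :: "'a::finite pmf"
  by (subst integral_measure_pmf[of UNIV]) auto

lemma in_set_P:
  "x \<in> set_pmf px \<Longrightarrow> r \<in> set_pmf pxr \<Longrightarrow> (y, v) \<in> set_pmf (W x r) \<Longrightarrow> u \<in> set_pmf (q v r) \<Longrightarrow> (x, r, y, v, u) \<in> set_pmf P"
  using map_P[of "\<lambda>\<omega>. \<omega>"] by (force simp: set_bind_pmf)

lemma single_letter: "cf_letter px pxr W t q e D1 A1 A2 D2"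
proof
  show "finite (set_pmf px)" "finite (set_pmf pxr)" "finite (set_pmf (W x r))" "finite (set_pmf (t r))" "finite (set_pmf (q v r))" for x r v
    by simp_all
  show "0 \<le> e v r u" "0 \<le> D1 x r y u" "0 \<le> A1 r y u" "0 \<le> A2 x r y" "0 \<le> D2 r y" for v r u x y
    by (simp_all add: e_def D1_def A1_def A2_def D2_def)
  have pos_r: "0 < p_r r" if "r \<in> set_pmf pxr" for r using that by (simp add: p_r pmf_positive)
  have t: "pmf (t r) u = p_ru r u / p_r r" if "r \<in> set_pmf pxr" for r u
    using pos_r[OF that] by (simp add: p_ru p_r)
  have x: "pmf px x = p_xr x r / p_r r" if "r \<in> set_pmf pxr" for r x
    using pos_r[OF that] by (simp add: p_xr p_r)
  show "expect (t r) (e v r) \<le> 1" if r: "r \<in> set_pmf pxr" for v r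
  proof -
    have "expect (t r) (e v r) \<le> (\<Sum>u\<in>UNIV. p_rvu r v u / p_rv r v)"
      unfolding expect_UNIV t[OF r] e_def using pos_r[OF r] by (intro sum_mono cancel_ratio_le) auto
    also have "\<dots> \<le> 1" by (simp add: sum_divide_distrib[symmetric] marginals)
    finally show ?thesis .
  qed
  show "expect px (\<lambda>x. D1 x r y u) \<le> A1 r y u" if r: "r \<in> set_pmf pxr" for r y u
  proof -
    have "expect px (\<lambda>x. D1 x r y u) \<le> (\<Sum>x\<in>UNIV. p_xryu x r y u * p_r r / (p_ry r y * p_ru r u))"
      unfolding expect_UNIV x[OF r] 
    proof (rule sum_mono)
      fix x
      show "p_xr x r / p_r r * D1 x r y u \<le> p_xryu x r y u * p_r r / (p_ry r y * p_ru r u)"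
        using cancel_ratio_le(1)[OF pos_r[OF r], of "p_xryu x r y u * p_r r" "p_ry r y * p_ru r u" 0 "p_xr x r"]
        by (simp add: D1_def power2_eq_square mult_ac)
    qed
    also have "\<dots> = A1 r y u"
      by (simp add: A1_def marginals sum_divide_distrib[symmetric] sum_distrib_right[symmetric])
    finally show ?thesis .
  qed
  show "expect (t r) (D1 x r y) \<le> A2 x r y" if r: "r \<in> set_pmf pxr" for x r y
  proof -
    have "expect (t r) (D1 x r y) \<le> (\<Sum>u\<in>UNIV. p_xryu x r y u * p_r r / (p_xr x r * p_ry r y))"
      unfolding expect_UNIV t[OF r]
    proof (rule sum_mono)
      fix u
      show "p_ru r u / p_r r * D1 x r y u \<le> p_xryu x r y u * p_r r / (p_xr x r * p_ry r y)"
        using cancel_ratio_le(1)[OF pos_r[OF r], of "p_xryu x r y u * p_r r" "p_xr x r * p_ry r y" 0 "p_ru r u"]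
        by (simp add: D1_def power2_eq_square mult_ac)
    qed
    also have "\<dots> = A2 x r y"
      by (simp add: A2_def marginals sum_divide_distrib[symmetric] sum_distrib_right[symmetric])
    finally show ?thesis .
  qed
  show "expect px (\<lambda>x. A2 x r y) \<le> 1" if r: "r \<in> set_pmf pxr" for r y
  proof -
    have "expect px (\<lambda>x. A2 x r y) \<le> (\<Sum>x\<in>UNIV. p_xry x r y / p_ry r y)"
      unfolding expect_UNIV x[OF r] A2_def using pos_r[OF r] by (intro sum_mono cancel_ratio_le) auto
    also have "\<dots> \<le> 1" by (simp add: sum_divide_distrib[symmetric] marginals)
    finally show ?thesis .
  qed
  show "expect pxr (\<lambda>r. D2 r y) \<le> 1" for y
  proof -
    have "expect pxr (\<lambda>r. D2 r y) \<le> (\<Sum>r\<in>UNIV. p_ry r y / p_y y)"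
      unfolding expect_UNIV p_r[symmetric] D2_def
    proof (rule sum_mono)
      fix r
      show "p_r r * (p_ry r y / (p_r r * p_y y)) \<le> p_ry r y / p_y y" by (cases "p_r r = 0") auto
    qed
    also have "\<dots> \<le> 1" by (simp add: sum_divide_distrib[symmetric] marginals)
    finally show ?thesis .
  qed
  fix x r y v u assume *: "x \<in> set_pmf px" "r \<in> set_pmf pxr" "(y, v) \<in> set_pmf (W x r)"
  show "pmf (t r) u * e v r u = pmf (q v r) u"
  proof -
    \<comment> \<open>Any symbol of the test channel completes the letter and shows that (r, v) has
      positive probability.\<close>
    obtain u0 where "u0 \<in> set_pmf (q v r)" using set_pmf_not_empty[of "q v r"] by blast
    from p_pos[OF in_set_P[OF * this]] have pos: "0 < p_r r" "0 < p_rv r v" by auto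
    show ?thesis
    proof (cases "p_ru r u = 0")
      case True
      \<comment> \<open>Where \<open>p_ru\<close> vanishes the ratio \<open>e\<close> is
        meaningless, but then the larger marginal forces the test channel probability to be 0 as
        well.\<close>
      have "p_rvu r v u \<le> p_ru r u"
        unfolding p_rvu_def p_ru_def pmf_map by (intro measure_pmf.finite_measure_mono) auto
      then have "p_rvu r v u = 0" using True p_nonneg(7)[of r v u] by simp
      then have "pmf (q v r) u = 0" using pos by (simp add: p_rvu)
      then show ?thesis using True pos by (simp add: t[OF *(2)])
    next
      case False
      then show ?thesis using pos by (simp add: t[OF *(2)] e_def p_rvu)
    qed
  qed
  assume "u \<in> set_pmf (q v r)"
  from p_pos[OF in_set_P[OF * this]]
  show "0 < e v r u \<and> 0 < D1 x r y u \<and> 0 < A1 r y u \<and> 0 < A2 x r y \<and> 0 < D2 r y"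
    by (simp add: e_def D1_def A1_def A2_def D2_def)
qed

sublocale cf_letter px pxr W t q e D1 A1 A2 D2 by (rule single_letter)

section \<open>Mean logarithms of the weights as informations\<close>

lemma expect_letter:
  "expect letter (\<lambda>w. g (lx w) (lr w) (lz w) (lu w)) = expect P (\<lambda>(x, r, y, v, u). g x r (y, v) u)"
  "expect letter (\<lambda>w. h (lr2 w) (lz2 w)) = expect P (\<lambda>(x, r, y, v, u). h r (y, v))"
proof -
  have P: "P = do {x \<leftarrow> px; r \<leftarrow> pxr; z \<leftarrow> W x r; u \<leftarrow> q (snd z) r; return_pmf (x, r, fst z, snd z, u)}"
    using map_P[of "\<lambda>\<omega>. \<omega>"] by simp
  show "expect letter (\<lambda>w. g (lx w) (lr w) (lz w) (lu w)) = expect P (\<lambda>(x, r, y, v, u). g x r (y, v) u)"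
    unfolding letter_def P by (simp add: expect_bind set_bind_pmf)
  show "expect letter (\<lambda>w. h (lr2 w) (lz2 w)) = expect P (\<lambda>(x, r, y, v, u). h r (y, v))"
    unfolding letter_def P by (simp add: expect_bind set_bind_pmf)
qed

lemma expect_log:
  assumes "\<And>x r y v u. (x, r, y, v, u) \<in> set_pmf P \<Longrightarrow> F x r y v u = G (x, r, y, v, u)"
  shows "expect P (\<lambda>(x, r, y, v, u). F x r y v u) = expect P G"
  using assms by (intro expect_cong) auto

abbreviation "LM \<equiv> log_mean P"
abbreviation "L_r \<equiv> LM rv_Xr"
abbreviation "L_y \<equiv> LM rv_Y"
abbreviation "L_xr \<equiv> LM (\<lambda>\<omega>. (rv_X \<omega>, rv_Xr \<omega>))"
abbreviation "L_ru \<equiv> LM (\<lambda>\<omega>. (rv_Xr \<omega>, rv_Yh \<omega>))"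
abbreviation "L_rv \<equiv> LM (\<lambda>\<omega>. (rv_Xr \<omega>, rv_Yr \<omega>))"
abbreviation "L_ry \<equiv> LM (\<lambda>\<omega>. (rv_Xr \<omega>, rv_Y \<omega>))"
abbreviation "L_rvu \<equiv> LM (\<lambda>\<omega>. ((rv_Xr \<omega>, rv_Yr \<omega>), rv_Yh \<omega>))"
abbreviation "L_ryu \<equiv> LM (\<lambda>\<omega>. (rv_Xr \<omega>, rv_Y \<omega>, rv_Yh \<omega>))"
abbreviation "L_xry \<equiv> LM (\<lambda>\<omega>. (rv_X \<omega>, rv_Xr \<omega>, rv_Y \<omega>))"
abbreviation "L_xryu \<equiv> LM (\<lambda>\<omega>. (rv_X \<omega>, rv_Xr \<omega>, rv_Y \<omega>, rv_Yh \<omega>))"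
abbreviation "L_xryv \<equiv> LM (\<lambda>\<omega>. (rv_X \<omega>, rv_Xr \<omega>, rv_Y \<omega>, rv_Yr \<omega>))"
abbreviation "L_all \<equiv> LM (\<lambda>\<omega>. ((rv_X \<omega>, rv_Xr \<omega>, rv_Y \<omega>, rv_Yr \<omega>), rv_Yh \<omega>))"

lemma LM_p:
  "L_r = expect P (\<lambda>(x, r, y, v, u). log 2 (p_r r))" "L_y = expect P (\<lambda>(x, r, y, v, u). log 2 (p_y y))"
  "L_xr = expect P (\<lambda>(x, r, y, v, u). log 2 (p_xr x r))" "L_ru = expect P (\<lambda>(x, r, y, v, u). log 2 (p_ru r u))"
  "L_rv = expect P (\<lambda>(x, r, y, v, u). log 2 (p_rv r v))" "L_ry = expect P (\<lambda>(x, r, y, v, u). log 2 (p_ry r y))"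
  "L_rvu = expect P (\<lambda>(x, r, y, v, u). log 2 (p_rvu r v u))" "L_ryu = expect P (\<lambda>(x, r, y, v, u). log 2 (p_ryu r y u))"
  "L_xry = expect P (\<lambda>(x, r, y, v, u). log 2 (p_xry x r y))" "L_xryu = expect P (\<lambda>(x, r, y, v, u). log 2 (p_xryu x r y u))"
  unfolding log_mean_def by (intro expect_cong; auto simp: p_defs)+

lemma information_weights:
  "I_e = L_rvu + L_r - L_ru - L_rv"
  "I_a = L_xryu + L_r - L_xr - L_ryu"
  "I_b = L_xryu + L_r - L_ru - L_xry"
  "I_c = L_ry - L_r - L_y"
  "I_2 = L_xry + L_r - L_xr - L_ry"
proof -
  have fin_P: "finite (set_pmf P)" by simp
  show "I_e = L_rvu + L_r - L_ru - L_rv"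
    unfolding I_e_def w_e_def expect_letter(1)[of "\<lambda>x r z u. log 2 (e (snd z) r u)"]
    unfolding LM_p expect_add[OF fin_P, symmetric] expect_diff[OF fin_P, symmetric]
    proof (rule expect_log, goal_cases)
      case (1 x r y v u)
      from p_pos[OF this] show ?case by (simp add: e_def log_mult log_divide)
    qed
  show "I_a = L_xryu + L_r - L_xr - L_ryu"
    unfolding I_a_def w_D1_def w_A1_def expect_letter(1)[of "\<lambda>x r z u. log 2 (D1 x r (fst z) u / A1 r (fst z) u)"]
    unfolding LM_p expect_add[OF fin_P, symmetric] expect_diff[OF fin_P, symmetric]
    proof (rule expect_log, goal_cases)
      case (1 x r y v u)
      from p_pos[OF this] show ?case by (simp add: D1_def A1_def power2_eq_square log_mult log_divide)
    qed
  show "I_b = L_xryu + L_r - L_ru - L_xry"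
    unfolding I_b_def w_D1_def w_A2_def expect_letter(1)[of "\<lambda>x r z u. log 2 (D1 x r (fst z) u / A2 x r (fst z))"]
    unfolding LM_p expect_add[OF fin_P, symmetric] expect_diff[OF fin_P, symmetric]
    proof (rule expect_log, goal_cases)
      case (1 x r y v u)
      from p_pos[OF this] show ?case by (simp add: D1_def A2_def power2_eq_square log_mult log_divide)
    qed
  show "I_c = L_ry - L_r - L_y"
    unfolding I_c_def w_D2_def expect_letter(2)[of "\<lambda>r z. log 2 (D2 r (fst z))"]
    unfolding LM_p expect_add[OF fin_P, symmetric] expect_diff[OF fin_P, symmetric]
    proof (rule expect_log, goal_cases)
      case (1 x r y v u)
      from p_pos[OF this] show ?case by (simp add: D2_def log_mult log_divide)
    qed
  show "I_2 = L_xry + L_r - L_xr - L_ry"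
    unfolding I_2_def w_A2_def expect_letter(1)[of "\<lambda>x r z u. log 2 (A2 x r (fst z))"]
    unfolding LM_p expect_add[OF fin_P, symmetric] expect_diff[OF fin_P, symmetric]
    proof (rule expect_log, goal_cases)
      case (1 x r y v u)
      from p_pos[OF this] show ?case by (simp add: A2_def log_mult log_divide)
    qed
qed

text \<open>Yh_r depends on (X, X_r, Y, Y_r) only through (X_r, Y_r): both sides are the mean
  logarithm of the test channel probability.\<close>

lemma markov: "L_all - L_xryv = L_rvu - L_rv"
proof -
  have fin_P: "finite (set_pmf P)" by simp
  show ?thesis
    unfolding log_mean_def expect_diff[OF fin_P, symmetric]
  proof (rule expect_cong)
    fix \<omega> assume \<omega>: "\<omega> \<in> set_pmf P"
    obtain x r y v u where w: "\<omega> = (x, r, y, v, u)" by (metis prod_cases5)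
    have pos: "0 < pmf (map_pmf (\<lambda>\<omega>. (rv_X \<omega>, rv_Xr \<omega>, rv_Y \<omega>, rv_Yr \<omega>)) P) (x, r, y, v)"
      using pmf_map_pos[OF \<omega>, of "\<lambda>\<omega>. (rv_X \<omega>, rv_Xr \<omega>, rv_Y \<omega>, rv_Yr \<omega>)"] by (simp add: w)
    have "0 < p_rv r v" "0 < p_rvu r v u" using p_pos[of x r y v u] \<omega> w by auto
    then have "0 < pmf (q v r) u" by (simp add: p_rvu zero_less_mult_iff)
    with pos \<open>0 < p_rv r v\<close> show "log 2 (pmf (map_pmf (\<lambda>\<omega>. ((rv_X \<omega>, rv_Xr \<omega>, rv_Y \<omega>, rv_Yr \<omega>), rv_Yh \<omega>)) P)
           ((rv_X \<omega>, rv_Xr \<omega>, rv_Y \<omega>, rv_Yr \<omega>), rv_Yh \<omega>)) -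
         log 2 (pmf (map_pmf (\<lambda>\<omega>. (rv_X \<omega>, rv_Xr \<omega>, rv_Y \<omega>, rv_Yr \<omega>)) P) (rv_X \<omega>, rv_Xr \<omega>, rv_Y \<omega>, rv_Yr \<omega>)) =
         log 2 (pmf (map_pmf (\<lambda>\<omega>. ((rv_Xr \<omega>, rv_Yr \<omega>), rv_Yh \<omega>)) P) ((rv_Xr \<omega>, rv_Yr \<omega>), rv_Yh \<omega>)) -
         log 2 (pmf (map_pmf (\<lambda>\<omega>. (rv_Xr \<omega>, rv_Yr \<omega>)) P) (rv_Xr \<omega>, rv_Yr \<omega>))"
      by (simp add: w p_all p_rvu_def[symmetric] p_rv_def[symmetric] p_rvu log_mult)
  qed
qed

text \<open>All but the last are comparisons of entropies. In the last, \<open>markov\<close>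
  replaces the entropy of Yh_r given (X, X_r, Y, Y_r) by that given (X_r, Y_r), which leaves I_e -
  I_b.\<close>

lemma mutual_infos:
  "mutual_info P rv_Xr rv_Y = I_c"
  "mutual_info P (\<lambda>\<omega>. (rv_X \<omega>, rv_Xr \<omega>)) rv_Y = I_2 + I_c"
  "cond_mutual_info P rv_Yh (\<lambda>\<omega>. (rv_X \<omega>, rv_Y \<omega>)) rv_Xr = I_b"
  "cond_mutual_info P rv_Yh rv_Yr rv_Xr = I_e"
  "cond_mutual_info P rv_X (\<lambda>\<omega>. (rv_Y \<omega>, rv_Yh \<omega>)) rv_Xr = I_a"
  "cond_mutual_info P rv_Yh rv_Yr (\<lambda>\<omega>. (rv_X \<omega>, rv_Xr \<omega>, rv_Y \<omega>)) = I_e - I_b"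
proof -
  have r1: "LM (\<lambda>\<omega>. ((rv_X \<omega>, rv_Xr \<omega>), rv_Y \<omega>)) = L_xry"
    by (rule log_mean_reorder[where f = "\<lambda>((x, r), y). (x, r, y)"]) (auto simp: inj_def)
  have r2: "LM (\<lambda>\<omega>. (rv_Yh \<omega>, (rv_X \<omega>, rv_Y \<omega>), rv_Xr \<omega>)) = L_xryu"
    by (rule log_mean_reorder[where f = "\<lambda>(u, (x, y), r). (x, r, y, u)"]) (auto simp: inj_def)
  have r3: "LM (\<lambda>\<omega>. (rv_Yh \<omega>, rv_Xr \<omega>)) = L_ru"
    by (rule log_mean_reorder[where f = "\<lambda>(u, r). (r, u)"]) (auto simp: inj_def)
  have r4: "LM (\<lambda>\<omega>. ((rv_X \<omega>, rv_Y \<omega>), rv_Xr \<omega>)) = L_xry"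
    by (rule log_mean_reorder[where f = "\<lambda>((x, y), r). (x, r, y)"]) (auto simp: inj_def)
  have r5: "LM (\<lambda>\<omega>. (rv_Yh \<omega>, rv_Yr \<omega>, rv_Xr \<omega>)) = L_rvu"
    by (rule log_mean_reorder[where f = "\<lambda>(u, v, r). ((r, v), u)"]) (auto simp: inj_def)
  have r6: "LM (\<lambda>\<omega>. (rv_Yr \<omega>, rv_Xr \<omega>)) = L_rv"
    by (rule log_mean_reorder[where f = "\<lambda>(v, r). (r, v)"]) (auto simp: inj_def)
  have r7: "LM (\<lambda>\<omega>. (rv_X \<omega>, (rv_Y \<omega>, rv_Yh \<omega>), rv_Xr \<omega>)) = L_xryu"
    by (rule log_mean_reorder[where f = "\<lambda>(x, (y, u), r). (x, r, y, u)"]) (auto simp: inj_def)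
  have r8: "LM (\<lambda>\<omega>. ((rv_Y \<omega>, rv_Yh \<omega>), rv_Xr \<omega>)) = L_ryu"
    by (rule log_mean_reorder[where f = "\<lambda>((y, u), r). (r, y, u)"]) (auto simp: inj_def)
  have r9: "LM (\<lambda>\<omega>. (rv_Yh \<omega>, rv_Yr \<omega>, rv_X \<omega>, rv_Xr \<omega>, rv_Y \<omega>)) = L_all"
    by (rule log_mean_reorder[where f = "\<lambda>(u, v, x, r, y). ((x, r, y, v), u)"]) (auto simp: inj_def)
  have r10: "LM (\<lambda>\<omega>. (rv_Yh \<omega>, rv_X \<omega>, rv_Xr \<omega>, rv_Y \<omega>)) = L_xryu"
    by (rule log_mean_reorder[where f = "\<lambda>(u, x, r, y). (x, r, y, u)"]) (auto simp: inj_def)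
  have r11: "LM (\<lambda>\<omega>. (rv_Yr \<omega>, rv_X \<omega>, rv_Xr \<omega>, rv_Y \<omega>)) = L_xryv"
    by (rule log_mean_reorder[where f = "\<lambda>(v, x, r, y). (x, r, y, v)"]) (auto simp: inj_def)
  show "mutual_info P rv_Xr rv_Y = I_c"
    "mutual_info P (\<lambda>\<omega>. (rv_X \<omega>, rv_Xr \<omega>)) rv_Y = I_2 + I_c"
    "cond_mutual_info P rv_Yh (\<lambda>\<omega>. (rv_X \<omega>, rv_Y \<omega>)) rv_Xr = I_b"
    "cond_mutual_info P rv_Yh rv_Yr rv_Xr = I_e"
    "cond_mutual_info P rv_X (\<lambda>\<omega>. (rv_Y \<omega>, rv_Yh \<omega>)) rv_Xr = I_a"
    "cond_mutual_info P rv_Yh rv_Yr (\<lambda>\<omega>. (rv_X \<omega>, rv_Xr \<omega>, rv_Y \<omega>)) = I_e - I_b"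
    using markov
    by (simp_all add: mutual_info_eq cond_mutual_info_eq information_weights r1 r2 r3 r4 r5 r6 r7 r8 r9 r10 r11)
qed

end

text \<open>At R = 0 there is no smaller nonnegative rate to approximate from, but a single message
  is decoded without error.\<close>

lemma zero_rate_code:
  "\<exists>c. (\<forall>n. is_code 0 n (c n)) \<and> (\<lambda>n. error_prob W 0 n (c n)) \<longlonglongrightarrow> 0"
proof -
  define c :: "nat \<Rightarrow> ('a, 'b, 'c, 'd) relay_code" where
    "c n = \<lparr>encoder = \<lambda>_. replicate n undefined, relay_encoder = \<lambda>_ _. undefined, decoder = \<lambda>_. Some 1\<rparr>" for n
  have mes: "messages 0 n = {1}" for n by (simp add: messages_def)
  have "is_code 0 n (c n)" for n by (simp add: is_code_def c_def mes)
  moreover have "error_prob W 0 n (c n) = 0" for n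
    by (auto simp: error_prob_def message_estimate_def mes c_def measure_pmf_zero_iff set_bind_pmf pmf_of_set_singleton)
  ultimately show ?thesis by (intro exI[of _ c]) simp
qed

theorem theorem1:
  fixes W :: "('x::finite, 'xr::finite, 'y::finite, 'yr::finite) relay_channel"
    and px :: "'x pmf" and pxr :: "'xr pmf"
    and q :: "'yr \<Rightarrow> 'xr \<Rightarrow> ('yh::finite) pmf"
    and P :: "('x \<times> 'xr \<times> 'y \<times> 'yr \<times> 'yh) pmf"
    and R :: real
  assumes "P = joint_pmf W px pxr q"
    and "mutual_info P rv_Xr rv_Y
           + cond_mutual_info P rv_Yh (\<lambda>\<omega>. (rv_X \<omega>, rv_Y \<omega>)) rv_Xr
         \<ge> cond_mutual_info P rv_Yh rv_Yr rv_Xr"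
    and "R \<ge> 0"
    and "R \<le> min
           (mutual_info P (\<lambda>\<omega>. (rv_X \<omega>, rv_Xr \<omega>)) rv_Y
              - cond_mutual_info P rv_Yh rv_Yr (\<lambda>\<omega>. (rv_X \<omega>, rv_Xr \<omega>, rv_Y \<omega>)))
           (cond_mutual_info P rv_X (\<lambda>\<omega>. (rv_Y \<omega>, rv_Yh \<omega>)) rv_Xr)"
  shows "achievable W R"
proof -
  interpret J: relay_joint W px pxr q .
  have P: "P = J.P" using assms(1) by (simp add: J.P_def)
  note infos = J.mutual_infos[folded P]
  let ?S = "{R'. R' \<ge> 0 \<and> (\<exists>c. (\<forall>n. is_code R' n (c n)) \<and> (\<lambda>n. error_prob W R' n (c n)) \<longlonglongrightarrow> 0)}"
  \<comment> \<open>The coding theorem gives rates strictly below R; the closure in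
    \<open>achievable\<close> adds R itself. The two sign conditions on informations are
    nonnegativity of I(X_r; Y) and of I(Yh_r; Y_r | X, X_r, Y).\<close>
  have below: "R' \<in> ?S" if "0 \<le> R'" "R' < R" for R'
  proof -
    have "0 \<le> J.I_c" using mutual_info_eq(2)[of P rv_Xr rv_Y] by (simp only: infos)
    moreover have "J.I_b \<le> J.I_e"
      using cond_mutual_info_eq(2)[of P rv_Yh rv_Yr "\<lambda>\<omega>. (rv_X \<omega>, rv_Xr \<omega>, rv_Y \<omega>)"] by (simp only: infos)
    ultimately show ?thesis
      using J.codes_of_rate_below[OF that] that(1) assms(2,4) by (simp add: infos)
  qed
  have "R \<in> closure ?S"
  proof (cases "R = 0")
    case True
    have "R \<in> ?S" unfolding True using zero_rate_code[of W] by (intro CollectI conjI order_refl)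
    then show ?thesis by (rule subsetD[OF closure_subset])
  next
    case False
    show ?thesis
      unfolding closure_approachable
    proof (intro allI impI)
      fix d :: real assume "0 < d"
      have "0 \<le> max 0 (R - d / 2)" "max 0 (R - d / 2) < R"
        using \<open>0 < d\<close> False assms(3) by auto
      then have "max 0 (R - d / 2) \<in> ?S" by (rule below)
      moreover have "dist (max 0 (R - d / 2)) R < d"
        using \<open>0 < d\<close> assms(3) by (auto simp: dist_real_def)
      ultimately show "\<exists>R'\<in>?S. dist R' R < d" by blast
    qed
  qed
  then show ?thesis by (simp add: achievable_def)
qed

end
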